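(* Let $\Theta$ be a continuous ellipsoid cover of $\mathbb{R}^n$, let $0<p\le1$, $1<q<\infty$, and let $l\in\mathbb{N}_0$ with $l\ge N_p(\Theta)$. Then for any $f\in L^q\cap H^p(\Theta)$ there exist a sequence of $(p,\infty,l)$-atoms $\{a_i^k\}_{k\in\mathbb{Z},\,i\in\mathbb{N}_0}$, a sequence $\{\lambda_i^k\}_{k\in\mathbb{Z},\,i\in\mathbb{N}_0}\subset\mathbb{C}$, and a positive constant $C$ independent of $f$ such that $$\sum_{k\in\mathbb{Z}}\sum_{i\in\mathbb{N}_0}|\lambda_i^k|^p\le C\|f\|^p_{H^p(\Theta)}$$ and $$f=\sum_{k\in\mathbb{Z}}\sum_{i\in\mathbb{N}_0}\lambda_i^ka_i^k\qquad\text{converges in }L^q.$$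
   Context: **Ellipsoid covers.** Let $\mathbb{B}^n=\{x\in\mathbb{R}^n:|x|<1\}$ and $\|M\|=\max_{|x|=1}|Mx|$ for a matrix $M$. A continuous ellipsoid cover of $\mathbb{R}^n$ is a family $\Theta=\{\theta_{x,t}:x\in\mathbb{R}^n,t\in\mathbb{R}\}$ of ellipsoids $\theta_{x,t}=M_{x,t}(\mathbb{B}^n)+x$, with $M_{x,t}$ an invertible $n\times n$ real matrix, for which there are positive constants $\mathbf{p}(\Theta)=\{a_1,\ldots,a_6\}$ such that (i) $a_12^{-t}\le|\theta_{x,t}|\le a_22^{-t}$ for all $x\in\mathbb{R}^n,t\in\mathbb{R}$; (ii) for all $x,y\in\mathbb{R}^n$, $t\in\mathbb{R}$, $s\ge0$ with $\theta_{x,t}\cap\theta_{y,t+s}\neq\emptyset$, $$a_32^{-a_4s}\le 1/\|(M_{y,t+s})^{-1}M_{x,t}\|\le\|(M_{x,t})^{-1}M_{y,t+s}\|\le a_52^{-a_6s}.$$ **Hardy space.** $N_p=N_p(\Theta)$ is the minimal integer $>\frac{\max(1,a_4)n+1}{a_6p}$ and $\widetilde N_p=\widetilde N_p(\Theta)$ the minimal integer $>\frac{a_4N_p(\Theta)+1}{a_6}$. For integers $0\le N\le\widetilde N$ let $\|\varphi\|_{N,\widetilde N}=\max_{|\alpha|\le N}\sup_y(1+|y|)^{\widetilde N}|\partial^\alpha\varphi(y)|$ and $\mathcal{S}_{N,\widetilde N}=\{\varphi\in\mathcal{S}:\|\varphi\|_{N,\widetilde N}\le1\}$, where $\mathcal{S}$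 is the Schwartz space on $\mathbb{R}^n$. Put $\varphi_{x,t}(y)=|\det(M_{x,t}^{-1})|\varphi(M_{x,t}^{-1}y)$. For a tempered distribution $f\in\mathcal{S}'$ define $M^\circ f(x)=\sup_{\varphi\in\mathcal{S}_{N_p,\widetilde N_p}}\sup_{t\in\mathbb{R}}|f*\varphi_{x,t}(x)|$. Then $H^p(\Theta)=\{f\in\mathcal{S}':M^\circ f\in L^p\}$ with quasi-norm $\|f\|_{H^p(\Theta)}=\|M^\circ f\|_p$. **Atoms.** A $(p,\infty,l)$-atom is a function $a:\mathbb{R}^n\to\mathbb{R}$ such that: $\operatorname{supp}a\subset\theta_{x,t}$ for some $\theta_{x,t}\in\Theta$ ($x\in\mathbb{R}^n,t\in\mathbb{R}$); $\|a\|_\infty\le|\theta_{x,t}|^{-1/p}$; and $\int_{\mathbb{R}^n}a(y)y^\alpha dy=0$ for all $\alpha\in\mathbb{N}_0^n$ with $|\alpha|\le l$. *)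

theory Defs
  imports "HOL-Probability.Essential_Supremum"
begin

section \<open>Continuous ellipsoid covers\<close>

definition ellipsoid :: "(real^'n \<Rightarrow> real \<Rightarrow> real^'n^'n) \<Rightarrow> real^'n \<Rightarrow> real \<Rightarrow> (real^'n) set" where
  "ellipsoid M x t = (\<lambda>v. M x t *v v + x) ` ball 0 1"

definition mat_norm :: "real^'n^'n \<Rightarrow> real" where
  "mat_norm A = onorm ((*v) A)"

text \<open>A cover is given by its family of matrices \<open>M x t\<close>; the constants
  \<open>a1, \<dots>, a6\<close> are part of the data, since the Hardy space depends on \<open>a4\<close> and \<open>a6\<close>.\<close>

definition continuous_ellipsoid_cover ::
  "(real^'n \<Rightarrow> real \<Rightarrow> real^'n^'n) \<Rightarrow> real \<Rightarrow> real \<Rightarrow> real \<Rightarrow> real \<Rightarrow> real \<Rightarrow> real \<Rightarrow> bool" where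
  "continuous_ellipsoid_cover M a1 a2 a3 a4 a5 a6 \<longleftrightarrow>
     0 < a1 \<and> 0 < a2 \<and> 0 < a3 \<and> 0 < a4 \<and> 0 < a5 \<and> 0 < a6 \<and>
     (\<forall>x t. invertible (M x t)) \<and>
     (\<forall>x t. a1 * 2 powr (- t) \<le> measure lebesgue (ellipsoid M x t) \<and>
            measure lebesgue (ellipsoid M x t) \<le> a2 * 2 powr (- t)) \<and>
     (\<forall>x y t s. 0 \<le> s \<longrightarrow> ellipsoid M x t \<inter> ellipsoid M y (t + s) \<noteq> {} \<longrightarrow>
        a3 * 2 powr (- a4 * s) \<le> 1 / mat_norm (matrix_inv (M y (t + s)) ** M x t) \<and>
        1 / mat_norm (matrix_inv (M y (t + s)) ** M x t)
          \<le> mat_norm (matrix_inv (M x t) ** M y (t + s)) \<and>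
        mat_norm (matrix_inv (M x t) ** M y (t + s)) \<le> a5 * 2 powr (- a6 * s))"


section \<open>Lebesgue spaces\<close>

definition Lp_space :: "real \<Rightarrow> (real^'n \<Rightarrow> 'b::real_normed_vector) set" where
  "Lp_space p = {f \<in> borel_measurable lebesgue. integrable lebesgue (\<lambda>x. norm (f x) powr p)}"

definition Lp_norm :: "real \<Rightarrow> (real^'n \<Rightarrow> 'b::real_normed_vector) \<Rightarrow> real" where
  "Lp_norm p f = (LINT x|lebesgue. norm (f x) powr p) powr (1 / p)"

definition Lp_tendsto ::
  "real \<Rightarrow> ('i \<Rightarrow> real^'n \<Rightarrow> 'b::real_normed_vector) \<Rightarrow> (real^'n \<Rightarrow> 'b) \<Rightarrow> 'i filter \<Rightarrow> bool" where
  "Lp_tendsto p u g F \<longleftrightarrow>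
     g \<in> Lp_space p \<and> (\<forall>\<^sub>F m in F. u m \<in> Lp_space p) \<and>
     ((\<lambda>m. Lp_norm p (\<lambda>x. u m x - g x)) \<longlongrightarrow> 0) F"

text \<open>Convergence in \<open>L\<^sup>p\<close> of the iterated series \<open>f = \<Sum>\<^sub>k \<Sum>\<^sub>i u k i\<close>: each inner series converges
  to some \<open>g k\<close>, and the two-sided partial sums of the \<open>g k\<close> converge to \<open>f\<close> when both ends of
  the summation range tend to infinity independently.\<close>

definition Lp_double_sums ::
  "real \<Rightarrow> (int \<Rightarrow> nat \<Rightarrow> real^'n \<Rightarrow> 'b::real_normed_vector) \<Rightarrow> (real^'n \<Rightarrow> 'b) \<Rightarrow> bool" where
  "Lp_double_sums p u f \<longleftrightarrow>
     (\<exists>g. (\<forall>k. Lp_tendsto p (\<lambda>m x. \<Sum>i<m. u k i x) (g k) sequentially) \<and>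
          Lp_tendsto p (\<lambda>(l, m) x. \<Sum>k=l..m. g k x) f (at_bot \<times>\<^sub>F at_top))"


section \<open>Schwartz functions and tempered distributions\<close>

definition partial_deriv :: "'n \<Rightarrow> (real^'n \<Rightarrow> complex) \<Rightarrow> real^'n \<Rightarrow> complex" where
  "partial_deriv i \<phi> x = vector_derivative (\<lambda>h. \<phi> (x + h *\<^sub>R axis i 1)) (at 0)"

definition smooth :: "(real^'n \<Rightarrow> complex) \<Rightarrow> bool" where
  "smooth \<phi> \<longleftrightarrow> (\<forall>is x. foldr partial_deriv is \<phi> differentiable (at x))"

definition mi_abs :: "('n::finite \<Rightarrow> nat) \<Rightarrow> nat" where
  "mi_abs \<alpha> = (\<Sum>i\<in>UNIV. \<alpha> i)"

text \<open>The index type \<open>'n\<close> carries no order, so an arbitrary enumeration of the multi-index is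
  chosen; for smooth functions the result does not depend on it.\<close>

definition mi_deriv :: "('n::finite \<Rightarrow> nat) \<Rightarrow> (real^'n \<Rightarrow> complex) \<Rightarrow> real^'n \<Rightarrow> complex" where
  "mi_deriv \<alpha> \<phi> = foldr partial_deriv (SOME is. \<forall>i. count_list is i = \<alpha> i) \<phi>"

definition schwartz :: "(real^'n \<Rightarrow> complex) set" where
  "schwartz = {\<phi>. smooth \<phi> \<and>
     (\<forall>\<alpha> m. bdd_above (range (\<lambda>y. (1 + norm y) ^ m * cmod (mi_deriv \<alpha> \<phi> y))))}"

definition schwartz_norm :: "nat \<Rightarrow> nat \<Rightarrow> (real^'n \<Rightarrow> complex) \<Rightarrow> real" where
  "schwartz_norm N Nt \<phi> =
     (MAX \<alpha>\<in>{\<alpha>. mi_abs \<alpha> \<le> N}. SUP y. (1 + norm y) ^ Nt * cmod (mi_deriv \<alpha> \<phi> y))"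

definition schwartz_unit :: "nat \<Rightarrow> nat \<Rightarrow> (real^'n \<Rightarrow> complex) set" where
  "schwartz_unit N Nt = {\<phi> \<in> schwartz. schwartz_norm N Nt \<phi> \<le> 1}"

text \<open>A tempered distribution is a linear functional on Schwartz functions that is continuous,
  i.e. bounded by one of the (directed) defining norms; its values outside
  \<open>schwartz\<close> are irrelevant.\<close>

definition tempered :: "((real^'n \<Rightarrow> complex) \<Rightarrow> complex) \<Rightarrow> bool" where
  "tempered F \<longleftrightarrow>
     (\<forall>\<phi>\<in>schwartz. \<forall>\<psi>\<in>schwartz. F (\<lambda>y. \<phi> y + \<psi> y) = F \<phi> + F \<psi>) \<and>
     (\<forall>c. \<forall>\<phi>\<in>schwartz. F (\<lambda>y. c * \<phi> y) = c * F \<phi>) \<and>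
     (\<exists>C N Nt. \<forall>\<phi>\<in>schwartz. cmod (F \<phi>) \<le> C * schwartz_norm N Nt \<phi>)"

definition distribution_of :: "(real^'n \<Rightarrow> complex) \<Rightarrow> (real^'n \<Rightarrow> complex) \<Rightarrow> complex" where
  "distribution_of f \<phi> = (LINT y|lebesgue. f y * \<phi> y)"

definition dist_conv ::
  "((real^'n \<Rightarrow> complex) \<Rightarrow> complex) \<Rightarrow> (real^'n \<Rightarrow> complex) \<Rightarrow> real^'n \<Rightarrow> complex" where
  "dist_conv F \<phi> x = F (\<lambda>y. \<phi> (x - y))"


section \<open>Hardy spaces of an ellipsoid cover\<close>

text \<open>In both cases the lower bound is positive, so the minimal integer is a natural number.\<close>

definition Np :: "nat \<Rightarrow> real \<Rightarrow> real \<Rightarrow> real \<Rightarrow> nat" where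
  "Np n a4 a6 p = (LEAST N. real N > (max 1 a4 * real n + 1) / (a6 * p))"

definition Np_tilde :: "nat \<Rightarrow> real \<Rightarrow> real \<Rightarrow> real \<Rightarrow> nat" where
  "Np_tilde n a4 a6 p = (LEAST N. real N > (a4 * real (Np n a4 a6 p) + 1) / a6)"

definition dilate ::
  "(real^'n \<Rightarrow> real \<Rightarrow> real^'n^'n) \<Rightarrow> (real^'n \<Rightarrow> complex) \<Rightarrow> real^'n \<Rightarrow> real \<Rightarrow> real^'n \<Rightarrow> complex" where
  "dilate M \<phi> x t y =
     complex_of_real \<bar>det (matrix_inv (M x t))\<bar> * \<phi> (matrix_inv (M x t) *v y)"

definition radial_grand_maximal ::
  "(real^'n \<Rightarrow> real \<Rightarrow> real^'n^'n) \<Rightarrow> real \<Rightarrow> real \<Rightarrow> real \<Rightarrow>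
   ((real^'n \<Rightarrow> complex) \<Rightarrow> complex) \<Rightarrow> real^'n \<Rightarrow> ennreal" where
  "radial_grand_maximal M a4 a6 p F x =
     (SUP \<phi>\<in>schwartz_unit (Np CARD('n) a4 a6 p) (Np_tilde CARD('n) a4 a6 p). SUP t.
        ennreal (cmod (dist_conv F (dilate M \<phi> x t) x)))"

text \<open>The maximal function takes values in \<open>[0, \<infinity>]\<close>. As \<open>enn2real\<close> maps \<open>\<infinity>\<close> to \<open>0\<close>,
  membership in \<open>L\<^sup>p\<close> has to require finiteness almost everywhere.\<close>

definition Hp ::
  "(real^'n \<Rightarrow> real \<Rightarrow> real^'n^'n) \<Rightarrow> real \<Rightarrow> real \<Rightarrow> real \<Rightarrow> ((real^'n \<Rightarrow> complex) \<Rightarrow> complex) set" where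
  "Hp M a4 a6 p = {F. tempered F \<and>
     radial_grand_maximal M a4 a6 p F \<in> borel_measurable lebesgue \<and>
     (AE x in lebesgue. radial_grand_maximal M a4 a6 p F x < \<infinity>) \<and>
     (\<lambda>x. enn2real (radial_grand_maximal M a4 a6 p F x)) \<in> Lp_space p}"

definition Hp_norm ::
  "(real^'n \<Rightarrow> real \<Rightarrow> real^'n^'n) \<Rightarrow> real \<Rightarrow> real \<Rightarrow> real \<Rightarrow> ((real^'n \<Rightarrow> complex) \<Rightarrow> complex) \<Rightarrow> real" where
  "Hp_norm M a4 a6 p F = Lp_norm p (\<lambda>x. enn2real (radial_grand_maximal M a4 a6 p F x))"


section \<open>Atoms\<close>

definition is_atom ::
  "(real^'n \<Rightarrow> real \<Rightarrow> real^'n^'n) \<Rightarrow> real \<Rightarrow> nat \<Rightarrow> (real^'n \<Rightarrow> real) \<Rightarrow> bool" where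
  "is_atom M p l a \<longleftrightarrow>
     a \<in> borel_measurable lebesgue \<and>
     (\<exists>x t. closure {y. a y \<noteq> 0} \<subseteq> ellipsoid M x t \<and>
        esssup lebesgue (\<lambda>y. ereal \<bar>a y\<bar>)
          \<le> ereal (measure lebesgue (ellipsoid M x t) powr (- 1 / p))) \<and>
     (\<forall>\<alpha>. mi_abs \<alpha> \<le> l \<longrightarrow> (LINT y|lebesgue. a y * (\<Prod>i\<in>UNIV. (y $ i) ^ \<alpha> i)) = 0)"

end

theory Submission
  imports Defs
begin

text \<open>The atoms are the pieces of Calderon--Zygmund decompositions of \<open>f\<close> at all dyadic heights. Real and
  imaginary parts are decomposed separately, so let \<open>f\<close> be real.

  For a point \<open>x\<close> let \<open>M f x\<close> be the supremum of the normalised integrals of \<open>f\<close> against smooth bumps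
  adapted to any ellipsoid of the cover that contains \<open>x\<close>. The sets \<open>{M f > 2\<^sup>k}\<close> are open, being unions
  of ellipsoids. Two ellipsoids of the same scale that meet are comparable, so a bump adapted to one is,
  up to a constant, a bump adapted to the other; therefore \<open>M f\<close> is bounded by the radial grand maximal
  function, see \<open>maximal_le_radial\<close>.

  Each of these sets \<open>\<Omega>\<^sub>k\<close> has a Whitney cover by ellipsoids of bounded overlap, \<open>whitney_exists\<close>, and a
  subordinate smooth partition of unity \<open>\<phi>\<^sub>i\<close>. Let \<open>p\<^sub>i\<close> be the polynomial of degree at most \<open>d\<close>, cut off to the
  \<open>i\<close>th ellipsoid, that has the same moments as \<open>f \<phi>\<^sub>i\<close>, and let \<open>g\<^sub>k\<close> be \<open>f\<close> off \<open>\<Omega>\<^sub>k\<close> and \<open>\<Sum> p\<^sub>i\<close> on \<open>\<Omega>\<^sub>k\<close>. A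
  Whitney ellipsoid, slightly enlarged, contains points where \<open>M f\<close> is at most \<open>2\<^sup>k\<close>, so the moments that
  determine \<open>p\<^sub>i\<close> are of this size, \<open>approx_bound\<close>. Off \<open>\<Omega>\<^sub>k\<close> the function \<open>f\<close> itself is bounded by a
  multiple of \<open>2\<^sup>k\<close> almost everywhere, \<open>AE_le_of_maximal\<close>. Altogether \<open>\<bar>g\<^sub>k\<bar> \<le> C 2\<^sup>k\<close>.

  The difference of \<open>g\<close> at the heights \<open>k + 1\<close> and \<open>k\<close> is the sum over \<open>i\<close> of the pieces
  \<open>h\<^sub>i = g' \<phi>\<^sub>i - p\<^sub>i + \<Sum>\<^sub>j \<pi>\<^sub>j ((f \<phi>'\<^sub>j - p'\<^sub>j) \<phi>\<^sub>i)\<close>, where primes refer to the height \<open>k + 1\<close> and \<open>\<pi>\<^sub>j\<close> projects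
  onto polynomials on the \<open>j\<close>th ellipsoid of the finer cover. The last sum restores the vanishing of the
  moments of \<open>h\<^sub>i\<close>, \<open>piece_moment\<close>, and it cancels when it is added up over \<open>i\<close>, \<open>pieces_sum\<close>. The piece \<open>h\<^sub>i\<close>
  is bounded by \<open>C 2\<^sup>k\<close> and lives on the \<open>i\<close>th Whitney ellipsoid, so it is an atom times a coefficient
  whose \<open>p\<close>th power is comparable to \<open>2\<^sup>k\<^sup>p\<close> times the volume of the ellipsoid. By bounded overlap these
  powers add up to at most a multiple of \<open>\<Sum>\<^sub>k 2\<^sup>k\<^sup>p \<bar>\<Omega>\<^sub>k\<bar>\<close>, hence of the integral of \<open>(M f)\<^sup>p\<close>.

  The series over \<open>i\<close> converges by dominated convergence. The series over \<open>k\<close> telescopes, and it remains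
  that \<open>g\<^sub>k\<close> tends to \<open>f\<close> upwards and to zero downwards in \<open>L\<^sup>q\<close>. The first holds because the \<open>L\<^sup>q\<close> norm of
  \<open>f - g\<^sub>k\<close> is bounded by that of \<open>f\<close> on \<open>\<Omega>\<^sub>k\<close>, \<open>approx_Lq\<close>. For the second, off \<open>\<Omega>\<^sub>k\<close> it is \<open>f\<close> that tends to
  zero, since \<open>f\<close> vanishes almost everywhere where \<open>M f\<close> does, and on \<open>\<Omega>\<^sub>k\<close> the bound on \<open>g\<^sub>k\<close> gives at most
  \<open>C 2\<^sup>k\<^sup>q \<bar>\<Omega>\<^sub>k\<bar>\<close>, which is at most a multiple of \<open>2\<close> to the power \<open>k (q - p)\<close>.\<close>

section \<open>Functions with bounded derivatives\<close>

text \<open>The partial derivatives are quantified existentially instead of being computed by an operator: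
  closure under sums, products and compositions is then a plain induction on the order,
  because each proof exhibits the partial derivatives of the compound function.\<close>

primrec bounded_derivs :: "nat \<Rightarrow> real \<Rightarrow> (real^'n) set \<Rightarrow> (real^'n \<Rightarrow> real) \<Rightarrow> bool" where
  "bounded_derivs 0 K S f \<longleftrightarrow> (\<forall>x\<in>S. \<bar>f x\<bar> \<le> K)"
| "bounded_derivs (Suc N) K S f \<longleftrightarrow> (\<forall>x\<in>S. \<bar>f x\<bar> \<le> K) \<and>
     (\<exists>D. (\<forall>x\<in>S. (f has_derivative (\<lambda>h. \<Sum>i\<in>UNIV. D i x * h $ i)) (at x)) \<and>
          (\<forall>i. bounded_derivs N K S (D i)))"

lemma bounded_derivs_bound: "bounded_derivs N K S f \<Longrightarrow> x \<in> S \<Longrightarrow> \<bar>f x\<bar> \<le> K"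
  by (cases N) auto

lemma bounded_derivs_mono:
  assumes "bounded_derivs N K S f" "K \<le> K'" "S' \<subseteq> S"
  shows "bounded_derivs N K' S' f"
  using assms
proof (induction N arbitrary: f)
  case 0 then show ?case by force
next
  case (Suc N)
  from Suc.prems(1) obtain D where
    D: "\<forall>x\<in>S. (f has_derivative (\<lambda>h. \<Sum>i\<in>UNIV. D i x * h $ i)) (at x)" "\<forall>i. bounded_derivs N K S (D i)"
    and b: "\<forall>x\<in>S. \<bar>f x\<bar> \<le> K" by auto
  have "\<forall>i. bounded_derivs N K' S' (D i)" using Suc.IH D(2) Suc.prems by blast
  moreover have "\<forall>x\<in>S'. \<bar>f x\<bar> \<le> K'" using b Suc.prems by force
  moreover have "\<forall>x\<in>S'. (f has_derivative (\<lambda>h. \<Sum>i\<in>UNIV. D i x * h $ i)) (at x)"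
    using D(1) Suc.prems(3) by blast
  ultimately show ?case unfolding bounded_derivs.simps by blast
qed

lemma bounded_derivs_lower:
  "bounded_derivs (Suc N) K S f \<Longrightarrow> bounded_derivs N K S f"
proof (induction N arbitrary: f)
  case 0 then show ?case by (auto intro: bounded_derivs_bound)
next
  case (Suc N)
  from Suc.prems obtain D where
    D: "\<forall>x\<in>S. (f has_derivative (\<lambda>h. \<Sum>i\<in>UNIV. D i x * h $ i)) (at x)" "\<forall>i. bounded_derivs (Suc N) K S (D i)"
    and b: "\<forall>x\<in>S. \<bar>f x\<bar> \<le> K" unfolding bounded_derivs.simps(2)[of "Suc N"] by blast
  from D(2) Suc.IH have "\<forall>i. bounded_derivs N K S (D i)" by blast
  with D(1) b show ?case unfolding bounded_derivs.simps(2)[of N] by blast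
qed

lemma bounded_derivs_cong:
  assumes "open S" "\<And>x. x \<in> S \<Longrightarrow> f x = g x" "bounded_derivs N K S f"
  shows "bounded_derivs N K S g"
proof (cases N)
  case 0 with assms show ?thesis by auto
next
  case (Suc m)
  from assms(3) Suc obtain D where
    D: "\<forall>x\<in>S. (f has_derivative (\<lambda>h. \<Sum>i\<in>UNIV. D i x * h $ i)) (at x)" "\<forall>i. bounded_derivs m K S (D i)"
    and b: "\<forall>x\<in>S. \<bar>f x\<bar> \<le> K" by auto
  have "\<forall>x\<in>S. (g has_derivative (\<lambda>h. \<Sum>i\<in>UNIV. D i x * h $ i)) (at x)"
    using D(1) assms(1,2) by (meson has_derivative_transform_within_open)
  with D b Suc assms(2) show ?thesis by auto
qed

lemma bounded_derivs_const: "bounded_derivs N \<bar>c\<bar> S (\<lambda>x. c)"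
proof (induction N arbitrary: c)
  case 0 show ?case by simp
next
  case (Suc N)
  have "((\<lambda>x. c) has_derivative (\<lambda>h. \<Sum>i\<in>UNIV. (\<lambda>i x. 0) i x * h $ i)) (at x)" for x :: "real^'n"
    by simp
  moreover have "bounded_derivs N \<bar>c\<bar> S (\<lambda>x. 0)"
    using Suc.IH[of 0] bounded_derivs_mono[of N "\<bar>0\<bar>" S "\<lambda>x. 0" "\<bar>c\<bar>" S] by simp
  ultimately show ?case
    unfolding bounded_derivs.simps by (intro conjI exI[of _ "\<lambda>i x. 0"]) auto
qed

lemma bounded_derivs_add:
  assumes "bounded_derivs N K S f" "bounded_derivs N L S g"
  shows "bounded_derivs N (K + L) S (\<lambda>x. f x + g x)"
  using assms
proof (induction N arbitrary: f g)
  case 0 then show ?case by (auto intro: order.trans[OF abs_triangle_ineq add_mono])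
next
  case (Suc N)
  from Suc.prems(1) obtain D where
    D: "\<forall>x\<in>S. (f has_derivative (\<lambda>h. \<Sum>i\<in>UNIV. D i x * h $ i)) (at x)" "\<forall>i. bounded_derivs N K S (D i)"
    and b: "\<forall>x\<in>S. \<bar>f x\<bar> \<le> K" by auto
  from Suc.prems(2) obtain E where
    E: "\<forall>x\<in>S. (g has_derivative (\<lambda>h. \<Sum>i\<in>UNIV. E i x * h $ i)) (at x)" "\<forall>i. bounded_derivs N L S (E i)"
    and b': "\<forall>x\<in>S. \<bar>g x\<bar> \<le> L" by auto
  have "\<forall>x\<in>S. ((\<lambda>x. f x + g x) has_derivative (\<lambda>h. \<Sum>i\<in>UNIV. (\<lambda>i x. D i x + E i x) i x * h $ i)) (at x)"
    using has_derivative_add[OF bspec[OF D(1)] bspec[OF E(1)]]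
    by (simp add: sum.distrib distrib_right)
  moreover have "\<forall>i. bounded_derivs N (K + L) S (\<lambda>x. D i x + E i x)" using Suc.IH D(2) E(2) by auto
  moreover have "\<forall>x\<in>S. \<bar>f x + g x\<bar> \<le> K + L"
    using b b' by (auto intro: order.trans[OF abs_triangle_ineq add_mono])
  ultimately show ?case
    unfolding bounded_derivs.simps by (intro conjI exI[of _ "\<lambda>i x. D i x + E i x"]) auto
qed

text \<open>One application of the product rule doubles the number of summands, whence the factor \<open>2 ^ N\<close>.\<close>

lemma bounded_derivs_mult:
  assumes "bounded_derivs N K S f" "bounded_derivs N L S g" "0 \<le> K" "0 \<le> L"
  shows "bounded_derivs N (2 ^ N * (K * L)) S (\<lambda>x. f x * g x)"
  using assms
proof (induction N arbitrary: f g)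
  case 0 then show ?case by (auto simp: abs_mult intro!: mult_mono)
next
  case (Suc N)
  from Suc.prems(1) obtain D where
    D: "\<forall>x\<in>S. (f has_derivative (\<lambda>h. \<Sum>i\<in>UNIV. D i x * h $ i)) (at x)" "\<forall>i. bounded_derivs N K S (D i)"
    and b: "\<forall>x\<in>S. \<bar>f x\<bar> \<le> K" by auto
  from Suc.prems(2) obtain E where
    E: "\<forall>x\<in>S. (g has_derivative (\<lambda>h. \<Sum>i\<in>UNIV. E i x * h $ i)) (at x)" "\<forall>i. bounded_derivs N L S (E i)"
    and b': "\<forall>x\<in>S. \<bar>g x\<bar> \<le> L" by auto
  define F where "F = (\<lambda>i x. f x * E i x + D i x * g x)"
  have "\<forall>x\<in>S. ((\<lambda>x. f x * g x) has_derivative (\<lambda>h. \<Sum>i\<in>UNIV. F i x * h $ i)) (at x)"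
  proof
    fix x assume "x \<in> S"
    have "((\<lambda>x. f x * g x) has_derivative
      (\<lambda>h. f x * (\<Sum>i\<in>UNIV. E i x * h $ i) + (\<Sum>i\<in>UNIV. D i x * h $ i) * g x)) (at x)"
      using has_derivative_mult[OF bspec[OF D(1) \<open>x \<in> S\<close>] bspec[OF E(1) \<open>x \<in> S\<close>]] .
    moreover have "(\<lambda>h. f x * (\<Sum>i\<in>UNIV. E i x * h $ i) + (\<Sum>i\<in>UNIV. D i x * h $ i) * g x)
      = (\<lambda>h. \<Sum>i\<in>UNIV. F i x * h $ i)"
      unfolding F_def sum_distrib_left sum_distrib_right sum.distrib[symmetric]
      by (intro ext sum.cong) (auto simp: algebra_simps)
    ultimately show "((\<lambda>x. f x * g x) has_derivative (\<lambda>h. \<Sum>i\<in>UNIV. F i x * h $ i)) (at x)" by simp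
  qed
  moreover have "bounded_derivs N (2 ^ N * (K * L) + 2 ^ N * (K * L)) S (F i)" for i
    unfolding F_def using Suc.prems D(2) E(2)
    by (intro bounded_derivs_add Suc.IH bounded_derivs_lower[OF Suc.prems(1)]
        bounded_derivs_lower[OF Suc.prems(2)]) auto
  then have "\<forall>i. bounded_derivs N (2 ^ Suc N * (K * L)) S (F i)" by (simp add: algebra_simps)
  moreover have "\<bar>f x * g x\<bar> \<le> 2 ^ Suc N * (K * L)" if "x \<in> S" for x
  proof -
    have "\<bar>f x * g x\<bar> \<le> 1 * (K * L)" using b b' that Suc.prems by (auto simp: abs_mult intro!: mult_mono)
    also have "\<dots> \<le> 2 ^ Suc N * (K * L)"
      by (rule mult_right_mono) (use Suc.prems in \<open>auto simp: one_le_power simp del: power_Suc\<close>)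
    finally show ?thesis .
  qed
  ultimately show ?case
    unfolding bounded_derivs.simps by (intro conjI exI[of _ F]) auto
qed

lemma bounded_derivs_cmult:
  assumes "bounded_derivs N K S f"
  shows "bounded_derivs N (\<bar>c\<bar> * K) S (\<lambda>x. c * f x)"
  using assms
proof (induction N arbitrary: f)
  case 0 then show ?case by (auto simp: abs_mult intro!: mult_left_mono)
next
  case (Suc N)
  from Suc.prems(1) obtain D where
    D: "\<forall>x\<in>S. (f has_derivative (\<lambda>h. \<Sum>i\<in>UNIV. D i x * h $ i)) (at x)" "\<forall>i. bounded_derivs N K S (D i)"
    and b: "\<forall>x\<in>S. \<bar>f x\<bar> \<le> K" by auto
  have "\<forall>x\<in>S. ((\<lambda>x. c * f x) has_derivative (\<lambda>h. \<Sum>i\<in>UNIV. (\<lambda>i x. c * D i x) i x * h $ i)) (at x)"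
    using has_derivative_mult_right[OF bspec[OF D(1)], of _ c]
    by (simp add: sum_distrib_left mult_ac)
  moreover have "\<forall>i. bounded_derivs N (\<bar>c\<bar> * K) S (\<lambda>x. c * D i x)" using Suc.IH D(2) by auto
  moreover have "\<forall>x\<in>S. \<bar>c * f x\<bar> \<le> \<bar>c\<bar> * K"
    using b by (auto simp: abs_mult intro!: mult_left_mono)
  ultimately show ?case
    unfolding bounded_derivs.simps by (intro conjI exI[of _ "\<lambda>i x. c * D i x"]) auto
qed

lemma bounded_derivs_sum:
  assumes "finite A" "\<And>a. a \<in> A \<Longrightarrow> bounded_derivs N (K a) S (f a)"
  shows "bounded_derivs N (\<Sum>a\<in>A. K a) S (\<lambda>x. \<Sum>a\<in>A. f a x)"
  using assms
proof (induction A rule: finite_induct)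
  case empty then show ?case using bounded_derivs_const[of N 0] by simp
next
  case (insert a A) then show ?case by (simp add: bounded_derivs_add)
qed

lemma bounded_derivs_prod:
  assumes "finite A" "\<And>a. a \<in> A \<Longrightarrow> bounded_derivs N K S (f a)" "0 \<le> K"
  shows "bounded_derivs N ((2 ^ N * K) ^ card A) S (\<lambda>x. \<Prod>a\<in>A. f a x)"
  using assms
proof (induction A rule: finite_induct)
  case empty then show ?case using bounded_derivs_const[of N 1] by simp
next
  case (insert a A)
  then have "bounded_derivs N (2 ^ N * (K * (2 ^ N * K) ^ card A)) S (\<lambda>x. f a x * (\<Prod>a\<in>A. f a x))"
    by (intro bounded_derivs_mult) auto
  then show ?case using insert by (simp add: mult_ac)
qed

text \<open>Each differentiation of \<open>f \<circ> L\<close> produces the entries of the linear part of \<open>L\<close> as factors,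
  so the bound on order \<open>N\<close> derivatives grows by the \<open>N\<close>th power of the size of the linear part.\<close>

lemma bounded_derivs_affine:
  fixes A :: "real^'n^'n"
  assumes "bounded_derivs N K UNIV f" "\<And>v. norm (A *v v) \<le> c * norm v" "0 \<le> c"
  shows "bounded_derivs N (max 1 (real CARD('n) * c) ^ N * K) UNIV (\<lambda>x. f (A *v x + b))"
  using assms
proof (induction N arbitrary: f)
  case 0 then show ?case by auto
next
  case (Suc N)
  let ?m = "max 1 (real CARD('n) * c)"
  from Suc.prems(1) obtain D where
    D: "\<forall>x. (f has_derivative (\<lambda>h. \<Sum>i\<in>UNIV. D i x * h $ i)) (at x)" "\<forall>i. bounded_derivs N K UNIV (D i)"
    and b: "\<forall>x. \<bar>f x\<bar> \<le> K" by auto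
  have K: "0 \<le> K" using b by (meson abs_ge_zero order.trans)
  define E where "E = (\<lambda>i x. \<Sum>j\<in>UNIV. A $ j $ i * D j (A *v x + b))"
  have lin: "((\<lambda>x. A *v x + b) has_derivative (\<lambda>h. A *v h)) (at x)" for x
    using has_derivative_add_const[OF bounded_linear_imp_has_derivative[OF matrix_vector_mul_bounded_linear[of A]]] by simp
  have "((\<lambda>x. f (A *v x + b)) has_derivative (\<lambda>h. \<Sum>i\<in>UNIV. D i (A *v x + b) * (A *v h) $ i)) (at x)" for x
    using has_derivative_compose[OF lin, of f "\<lambda>h. \<Sum>i\<in>UNIV. D i (A *v x + b) * h $ i" x] D(1) by simp
  moreover have "(\<Sum>i\<in>UNIV. D i (A *v x + b) * (A *v h) $ i) = (\<Sum>i\<in>UNIV. E i x * h $ i)" for x h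
    unfolding E_def matrix_vector_mult_def
    by (simp add: sum_distrib_left sum_distrib_right) (subst sum.swap, simp add: mult_ac)
  ultimately have "\<forall>x\<in>UNIV. ((\<lambda>x. f (A *v x + b)) has_derivative (\<lambda>h. \<Sum>i\<in>UNIV. E i x * h $ i)) (at x)"
    by simp
  moreover have "bounded_derivs N (?m ^ Suc N * K) UNIV (E i)" for i
  proof -
    have Aij: "\<bar>A $ j $ i\<bar> \<le> c" for j
    proof -
      have "\<bar>A $ j $ i\<bar> = \<bar>(A *v axis i 1) $ j\<bar>" by (simp add: matrix_vector_mult_basis column_def)
      also have "\<dots> \<le> norm (A *v axis i 1)" by (rule component_le_norm_cart)
      also have "\<dots> \<le> c * norm (axis i (1::real) :: real^'n)" by (rule Suc.prems(2))
      finally show ?thesis by simp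
    qed
    have "bounded_derivs N (\<bar>A $ j $ i\<bar> * (?m ^ N * K)) UNIV (\<lambda>x. A $ j $ i * D j (A *v x + b))" for j
      using Suc.IH[of "D j"] Suc.prems(2,3) D(2) bounded_derivs_cmult by blast
    then have "bounded_derivs N (\<Sum>j\<in>UNIV. \<bar>A $ j $ i\<bar> * (?m ^ N * K)) UNIV (E i)"
      unfolding E_def by (intro bounded_derivs_sum) auto
    moreover have "(\<Sum>j\<in>UNIV. \<bar>A $ j $ i\<bar> * (?m ^ N * K)) \<le> (\<Sum>j\<in>(UNIV::'n set). c * (?m ^ N * K))"
      using K Aij by (intro sum_mono mult_right_mono) auto
    moreover have "\<dots> = (real CARD('n) * c) * (?m ^ N * K)" by simp
    moreover have "\<dots> \<le> ?m * (?m ^ N * K)" using K by (intro mult_right_mono) auto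
    ultimately show ?thesis
      by (auto intro: bounded_derivs_mono simp: mult_ac)
  qed
  moreover have "\<bar>f (A *v x + b)\<bar> \<le> ?m ^ Suc N * K" for x
  proof -
    have "\<bar>f (A *v x + b)\<bar> \<le> 1 * K" using b by simp
    also have "\<dots> \<le> ?m ^ Suc N * K" using K by (intro mult_right_mono one_le_power) auto
    finally show ?thesis .
  qed
  ultimately show ?case
    unfolding bounded_derivs.simps by (intro conjI exI[of _ E]) auto
qed

lemma has_derivative_sum_unique:
  fixes f :: "real^'n \<Rightarrow> real"
  assumes "(f has_derivative (\<lambda>h. \<Sum>i\<in>UNIV. D i * h $ i)) (at x)"
    and "(f has_derivative (\<lambda>h. \<Sum>i\<in>UNIV. E i * h $ i)) (at x)"
  shows "D i = E i"
proof -
  have "(\<lambda>h::real^'n. \<Sum>i\<in>UNIV. D i * h $ i) = (\<lambda>h. \<Sum>i\<in>UNIV. E i * h $ i)"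
    using has_derivative_unique assms by blast
  from fun_cong[OF this, of "axis i 1"] show ?thesis by (simp add: axis_def if_distrib cong: if_cong)
qed

lemma bounded_derivs_Un:
  assumes "open S" "open T" "bounded_derivs N K S f" "bounded_derivs N K T f"
  shows "bounded_derivs N K (S \<union> T) f"
  using assms(3,4)
proof (induction N arbitrary: f)
  case 0 then show ?case by auto
next
  case (Suc N)
  from Suc.prems(1) obtain D where
    D: "\<forall>x\<in>S. (f has_derivative (\<lambda>h. \<Sum>i\<in>UNIV. D i x * h $ i)) (at x)" "\<forall>i. bounded_derivs N K S (D i)"
    and b: "\<forall>x\<in>S. \<bar>f x\<bar> \<le> K" by auto
  from Suc.prems(2) obtain E where
    E: "\<forall>x\<in>T. (f has_derivative (\<lambda>h. \<Sum>i\<in>UNIV. E i x * h $ i)) (at x)" "\<forall>i. bounded_derivs N K T (E i)"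
    and b': "\<forall>x\<in>T. \<bar>f x\<bar> \<le> K" by auto
  define F where "F = (\<lambda>i x. if x \<in> S then D i x else E i x)"
  have FE: "F i x = E i x" if "x \<in> T" for i x
    using that D(1) E(1) has_derivative_sum_unique[of f "\<lambda>i. D i x" x "\<lambda>i. E i x" i] by (auto simp: F_def)
  have "bounded_derivs N K S (F i)" for i
    by (rule bounded_derivs_cong[OF assms(1) _ D(2)[rule_format]]) (simp add: F_def)
  moreover have "bounded_derivs N K T (F i)" for i
    by (rule bounded_derivs_cong[OF assms(2) _ E(2)[rule_format]]) (simp add: FE)
  ultimately have "\<forall>i. bounded_derivs N K (S \<union> T) (F i)" using Suc.IH by blast
  moreover have "\<forall>x\<in>S \<union> T. (f has_derivative (\<lambda>h. \<Sum>i\<in>UNIV. F i x * h $ i)) (at x)"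
    using D(1) E(1) FE by (auto simp: F_def)
  ultimately show ?case using b b' unfolding bounded_derivs.simps by (intro conjI exI[of _ F]) auto
qed

text \<open>Polynomials have bounded derivatives only on bounded sets. Products with a cutoff vanishing
  near the unit sphere and beyond are estimated on the unit ball and then glued to zero.\<close>

lemma bounded_derivs_extend_by_zero:
  fixes f :: "real^'n \<Rightarrow> real"
  assumes "bounded_derivs N K (ball 0 1) f" "\<And>x. norm x \<ge> 1/2 \<Longrightarrow> f x = 0" "0 \<le> K"
  shows "bounded_derivs N K UNIV f"
proof -
  have op: "open (- cball (0::real^'n) (1/2))" by (simp add: open_Compl)
  have "bounded_derivs N K (- cball (0::real^'n) (1/2)) (\<lambda>x. 0)"
    by (rule bounded_derivs_mono[OF bounded_derivs_const[of N 0 UNIV]]) (use assms(3) in auto)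
  then have "bounded_derivs N K (- cball (0::real^'n) (1/2)) f"
    by (rule bounded_derivs_cong[OF op, rotated]) (use assms(2) in auto)
  then have "bounded_derivs N K (ball 0 1 \<union> - cball (0::real^'n) (1/2)) f"
    by (intro bounded_derivs_Un assms(1) op open_ball)
  moreover have "ball 0 1 \<union> - cball (0::real^'n) (1/2) = UNIV" by auto
  ultimately show ?thesis by simp
qed

lemma bounded_derivs_coordinate: "bounded_derivs N 1 (ball 0 1) (\<lambda>x::real^'n. x $ i)"
proof (cases N)
  case 0
  have "\<bar>x $ i\<bar> \<le> 1" if "norm x < 1" for x :: "real^'n"
    using component_le_norm_cart[of x i] that by linarith
  with 0 show ?thesis by simp
next
  case (Suc m)
  have b: "\<bar>x $ i\<bar> \<le> 1" if "norm x < 1" for x :: "real^'n"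
    using component_le_norm_cart[of x i] that by linarith
  have "((\<lambda>x. x $ i) has_derivative (\<lambda>h. h $ i)) (at x)" for x :: "real^'n"
    by (rule bounded_linear_imp_has_derivative) (rule bounded_linear_vec_nth)
  then have "((\<lambda>x. x $ i) has_derivative (\<lambda>h. \<Sum>j\<in>UNIV. (\<lambda>j x. if j = i then 1 else 0) j x * h $ j)) (at x)"
    for x :: "real^'n" by (simp add: if_distrib if_distribR cong: if_cong)
  moreover have "bounded_derivs m 1 (ball 0 1) (\<lambda>x. if j = i then 1 else 0)" for j
    using bounded_derivs_mono[OF bounded_derivs_const[of m "if j = i then 1 else 0" "ball 0 1"], of 1 "ball 0 1"]
    by auto
  ultimately show ?thesis unfolding Suc bounded_derivs.simps
    using b by (intro conjI exI[of _ "\<lambda>j x. if j = i then 1 else 0"] allI ballI) (simp, blast, blast)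
qed

lemma bounded_derivs_continuous:
  assumes "bounded_derivs (Suc N) K UNIV f"
  shows "continuous_on UNIV f"
proof -
  have "\<forall>x. \<exists>D. (f has_derivative D) (at x)" using assms by auto
  then show ?thesis
    by (intro differentiable_imp_continuous_on) (auto simp: differentiable_on_def differentiable_def)
qed

section \<open>Smooth bumps\<close>

text \<open>The powers in the denominator make the family \<open>flat n\<close> closed under differentiation, so that
  smoothness of \<open>flat 0\<close>, the standard function \<open>exp (- 1 / x)\<close>, follows by induction without
  computing higher derivatives.\<close>

definition flat :: "nat \<Rightarrow> real \<Rightarrow> real" where
  "flat n x = (if x > 0 then exp (- 1 / x) / x ^ n else 0)"

lemma power_le_fact_exp: "0 \<le> u \<Longrightarrow> u ^ n \<le> fact n * exp (u::real)"
proof -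
  assume u: "0 \<le> u"
  have "(\<Sum>k\<in>{n}. u ^ k /\<^sub>R fact k) \<le> (\<Sum>k. u ^ k /\<^sub>R fact k)"
    by (rule sum_le_suminf[OF summable_exp_generic]) (use u in auto)
  then have "u ^ n / fact n \<le> exp u" by (simp add: exp_def field_simps)
  then show ?thesis by (simp add: field_simps)
qed

lemma flat_nonneg: "0 \<le> flat n x" by (simp add: flat_def)

lemma flat_le:
  assumes "0 \<le> x" shows "flat n x \<le> fact (n + k) * x ^ k"
proof (cases "x = 0")
  case False
  then have x: "x > 0" using assms by simp
  have "(1/x) ^ (n + k) \<le> fact (n + k) * exp (1/x)" using power_le_fact_exp[of "1/x" "n+k"] x by simp
  then have "(1/x) ^ (n + k) * (x^k * exp (-1/x)) \<le> fact (n + k) * exp (1/x) * (x^k * exp (-1/x))"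
    using x by (intro mult_right_mono) auto
  then show ?thesis using x by (simp add: flat_def exp_minus power_add field_simps)
qed (simp add: flat_def)

lemma flat_abs_bound: "\<bar>flat n x\<bar> \<le> fact n"
  using flat_le[of x n 0] flat_nonneg[of n x] by (cases "0 \<le> x") (auto simp: flat_def)

lemma flat_deriv:
  "(flat n has_real_derivative (flat (n + 2) x - n * flat (n + 1) x)) (at x)"
proof (cases x "0::real" rule: linorder_cases)
  case less
  have "((\<lambda>x. 0) has_real_derivative 0) (at x)" by simp
  then have "(flat n has_real_derivative 0) (at x)"
    by (rule has_field_derivative_transform_within_open[of _ _ _ "{..<0}"]) (use less in \<open>auto simp: flat_def\<close>)
  then show ?thesis using less by (simp add: flat_def)
next
  case greater
  have "((\<lambda>x. exp (- 1 / x) / x ^ n) has_real_derivative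
      ((exp (- 1 / x) * (1 / (x * x))) * x ^ n - exp (- 1 / x) * (n * x ^ (n - 1))) / (x ^ n * x ^ n)) (at x)"
    using greater by (auto intro!: derivative_eq_intros)
  moreover have "((exp (- 1 / x) * (1 / (x * x))) * x ^ n - exp (- 1 / x) * (n * x ^ (n - 1))) / (x ^ n * x ^ n)
      = flat (n + 2) x - n * flat (n + 1) x"
    using greater by (cases n) (simp_all add: flat_def field_simps)
  ultimately have "((\<lambda>x. exp (- 1 / x) / x ^ n) has_real_derivative (flat (n + 2) x - n * flat (n + 1) x)) (at x)"
    by simp
  then show ?thesis
    by (rule has_field_derivative_transform_within_open[of _ _ _ "{0<..}"]) (use greater in \<open>auto simp: flat_def\<close>)
next
  case equal
  have "((\<lambda>h. flat n h / h) \<longlongrightarrow> 0) (at 0)"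
  proof (rule tendsto_0_le[where K="fact (n+2)"])
    show "((\<lambda>h::real. h) \<longlongrightarrow> 0) (at 0)" by (rule tendsto_ident_at)
    show "\<forall>\<^sub>F h in at 0. norm (flat n h / h) \<le> norm h * fact (n + 2)"
    proof (rule always_eventually, rule allI)
      fix h :: real
      show "norm (flat n h / h) \<le> norm h * fact (n + 2)"
      proof (cases "h > 0")
        case True
        then have "flat n h \<le> fact (n+2) * h^2" by (intro flat_le) auto
        then show ?thesis using True flat_nonneg[of n h]
          by (simp add: divide_le_eq power2_eq_square mult_ac del: fact_Suc add_2_eq_Suc')
      next
        case False
        then have "flat n h = 0" by (simp add: flat_def)
        then show ?thesis by (simp del: fact_Suc add_2_eq_Suc')
      qed
    qed
  qed
  then show ?thesis using equal by (simp add: has_field_derivative_iff flat_def)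
qed

lemma bounded_derivs_flat_comp:
  assumes "\<And>N. \<exists>K. bounded_derivs N K S g"
  shows "\<exists>K. bounded_derivs N K S (\<lambda>x. flat n (g x))"
proof (induction N arbitrary: n)
  case 0 show ?case using flat_abs_bound by auto
next
  case (Suc N)
  obtain K where "bounded_derivs (Suc N) K S g" using assms by blast
  then obtain D where D: "\<forall>x\<in>S. (g has_derivative (\<lambda>h. \<Sum>i\<in>UNIV. D i x * h $ i)) (at x)"
    "\<forall>i. bounded_derivs N K S (D i)" by auto
  have D2: "bounded_derivs N (max K 0) S (D i)" for i using bounded_derivs_mono[OF D(2)[rule_format], of "max K 0" S] by simp
  define E where "E = (\<lambda>i x. (flat (n + 2) (g x) + (- real n) * flat (n + 1) (g x)) * D i x)"
  obtain K1 where K1: "bounded_derivs N K1 S (\<lambda>x. flat (n + 2) (g x))" using Suc by blast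
  obtain K2 where K2: "bounded_derivs N K2 S (\<lambda>x. flat (n + 1) (g x))" using Suc by blast
  define L where "L = max 0 (K1 + \<bar>- real n\<bar> * K2)"
  have "bounded_derivs N L S (\<lambda>x. flat (n + 2) (g x) + (- real n) * flat (n + 1) (g x))"
    by (rule bounded_derivs_mono[OF bounded_derivs_add[OF K1 bounded_derivs_cmult[OF K2, of "- real n"]]])
       (auto simp: L_def)
  then have E: "bounded_derivs N (2 ^ N * (L * max K 0)) S (E i)" for i
    unfolding E_def by (intro bounded_derivs_mult D2) (auto simp: L_def)
  have "((\<lambda>x. flat n (g x)) has_derivative (\<lambda>h. \<Sum>i\<in>UNIV. E i x * h $ i)) (at x)" if "x \<in> S" for x
  proof -
    have "((\<lambda>x. flat n (g x)) has_derivative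
       (\<lambda>h. (flat (n + 2) (g x) - n * flat (n + 1) (g x)) * (\<Sum>i\<in>UNIV. D i x * h $ i))) (at x)"
      using has_derivative_compose[OF bspec[OF D(1) that] flat_deriv[unfolded has_field_derivative_def]] .
    then show ?thesis by (simp add: E_def sum_distrib_left mult.assoc)
  qed
  moreover have "bounded_derivs N (max (fact n) (2 ^ N * (L * max K 0))) S (E i)" for i
    by (rule bounded_derivs_mono[OF E]) auto
  moreover have "\<bar>flat n (g x)\<bar> \<le> max (fact n) (2 ^ N * (L * max K 0))" for x
    using flat_abs_bound[of n "g x"] by linarith
  ultimately show ?case
    unfolding bounded_derivs.simps by (intro exI[of _ "max (fact n) (2 ^ N * (L * max K 0))"] conjI exI[of _ E]) auto
qed

lemma bounded_derivs_lincomb: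
  assumes "\<And>N. \<exists>K. bounded_derivs N K S f"
  shows "\<exists>K. bounded_derivs N K S (\<lambda>x. a + b * f x)"
proof -
  obtain K where "bounded_derivs N K S f" using assms by blast
  from bounded_derivs_add[OF bounded_derivs_const[of N a] bounded_derivs_cmult[OF this, of b]]
  show ?thesis by blast
qed

lemma flat0_le: "y \<le> 1 \<Longrightarrow> flat 0 y \<le> exp (-1)" and flat0_ge: "1 \<le> y \<Longrightarrow> exp (-1) \<le> flat 0 y"
  by (auto simp: flat_def field_simps)

text \<open>With \<open>\<beta> y = exp 1 * flat 0 y\<close>, which vanishes for \<open>y \<le> 0\<close> and is at least one for \<open>y \<ge> 1\<close>, the
  bump is \<open>\<beta> (1 - \<beta> (r w))\<close>, where \<open>r\<close> is the polynomial in \<open>norm w\<close> with \<open>r \<le> 0\<close> on the ball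
  of radius \<open>1/4\<close> and \<open>r \<ge> 1\<close> off the ball of radius \<open>1/2\<close>.\<close>

lemma smooth_bump_exists:
  obtains \<psi> :: "real^'n \<Rightarrow> real" where
    "\<And>N. \<exists>K. bounded_derivs N K UNIV \<psi>" "\<And>w. 0 \<le> \<psi> w" "\<And>w. \<psi> w \<le> 1"
    "\<And>w. norm w \<le> 1/4 \<Longrightarrow> \<psi> w = 1" "\<And>w. norm w \<ge> 1/2 \<Longrightarrow> \<psi> w = 0"
proof
  define r :: "real^'n \<Rightarrow> real" where "r = (\<lambda>w. - (1/3) + 16/3 * (\<Sum>i\<in>UNIV. w $ i * w $ i))"
  define \<psi> where "\<psi> = (\<lambda>w. exp 1 * flat 0 (1 + (- exp 1) * flat 0 (r w)))"
  have r_eq: "r w = 16/3 * ((norm w)\<^sup>2 - (1/4)\<^sup>2)" for w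
    unfolding power2_norm_eq_inner r_def inner_vec_def by (simp add: power2_eq_square algebra_simps)
  have "\<exists>K. bounded_derivs N K (ball 0 1) (\<lambda>w::real^'n. \<Sum>i\<in>UNIV. w $ i * w $ i)" for N
    by (rule exI, rule bounded_derivs_sum[OF finite],
        rule bounded_derivs_mult[OF bounded_derivs_coordinate bounded_derivs_coordinate]) auto
  then have "\<exists>K. bounded_derivs N K (ball 0 1) r" for N unfolding r_def by (rule bounded_derivs_lincomb)
  then have "\<exists>K. bounded_derivs N K (ball 0 1) (\<lambda>w. flat 0 (r w))" for N by (rule bounded_derivs_flat_comp)
  then have "\<exists>K. bounded_derivs N K (ball 0 1) (\<lambda>w. 1 + (- exp 1) * flat 0 (r w))" for N
    by (rule bounded_derivs_lincomb)
  then have "\<exists>K. bounded_derivs N K (ball 0 1) (\<lambda>w. flat 0 (1 + (- exp 1) * flat 0 (r w)))" for N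
    by (rule bounded_derivs_flat_comp)
  then have *: "\<exists>K. bounded_derivs N K (ball 0 1) \<psi>" for N
  proof -
    obtain K where "bounded_derivs N K (ball 0 1) (\<lambda>w. flat 0 (1 + (- exp 1) * flat 0 (r w)))"
      using \<open>\<And>N. \<exists>K. bounded_derivs N K (ball 0 1) (\<lambda>w. flat 0 (1 + (- exp 1) * flat 0 (r w)))\<close> by blast
    from bounded_derivs_cmult[OF this, of "exp 1"] show ?thesis unfolding \<psi>_def by blast
  qed
  show zero: "\<psi> w = 0" if "norm w \<ge> 1/2" for w
  proof -
    have "(1/2)\<^sup>2 \<le> (norm w)\<^sup>2" using that by (intro power_mono) auto
    then have "r w \<ge> 1" by (simp add: r_eq power2_eq_square)
    then have "exp 1 * exp (-1) \<le> exp 1 * flat 0 (r w)" by (intro mult_left_mono flat0_ge) auto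
    then show ?thesis by (simp add: \<psi>_def flat_def exp_minus)
  qed
  show "\<exists>K. bounded_derivs N K UNIV \<psi>" for N
  proof -
    obtain K where "bounded_derivs N K (ball 0 1) \<psi>" using * by blast
    then have "bounded_derivs N (max K 0) (ball 0 1) \<psi>" by (rule bounded_derivs_mono) auto
    then show ?thesis using bounded_derivs_extend_by_zero[of N "max K 0" \<psi>] zero by auto
  qed
  show "0 \<le> \<psi> w" for w by (simp add: \<psi>_def flat_nonneg)
  have "exp 1 * flat 0 y \<le> exp 1 * exp (-1)" if "y \<le> 1" for y
    using that by (intro mult_left_mono flat0_le) auto
  then show "\<psi> w \<le> 1" for w
    using flat_nonneg[of 0 "r w"] by (simp add: \<psi>_def exp_minus)
  show "\<psi> w = 1" if "norm w \<le> 1/4" for w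
  proof -
    have "(norm w)\<^sup>2 \<le> (1/4)\<^sup>2" using that by (intro power_mono) auto
    then have "r w \<le> 0" by (simp add: r_eq)
    then show ?thesis by (simp add: \<psi>_def flat_def exp_minus)
  qed
qed

section \<open>Geometry of an ellipsoid cover\<close>

locale ellipsoid_cover =
  fixes M :: "real^'n \<Rightarrow> real \<Rightarrow> real^'n^'n" and a1 a2 a3 a4 a5 a6 :: real
  assumes cover: "continuous_ellipsoid_cover M a1 a2 a3 a4 a5 a6"
begin

text \<open>The affine map that carries the ellipsoid onto the unit ball.\<close>

definition chart :: "real^'n \<Rightarrow> real \<Rightarrow> real^'n \<Rightarrow> real^'n" where
  "chart x t z = matrix_inv (M x t) *v (z - x)"

abbreviation E :: "real^'n \<Rightarrow> real \<Rightarrow> (real^'n) set" where "E x t \<equiv> ellipsoid M x t"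

lemma pos: "0 < a1" "0 < a2" "0 < a3" "0 < a4" "0 < a5" "0 < a6"
  using cover unfolding continuous_ellipsoid_cover_def by auto

lemma invM: "invertible (M x t)"
  using cover unfolding continuous_ellipsoid_cover_def by auto

lemma matrix_inv_MM: "M x t ** matrix_inv (M x t) = mat 1" "matrix_inv (M x t) ** M x t = mat 1"
proof -
  have "\<exists>A'. M x t ** A' = mat 1 \<and> A' ** M x t = mat 1" using invM[of x t] unfolding invertible_def .
  then have "M x t ** matrix_inv (M x t) = mat 1 \<and> matrix_inv (M x t) ** M x t = mat 1"
    unfolding matrix_inv_def by (rule someI_ex)
  then show "M x t ** matrix_inv (M x t) = mat 1" "matrix_inv (M x t) ** M x t = mat 1" by auto
qed

lemma M_inv: "M x t *v (matrix_inv (M x t) *v v) = v"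
  by (simp add: matrix_vector_mul_assoc matrix_inv_MM(1))

lemma inv_M: "matrix_inv (M x t) *v (M x t *v v) = v"
  by (simp add: matrix_vector_mul_assoc matrix_inv_MM(2))

lemma chart_M: "chart x t (M x t *v w + x) = w" by (simp add: chart_def inv_M)

lemma M_chart: "M x t *v chart x t z + x = z" by (simp add: chart_def M_inv)

lemma mem_E: "z \<in> E x t \<longleftrightarrow> norm (chart x t z) < 1"
proof
  assume "z \<in> E x t"
  then obtain w where "w \<in> ball 0 1" "z = M x t *v w + x" unfolding ellipsoid_def by auto
  then show "norm (chart x t z) < 1" using chart_M by simp
next
  assume "norm (chart x t z) < 1"
  then show "z \<in> E x t" unfolding ellipsoid_def using M_chart[of x t z]
    by (intro image_eqI[of _ _ "chart x t z"]) auto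
qed

lemma chart_center [simp]: "chart x t x = 0" by (simp add: chart_def)

lemma center_mem [simp]: "x \<in> E x t" by (simp add: mem_E)

lemma continuous_chart: "continuous_on A (chart x t)"
  unfolding chart_def by (intro continuous_intros linear_continuous_on_compose[OF _ matrix_vector_mul_linear])

lemma open_E: "open (E x t)"
proof -
  have "E x t = {z. norm (chart x t z) < 1}" using mem_E by auto
  then show ?thesis by (auto intro!: open_Collect_less continuous_on_norm continuous_chart continuous_intros)
qed

lemma bounded_E: "bounded (E x t)"
proof -
  have "bounded ((*v) (M x t) ` ball 0 1)"
    by (rule bounded_linear_image[OF bounded_ball matrix_vector_mul_bounded_linear])
  then have "bounded ((\<lambda>v. x + v) ` ((*v) (M x t) ` ball 0 1))" by (rule bounded_translation)
  moreover have "(\<lambda>v. x + v) ` ((*v) (M x t) ` ball 0 1) = E x t"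
    unfolding ellipsoid_def image_image by (simp add: add.commute)
  ultimately show ?thesis by simp
qed

lemma E_lmeasurable: "E x t \<in> lmeasurable"
  using bounded_E open_E by (intro lmeasurable_open) auto

lemma measure_E: "a1 * 2 powr (- t) \<le> measure lebesgue (E x t)" "measure lebesgue (E x t) \<le> a2 * 2 powr (- t)"
  using cover unfolding continuous_ellipsoid_cover_def by auto

lemma norm_mult_le: "norm (A *v v) \<le> mat_norm A * norm (v :: real^'n)" for A :: "real^'n^'n"
  unfolding mat_norm_def by (rule onorm[OF matrix_vector_mul_bounded_linear])

text \<open>The two bounds of the cover axiom, freed from matrix norms: if two ellipsoids meet, then
  passing from the coordinates of the smaller one to those of the larger one contracts at the
  rate \<open>a6\<close>, and the converse passage expands at most at the rate \<open>a4\<close>.\<close>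

lemma shrink:
  assumes "E x t \<inter> E y t' \<noteq> {}" "t \<le> t'"
  shows "norm (matrix_inv (M x t) *v v) \<le> a5 * 2 powr (- a6 * (t' - t)) * norm (matrix_inv (M y t') *v v)"
proof -
  have "mat_norm (matrix_inv (M x t) ** M y (t + (t' - t))) \<le> a5 * 2 powr (- a6 * (t' - t))"
    using cover assms unfolding continuous_ellipsoid_cover_def
    by (metis add.commute diff_add_cancel diff_ge_0_iff_ge)
  then have *: "mat_norm (matrix_inv (M x t) ** M y t') \<le> a5 * 2 powr (- a6 * (t' - t))" by simp
  let ?w = "matrix_inv (M y t') *v v"
  have "norm (matrix_inv (M x t) *v v) = norm ((matrix_inv (M x t) ** M y t') *v ?w)"
    by (simp add: M_inv flip: matrix_vector_mul_assoc)
  also have "\<dots> \<le> mat_norm (matrix_inv (M x t) ** M y t') * norm ?w" by (rule norm_mult_le)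
  also have "\<dots> \<le> a5 * 2 powr (- a6 * (t' - t)) * norm ?w" using * by (intro mult_right_mono) auto
  finally show ?thesis .
qed

lemma expand:
  assumes "E x t \<inter> E y t' \<noteq> {}" "t \<le> t'"
  shows "norm (matrix_inv (M y t') *v v) \<le> 2 powr (a4 * (t' - t)) / a3 * norm (matrix_inv (M x t) *v v)"
proof -
  let ?A = "matrix_inv (M y t') ** M x t"
  have "a3 * 2 powr (- a4 * (t' - t)) \<le> 1 / mat_norm (matrix_inv (M y (t + (t' - t))) ** M x t)"
    using cover assms unfolding continuous_ellipsoid_cover_def
    by (metis add.commute diff_add_cancel diff_ge_0_iff_ge)
  then have *: "a3 * 2 powr (- a4 * (t' - t)) \<le> 1 / mat_norm ?A" by simp
  have p: "0 < a3 * 2 powr (- a4 * (t' - t))" using pos by simp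
  with * have "0 < mat_norm ?A" by (metis less_le_trans zero_less_divide_1_iff)
  with * p have "mat_norm ?A \<le> 1 / (a3 * 2 powr (- a4 * (t' - t)))"
    by (simp add: field_simps)
  moreover have "1 / (a3 * 2 powr (- a4 * (t' - t))) = 2 powr (a4 * (t' - t)) / a3"
    by (simp only: mult_minus_left powr_minus) (simp add: divide_simps)
  ultimately have **: "mat_norm ?A \<le> 2 powr (a4 * (t' - t)) / a3" by simp
  let ?w = "matrix_inv (M x t) *v v"
  have "norm (matrix_inv (M y t') *v v) = norm (?A *v ?w)"
    by (simp add: M_inv flip: matrix_vector_mul_assoc)
  also have "\<dots> \<le> mat_norm ?A * norm ?w" by (rule norm_mult_le)
  also have "\<dots> \<le> 2 powr (a4 * (t' - t)) / a3 * norm ?w" using ** by (intro mult_right_mono) auto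
  finally show ?thesis .
qed

text \<open>Distances between scales at which the geometry becomes usable. Enlarging by \<open>J0\<close> scales, an
  ellipsoid engulfs each ellipsoid of at most its size that it meets. A Whitney ellipsoid
  enlarged by \<open>J0\<close> scales lies in the open set that it helps to cover, and enlarged by \<open>J1\<close>
  scales it does not. Partition functions live on Whitney ellipsoids shrunk by \<open>J3 = J1 + J0\<close>
  scales: \<open>J1\<close> pays for comparing the sizes of two ellipsoids, \<open>J0\<close> for engulfing one by the
  other.\<close>

definition J0 :: real where "J0 = max 1 (log 2 (2 * (a5 * (2 * a5 + 1))) / a6)"
definition J1 :: real where "J1 = J0 + 1"
definition J3 :: real where "J3 = J1 + J0"

lemma J0_pos: "1 \<le> J0" by (simp add: J0_def)

lemma powr_neg_le:
  assumes "log 2 X / a6 \<le> J" "0 < X"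
  shows "X * 2 powr (- a6 * J) \<le> 1"
proof -
  have "log 2 X \<le> a6 * J" using assms(1) pos by (simp add: field_simps)
  then have "2 powr (log 2 X) \<le> 2 powr (a6 * J)" by simp
  then have "X \<le> 2 powr (a6 * J)" using assms by simp
  then show ?thesis by (simp add: powr_minus field_simps)
qed

text \<open>For a common point \<open>u\<close>, the difference \<open>z - u\<close> has length at most \<open>2\<close> in the coordinates of
  the smaller ellipsoid, hence at most \<open>2 * a5\<close> in those of the larger one, so \<open>z\<close> has norm
  less than \<open>2 * a5 + 1\<close> there. Enlarging by \<open>J\<close> scales contracts this below one, which is how
  \<open>J0\<close> is chosen.\<close>

lemma engulf:
  assumes "E x t \<inter> E y t' \<noteq> {}" "t \<le> t'" "J0 \<le> J" "norm (chart y t' z) \<le> 1"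
  shows "z \<in> E x (t - J)"
proof -
  obtain u where u: "norm (chart x t u) < 1" "norm (chart y t' u) < 1" using assms(1) mem_E by auto
  have J: "0 \<le> J" using J0_pos assms(3) by simp
  have self: "norm (matrix_inv (M x (t - J)) *v v) \<le> a5 * 2 powr (- a6 * J) * norm (matrix_inv (M x t) *v v)" for v
  proof -
    have "E x (t - J) \<inter> E x t \<noteq> {}" using center_mem[of x t] center_mem[of x "t-J"] by blast
    then show ?thesis using shrink[of x "t - J" x t v] J by simp
  qed
  have zu: "matrix_inv (M y t') *v (z - u) = chart y t' z - chart y t' u"
    unfolding chart_def by (simp flip: matrix_vector_mult_diff_distrib)
  have "a5 * 2 powr (- a6 * (t' - t)) \<le> a5 * 1" using pos assms(2)
    by (intro mult_left_mono) (auto simp: powr_minus inverse_le_1_iff intro!: disjI2 ge_one_powr_ge_zero)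
  have "norm (matrix_inv (M x t) *v (z - u)) \<le> a5 * norm (matrix_inv (M y t') *v (z - u))"
    using shrink[OF assms(1,2), of "z - u"]
      mult_right_mono[OF \<open>a5 * 2 powr (- a6 * (t' - t)) \<le> a5 * 1\<close>, of "norm (matrix_inv (M y t') *v (z - u))"]
    by simp
  also have "\<dots> \<le> a5 * 2" unfolding zu using u assms(4) norm_triangle_ineq4[of "chart y t' z" "chart y t' u"] pos
    by (intro mult_left_mono) auto
  finally have 1: "norm (matrix_inv (M x t) *v (z - u)) \<le> 2 * a5" by simp
  have "matrix_inv (M x t) *v (z - x) = matrix_inv (M x t) *v (z - u) + chart x t u"
    unfolding chart_def by (simp flip: matrix_vector_right_distrib)
  then have "norm (matrix_inv (M x t) *v (z - x)) < 2 * a5 + 1"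
    using 1 u norm_triangle_ineq[of "matrix_inv (M x t) *v (z - u)" "chart x t u"] by simp
  then have "a5 * 2 powr (- a6 * J) * norm (matrix_inv (M x t) *v (z - x)) < a5 * 2 powr (- a6 * J) * (2 * a5 + 1)"
    using pos by (intro mult_strict_left_mono) auto
  also have "\<dots> \<le> 1"
  proof -
    have "0 < a5 * (2 * a5 + 1)" using pos by (simp add: add_pos_pos)
    then have "2 * (a5 * (2 * a5 + 1)) * 2 powr (- a6 * J) \<le> 1"
      using powr_neg_le[of "2 * (a5 * (2 * a5 + 1))" J] assms(3) by (simp add: J0_def)
    moreover have "0 \<le> a5 * 2 powr (- a6 * J) * (2 * a5 + 1)" using pos by simp
    moreover have "2 * (a5 * (2 * a5 + 1)) * 2 powr (- a6 * J) = 2 * (a5 * 2 powr (- a6 * J) * (2 * a5 + 1))"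
      by (simp only: mult_ac)
    ultimately show ?thesis by linarith
  qed
  finally have "norm (chart x (t - J) z) < 1" using self[of "z - x"] by (simp add: chart_def)
  then show ?thesis by (simp add: mem_E)
qed

lemma engulf_subset:
  assumes "E x t \<inter> E y t' \<noteq> {}" "t \<le> t'" "J0 \<le> J"
  shows "E y t' \<subseteq> E x (t - J)"
  using engulf[OF assms] mem_E by auto

lemma nested: "J0 \<le> J \<Longrightarrow> E x t \<subseteq> E x (t - J)"
  using engulf_subset[of x t x t J] center_mem[of x t] by auto

text \<open>Two ellipsoids of the Whitney kind can only meet if the one fitting into the smaller set
  is not much larger: otherwise it would engulf the other together with a point outside.\<close>

lemma comparable_scale:
  assumes "\<not> E x (t - J1) \<subseteq> \<Omega>" "E x' (t' - J0) \<subseteq> \<Omega>" "E x t \<inter> E x' t' \<noteq> {}"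
  shows "t - J1 < t'"
proof (rule ccontr)
  assume "\<not> t - J1 < t'"
  then have le: "t' \<le> t - J1" by simp
  have "E x t \<subseteq> E x (t - J1)" by (rule nested) (simp add: J1_def)
  then have "E x' t' \<inter> E x (t - J1) \<noteq> {}" using assms(3) by blast
  from engulf_subset[OF this le order_refl] assms show False by blast
qed

text \<open>The shrunk ellipsoids on which partition functions live have the property that whenever two of
  them meet, the unshrunk first one contains the second.\<close>

lemma support_in_enlarged:
  assumes "\<not> E x (t - J1) \<subseteq> \<Omega>" "E x' (t' - J0) \<subseteq> \<Omega>" "E x (t + J3) \<inter> E x' (t' + J3) \<noteq> {}"
  shows "t - J1 < t'" "E x' (t' + J3) \<subseteq> E x t"
proof -
  have J: "J0 \<le> J3" "J0 \<le> J1" "J3 - J1 - J0 = 0" using J0_pos by (auto simp: J1_def J3_def)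
  have "E x (t + J3) \<subseteq> E x t" "E x' (t' + J3) \<subseteq> E x' t'" using nested[OF J(1)] by (metis add_diff_cancel_right')+
  then have "E x t \<inter> E x' t' \<noteq> {}" using assms(3) by blast
  from comparable_scale[OF assms(1,2) this] show lt: "t - J1 < t'" .
  have "E x (t + J3) \<subseteq> E x (t + J3 - J1)" by (rule nested[OF J(2)])
  then have "E x (t + J3 - J1) \<inter> E x' (t' + J3) \<noteq> {}" using assms(3) by blast
  from engulf_subset[OF this _ order_refl] lt have "E x' (t' + J3) \<subseteq> E x (t + J3 - J1 - J0)" by simp
  then show "E x' (t' + J3) \<subseteq> E x t" by (simp add: J3_def)
qed

text \<open>The Whitney ellipsoids are selected so that their copies shrunk by \<open>J5\<close> scales are disjoint.
  The last summand makes the quarter-size cores at scale \<open>J3\<close> of the selected ellipsoids cover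
  the set. The number \<open>overlap\<close> bounds how many disjoint shrunk copies fit, by volume, into
  one enlarged Whitney ellipsoid.\<close>

definition J5 :: real where "J5 = J1 + J0 + J3 + max 0 (log 2 (4 * a5) / a6)"
definition overlap :: nat where "overlap = nat \<lfloor>a2 / a1 * 2 powr (2 * J1 + J0 + J5)\<rfloor>"

text \<open>Indices are natural numbers because each partition function is a product over the earlier
  indices. The covering is by cores of radius \<open>1/4\<close>, where a bump equals one, at the scale
  \<open>J3\<close> at which the bumps live.\<close>

definition whitney :: "(real^'n) set \<Rightarrow> nat set \<Rightarrow> (nat \<Rightarrow> real^'n) \<Rightarrow> (nat \<Rightarrow> real) \<Rightarrow> bool" where
  "whitney \<Omega> I x t \<longleftrightarrow>
     (\<forall>i\<in>I. E (x i) (t i - J0) \<subseteq> \<Omega> \<and> \<not> E (x i) (t i - J1) \<subseteq> \<Omega>) \<and>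
     (\<forall>z\<in>\<Omega>. \<exists>i\<in>I. norm (chart (x i) (t i + J3) z) \<le> 1 / 4) \<and>
     (\<forall>z. finite {i\<in>I. z \<in> E (x i) (t i)} \<and> card {i\<in>I. z \<in> E (x i) (t i)} \<le> overlap)"

lemma J5_ge: "J0 \<le> J5" "0 \<le> J5" using J0_pos by (auto simp: J5_def J1_def J3_def)

text \<open>Small ellipsoids around \<open>z\<close> lie in the open set, whereas volumes grow without bound as the
  scale decreases, so that large ones do not fit into a set of finite measure. The scale is
  the last one, in unit steps, before the enlarged ellipsoid leaves the set.\<close>

lemma exists_whitney_scale:
  assumes "open \<Omega>" "emeasure lebesgue \<Omega> < \<infinity>" "z \<in> \<Omega>"
  shows "\<exists>t. E z (t - J0) \<subseteq> \<Omega> \<and> \<not> E z (t - J1) \<subseteq> \<Omega>"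
proof -
  obtain r where r: "0 < r" "ball z r \<subseteq> \<Omega>" using assms openE by blast
  have "\<exists>m\<ge>0. E z m \<subseteq> \<Omega>"
  proof -
    define X where "X = a5 * (mat_norm (M z 0) + 1) / r"
    have mn: "0 \<le> mat_norm (M z 0)" unfolding mat_norm_def by (rule onorm_pos_le[OF matrix_vector_mul_bounded_linear])
    have X: "0 < X" using pos r mn by (simp add: X_def)
    define m where "m = max 0 (log 2 X / a6)"
    have "dist z y < r" if "y \<in> E z m" for y
    proof -
      have "norm (matrix_inv (M z 0) *v (y - z)) \<le> a5 * 2 powr (- a6 * (m - 0)) * norm (matrix_inv (M z m) *v (y - z))"
        by (rule shrink) (auto simp: m_def intro: center_mem)
      also have "\<dots> \<le> a5 * 2 powr (- a6 * m) * 1"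
        using that pos by (intro mult_mono) (auto simp: mem_E chart_def)
      also have "\<dots> \<le> r / (mat_norm (M z 0) + 1)"
        using powr_neg_le[of X m] X r mn pos unfolding X_def m_def by (simp add: field_simps)
      finally have le: "norm (matrix_inv (M z 0) *v (y - z)) \<le> r / (mat_norm (M z 0) + 1)" .
      have "norm (y - z) = norm (M z 0 *v (matrix_inv (M z 0) *v (y - z)))" by (simp add: M_inv)
      also have "\<dots> \<le> mat_norm (M z 0) * norm (matrix_inv (M z 0) *v (y - z))" by (rule norm_mult_le)
      also have "\<dots> \<le> mat_norm (M z 0) * (r / (mat_norm (M z 0) + 1))" using le mn by (rule mult_left_mono)
      also have "\<dots> < r" using r mn by (simp add: field_simps)
      finally show ?thesis by (simp add: dist_norm norm_minus_commute)
    qed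
    then have "E z m \<subseteq> \<Omega>" using r by auto
    moreover have "0 \<le> m" by (simp add: m_def)
    ultimately show ?thesis by blast
  qed
  then obtain m where m: "E z m \<subseteq> \<Omega>" by blast
  have "\<exists>k::nat. \<not> E z (m - real k) \<subseteq> \<Omega>"
  proof (rule ccontr)
    assume "\<not> ?thesis"
    then have sub: "E z (m - real k) \<subseteq> \<Omega>" for k by blast
    have fin: "\<Omega> \<in> lmeasurable" using assms by (auto simp: fmeasurable_def)
    have "a1 * 2 powr (- m) * real k \<le> measure lebesgue \<Omega>" for k :: nat
    proof -
      \<comment> \<open>Volumes of the enlarged ellipsoids grow exponentially; linear growth suffices.\<close>
      have "real k \<le> 2 ^ k" by (simp add: less_imp_le of_nat_less_two_power)
      then have "a1 * 2 powr (- m) * real k \<le> a1 * 2 powr (- m) * 2 powr (real k)"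
        using pos by (intro mult_left_mono) (auto simp: powr_realpow)
      also have "\<dots> = a1 * 2 powr (- (m - real k))" by (simp add: powr_add[symmetric])
      also have "\<dots> \<le> measure lebesgue (E z (m - real k))" by (rule measure_E)
      also have "\<dots> \<le> measure lebesgue \<Omega>"
        by (rule measure_mono_fmeasurable[OF sub _ fin]) (use E_lmeasurable in auto)
      finally show ?thesis .
    qed
    moreover have "0 < a1 * 2 powr (- m)" using pos by simp
    ultimately show False using reals_Archimedean3 by (metis mult.commute not_less)
  qed
  then obtain k where k: "\<not> E z (m - real k) \<subseteq> \<Omega>" and min: "\<And>j. j < k \<Longrightarrow> E z (m - real j) \<subseteq> \<Omega>"
    using exists_least_iff[of "\<lambda>k. \<not> E z (m - real k) \<subseteq> \<Omega>"] by blast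
  have "k \<noteq> 0" using k m by (metis diff_zero of_nat_0)
  then obtain j where j: "k = Suc j" by (cases k) auto
  have "E z ((m - real j + J0) - J0) \<subseteq> \<Omega>" "\<not> E z ((m - real j + J0) - J1) \<subseteq> \<Omega>"
    using min[of j] k j by (auto simp: J1_def algebra_simps)
  then show ?thesis by blast
qed

lemma card_disjoint_cores:
  assumes "\<And>a. a \<in> F \<Longrightarrow> S a \<in> lmeasurable" "\<And>a b. a \<in> F \<Longrightarrow> b \<in> F \<Longrightarrow> a \<noteq> b \<Longrightarrow> S a \<inter> S b = {}"
    and "\<And>a. a \<in> F \<Longrightarrow> S a \<subseteq> T" "T \<in> lmeasurable" "\<And>a. a \<in> F \<Longrightarrow> v \<le> measure lebesgue (S a)" "finite F"
  shows "real (card F) * v \<le> measure lebesgue T"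
proof -
  have "real (card F) * v \<le> (\<Sum>a\<in>F. measure lebesgue (S a))"
    using sum_mono[of F "\<lambda>_. v" "\<lambda>a. measure lebesgue (S a)"] assms(5) by simp
  also have "\<dots> = measure lebesgue (\<Union>a\<in>F. S a)"
    by (rule measure_UNION'[symmetric]) (use assms in \<open>auto simp: pairwise_def disjnt_def\<close>)
  also have "\<dots> \<le> measure lebesgue T"
  proof (rule measure_mono_fmeasurable)
    show "(\<Union>a\<in>F. S a) \<subseteq> T" using assms(3) by blast
    show "(\<Union>a\<in>F. S a) \<in> sets lebesgue"
      using assms(1) by (intro sets.finite_UN assms(6)) (auto intro: fmeasurableD)
  qed (rule assms(4))
  finally show ?thesis .
qed

text \<open>Take a maximal family of points with disjoint shrunk ellipsoids. By maximality the shrunk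
  ellipsoid of any point of the set meets a selected one, and engulfing puts the point into
  the core of the latter. The Whitney ellipsoids containing a given point have comparable
  sizes, so their disjoint shrunk copies all lie in one ellipsoid of comparable size and can
  be counted by volume.\<close>

theorem whitney_exists:
  assumes "open \<Omega>" "emeasure lebesgue \<Omega> < \<infinity>"
  shows "\<exists>I x t. whitney \<Omega> I x t"
proof -
  obtain \<tau> where \<tau>: "\<And>z. z \<in> \<Omega> \<Longrightarrow> E z (\<tau> z - J0) \<subseteq> \<Omega>" "\<And>z. z \<in> \<Omega> \<Longrightarrow> \<not> E z (\<tau> z - J1) \<subseteq> \<Omega>"
    using exists_whitney_scale[OF assms] by metis
  define core where "core = (\<lambda>z. E z (\<tau> z + J5))"
  define \<A> where "\<A> = {W. W \<subseteq> \<Omega> \<and> (\<forall>a\<in>W. \<forall>b\<in>W. a \<noteq> b \<longrightarrow> core a \<inter> core b = {})}"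
  have "\<exists>W\<in>\<A>. \<forall>X\<in>\<A>. W \<subseteq> X \<longrightarrow> X = W"
  proof (rule subset_Zorn_nonempty)
    show "\<A> \<noteq> {}" unfolding \<A>_def by blast
    fix \<C> assume C: "\<C> \<noteq> {}" "subset.chain \<A> \<C>"
    show "\<Union>\<C> \<in> \<A>" unfolding \<A>_def
    proof (intro CollectI conjI ballI impI)
      show "\<Union>\<C> \<subseteq> \<Omega>" using C unfolding subset_chain_def \<A>_def by auto
      fix a b assume "a \<in> \<Union>\<C>" "b \<in> \<Union>\<C>" "a \<noteq> b"
      then obtain X Y where XY: "a \<in> X" "b \<in> Y" "X \<in> \<C>" "Y \<in> \<C>" by blast
      then have "X \<subseteq> Y \<or> Y \<subseteq> X" using C unfolding subset_chain_def by blast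
      then obtain Z where "Z \<in> \<C>" "a \<in> Z" "b \<in> Z" using XY by blast
      then show "core a \<inter> core b = {}" using C \<open>a \<noteq> b\<close> unfolding subset_chain_def \<A>_def by blast
    qed
  qed
  then obtain W where W: "W \<in> \<A>" and max: "\<And>X. X \<in> \<A> \<Longrightarrow> W \<subseteq> X \<Longrightarrow> X = W" by blast
  have W1: "W \<subseteq> \<Omega>" and W2: "\<And>a b. a \<in> W \<Longrightarrow> b \<in> W \<Longrightarrow> a \<noteq> b \<Longrightarrow> core a \<inter> core b = {}"
    using W by (auto simp: \<A>_def)
  have mem_core: "z \<in> core z" for z by (simp add: core_def)
  have core_sub: "core z \<subseteq> E z (\<tau> z)" for z
    unfolding core_def using nested[OF J5_ge(1), of z "\<tau> z + J5"] by simp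
  have meet: "\<exists>a\<in>W. core a \<inter> core z \<noteq> {}" if "z \<in> \<Omega>" for z
  proof (cases "z \<in> W")
    case True then show ?thesis using mem_core by blast
  next
    case False
    show ?thesis
    proof (rule ccontr)
      assume "\<not> ?thesis"
      then have "insert z W \<in> \<A>" unfolding \<A>_def using W1 W2 that by (auto simp: Int_commute)
      then have "insert z W = W" using max by blast
      then show False using False by blast
    qed
  qed
  have cover: "\<exists>a\<in>W. norm (chart a (\<tau> a + J3) z) \<le> 1 / 4" if z: "z \<in> \<Omega>" for z
  proof -
    obtain a where a: "a \<in> W" "core a \<inter> core z \<noteq> {}" using meet[OF z] by blast
    then have aO: "a \<in> \<Omega>" using W1 by blast
    have "E z (\<tau> z) \<inter> E a (\<tau> a) \<noteq> {}" using a core_sub by blast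
    from comparable_scale[OF \<tau>(2)[OF aO] \<tau>(1)[OF z]] this have lt: "\<tau> a - J1 < \<tau> z" by blast
    have "core a \<subseteq> E a (\<tau> a + J5 - J1)" unfolding core_def by (rule nested) (simp add: J1_def)
    then have "E a (\<tau> a + J5 - J1) \<inter> E z (\<tau> z + J5) \<noteq> {}" using a unfolding core_def by blast
    from engulf_subset[OF this _ order_refl] lt
    have "z \<in> E a (\<tau> a + J5 - J1 - J0)" using center_mem by auto
    then have lt1: "norm (chart a (\<tau> a + J5 - J1 - J0) z) < 1" by (simp add: mem_E)
    have J: "\<tau> a + J3 \<le> \<tau> a + J5 - J1 - J0" by (simp add: J5_def)
    have "norm (chart a (\<tau> a + J3) z) \<le> a5 * 2 powr (- a6 * ((\<tau> a + J5 - J1 - J0) - (\<tau> a + J3)))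
        * norm (chart a (\<tau> a + J5 - J1 - J0) z)"
      unfolding chart_def using center_mem J by (intro shrink) blast+
    also have "\<dots> \<le> a5 * 2 powr (- a6 * ((\<tau> a + J5 - J1 - J0) - (\<tau> a + J3))) * 1"
      using lt1 pos by (intro mult_left_mono) auto
    also have "\<dots> = (4 * a5 * 2 powr (- a6 * (J5 - J1 - J0 - J3))) / 4" by (simp add: algebra_simps)
    also have "\<dots> \<le> 1 / 4"
      using powr_neg_le[of "4 * a5" "J5 - J1 - J0 - J3"] pos by (simp add: J5_def)
    finally show ?thesis using a by blast
  qed
  have bounded_overlap: "finite {a\<in>W. z \<in> E a (\<tau> a)} \<and> card {a\<in>W. z \<in> E a (\<tau> a)} \<le> overlap" for z
  proof (rule finite_if_finite_subsets_card_bdd)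
    fix F assume F: "F \<subseteq> {a\<in>W. z \<in> E a (\<tau> a)}" "finite F"
    show "card F \<le> overlap"
    proof (cases "F = {}")
      case False
      then obtain b where b: "b \<in> F" by blast
      have bO: "b \<in> \<Omega>" using b F W1 by blast
      define T where "T = E b (\<tau> b - J1 - J0)"
      define v where "v = a1 * 2 powr (- (\<tau> b + J1 + J5))"
      have lt: "\<tau> b - J1 < \<tau> a" "\<tau> a - J1 < \<tau> b" if "a \<in> F" for a
      proof -
        have aO: "a \<in> \<Omega>" and "E a (\<tau> a) \<inter> E b (\<tau> b) \<noteq> {}" "E b (\<tau> b) \<inter> E a (\<tau> a) \<noteq> {}" using that b F W1 by auto
        then show "\<tau> b - J1 < \<tau> a" "\<tau> a - J1 < \<tau> b"
          using comparable_scale[OF \<tau>(2)[OF bO] \<tau>(1)[OF aO]] comparable_scale[OF \<tau>(2)[OF aO] \<tau>(1)[OF bO]] by blast+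
      qed
      have "real (card F) * v \<le> measure lebesgue T"
      proof (rule card_disjoint_cores[where S=core])
        fix a assume a: "a \<in> F"
        show "core a \<in> lmeasurable" unfolding core_def by (rule E_lmeasurable)
        show "v \<le> measure lebesgue (core a)"
        proof -
          have "v \<le> a1 * 2 powr (- (\<tau> a + J5))"
            using lt[OF a] pos by (auto simp: v_def intro!: mult_left_mono)
          also have "\<dots> \<le> measure lebesgue (core a)" unfolding core_def by (rule measure_E)
          finally show ?thesis .
        qed
        have "E b (\<tau> b) \<subseteq> E b (\<tau> b - J1)" by (rule nested) (simp add: J1_def)
        moreover have "E b (\<tau> b) \<inter> E a (\<tau> a) \<noteq> {}" using a b F by blast
        ultimately have "E b (\<tau> b - J1) \<inter> E a (\<tau> a) \<noteq> {}" by blast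
        from engulf_subset[OF this _ order_refl] lt[OF a] have "E a (\<tau> a) \<subseteq> T" unfolding T_def by simp
        then show "core a \<subseteq> T" using core_sub by blast
      next
        fix a b assume "a \<in> F" "b \<in> F" "a \<noteq> b"
        then show "core a \<inter> core b = {}" using W2 F by blast
      qed (use F in \<open>auto simp: T_def E_lmeasurable\<close>)
      also have "\<dots> \<le> a2 * 2 powr (- (\<tau> b - J1 - J0))" unfolding T_def by (rule measure_E)
      finally have "real (card F) * v \<le> a2 * 2 powr (- (\<tau> b - J1 - J0))" .
      also have "\<dots> = a2 / a1 * 2 powr (2 * J1 + J0 + J5) * v"
        using pos by (simp add: v_def powr_add[symmetric] mult.assoc) (simp add: algebra_simps powr_add[symmetric])
      finally have "real (card F) \<le> a2 / a1 * 2 powr (2 * J1 + J0 + J5)" using pos by (simp add: v_def field_simps)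
      then show ?thesis unfolding overlap_def by (simp add: le_nat_floor)
    qed simp
  qed
  have "countable W"
  proof -
    have inj: "inj_on core W" using W2 mem_core unfolding inj_on_def by blast
    have "countable (core ` W)"
    proof (rule countable_disjoint_open_subsets)
      show "open S" if "S \<in> core ` W" for S using that open_E by (auto simp: core_def)
      show "disjoint (core ` W)" using W2 by (force simp: disjoint_def)
    qed
    then show ?thesis using inj by (metis countable_image_inj_eq)
  qed
  define I where "I = to_nat_on W ` W"
  define x where "x = from_nat_into W"
  have x: "x (to_nat_on W a) = a" if "a \<in> W" for a using \<open>countable W\<close> that by (simp add: x_def)
  have xW: "x i \<in> W" if "i \<in> I" for i using that x by (auto simp: I_def)
  have inj: "inj_on x I" unfolding inj_on_def I_def using x by auto
  have "whitney \<Omega> I x (\<tau> \<circ> x)"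
    unfolding whitney_def
  proof (intro conjI ballI allI)
    fix i assume "i \<in> I"
    then show "E (x i) ((\<tau> \<circ> x) i - J0) \<subseteq> \<Omega>" "\<not> E (x i) ((\<tau> \<circ> x) i - J1) \<subseteq> \<Omega>"
      using xW[OF \<open>i \<in> I\<close>] \<tau>(1)[of "x i"] \<tau>(2)[of "x i"] W1 by auto
  next
    fix z assume "z \<in> \<Omega>"
    from cover[OF this] obtain a where a: "a \<in> W" "norm (chart a (\<tau> a + J3) z) \<le> 1 / 4" by blast
    then show "\<exists>i\<in>I. norm (chart (x i) ((\<tau> \<circ> x) i + J3) z) \<le> 1 / 4"
      by (intro bexI[of _ "to_nat_on W a"]) (auto simp: x I_def)
  next
    fix z
    let ?A = "{i \<in> I. z \<in> E (x i) ((\<tau> \<circ> x) i)}"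
    have sub: "x ` ?A \<subseteq> {a\<in>W. z \<in> E a (\<tau> a)}" using xW by auto
    have inj': "inj_on x ?A" using inj by (rule inj_on_subset) auto
    have fin: "finite {a\<in>W. z \<in> E a (\<tau> a)}" and cd: "card {a\<in>W. z \<in> E a (\<tau> a)} \<le> overlap"
      using bounded_overlap by auto
    show "finite ?A" using finite_imageD[OF finite_subset[OF sub fin] inj'] .
    show "card ?A \<le> overlap" using card_mono[OF fin sub] card_image[OF inj'] cd by simp
  qed
  then show ?thesis by blast
qed

end

section \<open>Linear changes of variables\<close>

text \<open>Every linear map is a composition of elementary ones; for swaps and shears the claim need only
  be tested on boxes.\<close>

lemma measure_linear_image_finite:
  fixes f :: "real^'n \<Rightarrow> real^'n"
  assumes "linear f" "S \<in> lmeasurable"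
  shows "f ` S \<in> lmeasurable" "measure lebesgue (f ` S) = \<bar>det (matrix f)\<bar> * measure lebesgue S"
proof -
  let ?P = "\<lambda>f :: real^'n \<Rightarrow> real^'n. \<forall>S\<in>lmeasurable. f ` S \<in> lmeasurable \<and>
     measure lebesgue (f ` S) = \<bar>det (matrix f)\<bar> * measure lebesgue S"
  have "?P f"
  proof (rule induct_linear_elementary[OF \<open>linear f\<close>])
    fix f g :: "real^'n \<Rightarrow> real^'n"
    assume lin: "linear f" "linear g" and P: "?P f" "?P g"
    have "det (matrix (f \<circ> g)) = det (matrix f) * det (matrix g)"
      by (simp add: matrix_compose[OF lin(2,1)] det_mul)
    moreover have "(f \<circ> g) ` S = f ` (g ` S)" for S by (simp add: image_comp)
    ultimately show "?P (f \<circ> g)" using P by (simp add: abs_mult del: o_apply)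
  next
    fix f :: "real^'n \<Rightarrow> real^'n" and i
    assume lin: "linear f" and "\<And>x. f x $ i = 0"
    then have "\<not> surj f" by (metis one_neq_zero surjE vec_component)
    then have ni: "\<not> inj f" using linear_injective_imp_surjective[OF lin] by blast
    then have "det (matrix f) = 0" "\<And>S. negligible (f ` S)"
      using det_nz_iff_inj[OF lin] negligible_linear_singular_image[OF lin] by blast+
    then show "?P f" by (simp add: negligible_iff_measure)
  next
    fix c :: "'n \<Rightarrow> real"
    have "det (matrix (\<lambda>x::real^'n. \<chi> i. c i * x $ i)) = prod c UNIV"
      by (simp add: matrix_def axis_def det_diagonal)
    then show "?P (\<lambda>x. \<chi> i. c i * x $ i)"
      using measurable_stretch[of _ c] measure_stretch[of _ c] by simp
  next
    fix m n :: 'n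
    assume "m \<noteq> n"
    let ?\<tau> = "Transposition.transpose m n"
    let ?f = "\<lambda>x::real^'n. \<chi> i. x $ ?\<tau> i"
    have lin: "linear ?f" by (rule linearI) (simp_all add: vec_eq_iff)
    have "matrix ?f = (\<chi> i. (mat 1 :: real^'n^'n) $ ?\<tau> i)"
      by (simp add: matrix_def mat_def axis_def vec_eq_iff eq_commute)
    then have det: "\<bar>det (matrix ?f)\<bar> = 1"
      using det_permute_rows[of ?\<tau> "mat 1 :: real^'n^'n"] permutes_swap_id[of m UNIV n]
      by (simp add: abs_mult sign_def)
    have "measure lebesgue (?f ` cbox a b) = \<bar>det (matrix ?f)\<bar> * measure lebesgue (cbox a b)" for a b
    proof -
      have "?f ` cbox a b = cbox (?f a) (?f b)"
      proof (intro set_eqI iffI)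
        fix y assume "y \<in> cbox (?f a) (?f b)"
        then have "\<And>i. a $ ?\<tau> i \<le> y $ i \<and> y $ i \<le> b $ ?\<tau> i" by (simp add: mem_box_cart)
        from this[of "?\<tau> _"] have "?f y \<in> cbox a b" by (simp add: mem_box_cart)
        moreover have "y = ?f (?f y)" by (simp add: vec_eq_iff)
        ultimately show "y \<in> ?f ` cbox a b" by blast
      qed (auto simp: mem_box_cart)
      moreover have "(\<Prod>i\<in>UNIV. b $ ?\<tau> i - a $ ?\<tau> i) = (\<Prod>i\<in>UNIV. b $ i - a $ i)"
        by (rule prod.reindex_bij_betw) (simp add: bij_betw_def surj_transpose)
      moreover have "cbox (?f a) (?f b) = {} \<longleftrightarrow> cbox a b = {}" using calculation(1) by blast
      ultimately show ?thesis by (simp add: det content_cbox_if_cart)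
    qed
    then show "?P ?f" using measure_linear_sufficient[OF lin, of _ "\<bar>det (matrix ?f)\<bar>"] by simp
  next
    fix m n :: 'n
    assume mn: "m \<noteq> n"
    let ?f = "\<lambda>x::real^'n. \<chi> i. if i = m then x $ m + x $ n else x $ i"
    have lin: "linear ?f" by (rule linearI) (simp_all add: vec_eq_iff algebra_simps)
    have "matrix ?f = (\<chi> k. if k = m then row m (mat 1) + 1 *s row n (mat 1 :: real^'n^'n) else row k (mat 1))"
      by (simp add: matrix_def mat_def axis_def row_def vec_eq_iff)
    then have det: "det (matrix ?f) = 1" using det_row_operation[OF mn, of "mat 1 :: real^'n^'n" 1] by simp
    \<comment> \<open>Moving the corner of the box to the origin reduces to a box with nonnegative coordinates.\<close>
    have "measure lebesgue (?f ` cbox a b) = \<bar>det (matrix ?f)\<bar> * measure lebesgue (cbox a b)" for a b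
    proof (cases "cbox a b = {}")
      case False
      have eq: "cbox a b = (+) a ` cbox 0 (b - a)" using cbox_translation[of a 0 "b - a"] by simp
      then have ne: "cbox 0 (b - a) \<noteq> {}" using False by auto
      have "?f ` cbox a b = (+) (?f a) ` ?f ` cbox 0 (b - a)"
        unfolding eq image_image by (rule image_cong) (simp_all add: vec_eq_iff)
      then have "measure lebesgue (?f ` cbox a b) = measure lebesgue (?f ` cbox 0 (b - a))"
        by (simp add: measure_translation)
      also have "\<dots> = measure lebesgue (cbox 0 (b - a))"
        using measure_shear_interval[OF mn ne] by simp
      also have "\<dots> = measure lebesgue (cbox a b)" unfolding eq by (rule measure_translation[symmetric])
      finally show ?thesis by (simp add: det)
    qed simp
    then show "?P ?f" using measure_linear_sufficient[OF lin, of _ "\<bar>det (matrix ?f)\<bar>"] by simp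
  qed
  with assms(2) show "f ` S \<in> lmeasurable" "measure lebesgue (f ` S) = \<bar>det (matrix f)\<bar> * measure lebesgue S"
    by auto
qed

lemma lborel_affine_matrix:
  fixes A :: "real^'n^'n"
  assumes "invertible A"
  shows "lborel = density (distr lborel borel (\<lambda>w. A *v w + x)) (\<lambda>_. ennreal \<bar>det A\<bar>)"
proof (rule lborel_eqI)
  let ?T = "\<lambda>w. A *v w + x"
  have T: "?T \<in> borel \<rightarrow>\<^sub>M borel"
    by (intro borel_measurable_continuous_onI continuous_intros linear_continuous_on_compose matrix_vector_mul_linear)
  fix l u :: "real^'n"
  assume lu: "\<And>b. b \<in> Basis \<Longrightarrow> l \<bullet> b \<le> u \<bullet> b"
  obtain B where B: "A ** B = mat 1" "B ** A = mat 1" using assms unfolding invertible_def by blast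
  define S where "S = ?T -` box l u"
  have S_eq: "S = (*v) B ` ((+) (- x) ` box l u)"
  proof (intro set_eqI iffI)
    fix w assume "w \<in> S"
    then have "A *v w + x \<in> box l u" by (simp add: S_def)
    moreover have "w = B *v (- x + (A *v w + x))" by (simp add: matrix_vector_mul_assoc B)
    ultimately show "w \<in> (*v) B ` ((+) (- x) ` box l u)" by blast
  next
    fix w assume "w \<in> (*v) B ` ((+) (- x) ` box l u)"
    then obtain z where "z \<in> box l u" "w = B *v (- x + z)" by blast
    then show "w \<in> S" by (simp add: S_def matrix_vector_mul_assoc B)
  qed
  have Sm: "S \<in> lmeasurable" unfolding S_eq
    by (intro measure_linear_image_finite(1) matrix_vector_mul_linear measurable_translation) auto
  have Sb: "S \<in> sets borel" unfolding S_def using measurable_sets_borel[OF T] by auto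
  have "(*v) A ` S = (+) (- x) ` box l u"
    unfolding S_eq image_image by (simp add: matrix_vector_mul_assoc B)
  then have "measure lebesgue (box l u) = \<bar>det A\<bar> * measure lebesgue S"
    using measure_linear_image_finite(2)[OF matrix_vector_mul_linear Sm, of A] measure_translation[of "- x" "box l u"]
    by (simp only: matrix_of_matrix_vector_mul)
  then have m: "measure lborel (box l u) = \<bar>det A\<bar> * measure lborel S"
    using Sb by simp
  have fin: "emeasure lborel S \<noteq> \<infinity>" using Sm Sb by (simp add: fmeasurable_def)
  have "emeasure (density (distr lborel borel ?T) (\<lambda>_. ennreal \<bar>det A\<bar>)) (box l u) = ennreal \<bar>det A\<bar> * emeasure lborel S"
    using T by (simp add: emeasure_density emeasure_distr nn_integral_cmult_indicator S_def nn_integral_distr)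
  also have "\<dots> = ennreal (\<bar>det A\<bar> * measure lborel S)"
    using fin by (simp add: emeasure_eq_ennreal_measure ennreal_mult)
  also have "\<dots> = ennreal (measure lborel (box l u))" using m by simp
  also have "\<dots> = (\<Prod>b\<in>Basis. (u - l) \<bullet> b)"
    using lu by (simp add: measure_lborel_box_eq)
  finally show "emeasure (density (distr lborel borel ?T) (\<lambda>_. ennreal \<bar>det A\<bar>)) (box l u) = (\<Prod>b\<in>Basis. (u - l) \<bullet> b)" .
qed simp

lemma integral_affine_matrix:
  fixes A :: "real^'n^'n" and g :: "real^'n \<Rightarrow> real"
  assumes "invertible A" "g \<in> borel_measurable borel"
  shows "(LINT z|lborel. g z) = \<bar>det A\<bar> * (LINT w|lborel. g (A *v w + x))"
proof -
  let ?T = "\<lambda>w. A *v w + x"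
  have T[measurable]: "?T \<in> borel \<rightarrow>\<^sub>M borel"
    by (intro borel_measurable_continuous_onI continuous_intros linear_continuous_on_compose matrix_vector_mul_linear)
  note assms(2)[measurable]
  have "(LINT z|lborel. g z) = (LINT z|density (distr lborel borel ?T) (\<lambda>_. ennreal \<bar>det A\<bar>). g z)"
    using lborel_affine_matrix[OF assms(1), of x] by simp
  also have "\<dots> = \<bar>det A\<bar> * (LINT w|lborel. g (?T w))"
    by (subst integral_density) (auto simp: integral_distr)
  finally show ?thesis .
qed

section \<open>Polynomials and moment matching\<close>

definition monomial :: "('n \<Rightarrow> nat) \<Rightarrow> real^'n \<Rightarrow> real" where
  "monomial \<alpha> w = (\<Prod>i\<in>UNIV. (w $ i) ^ \<alpha> i)"

definition polys :: "nat \<Rightarrow> (real^'n \<Rightarrow> real) set" where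
  "polys d = {p. \<exists>c. \<forall>w. p w = (\<Sum>\<alpha>\<in>{\<alpha>. mi_abs \<alpha> \<le> d}. c \<alpha> * monomial \<alpha> w)}"

lemma finite_mi: "finite {\<alpha> :: 'n::finite \<Rightarrow> nat. mi_abs \<alpha> \<le> d}"
proof (rule finite_subset)
  show "{\<alpha> :: 'n \<Rightarrow> nat. mi_abs \<alpha> \<le> d} \<subseteq> PiE UNIV (\<lambda>_. {..d})"
  proof
    fix \<alpha> :: "'n \<Rightarrow> nat" assume "\<alpha> \<in> {\<alpha>. mi_abs \<alpha> \<le> d}"
    then have le: "(\<Sum>i\<in>UNIV. \<alpha> i) \<le> d" by (simp add: mi_abs_def)
    have "\<alpha> i \<le> d" for i using le member_le_sum[of i UNIV \<alpha>] by simp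
    then show "\<alpha> \<in> PiE UNIV (\<lambda>_. {..d})" by (simp add: PiE_iff)
  qed
qed (simp add: finite_PiE)

lemma polys_monomial: "mi_abs \<alpha> \<le> d \<Longrightarrow> monomial \<alpha> \<in> polys d"
proof -
  assume a: "mi_abs \<alpha> \<le> d"
  define c :: "('a \<Rightarrow> nat) \<Rightarrow> real" where "c = (\<lambda>\<beta>. if \<beta> = \<alpha> then 1 else 0)"
  have "(\<Sum>\<beta> | mi_abs \<beta> \<le> d. c \<beta> * monomial \<beta> w) = (\<Sum>\<beta> | mi_abs \<beta> \<le> d. if \<beta> = \<alpha> then monomial \<beta> w else 0)" for w
    by (rule sum.cong) (auto simp: c_def)
  then show ?thesis using a unfolding polys_def by (intro CollectI exI[of _ c]) (simp add: finite_mi)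
qed

lemma polys_add: "p \<in> polys d \<Longrightarrow> r \<in> polys d \<Longrightarrow> (\<lambda>w. p w + r w) \<in> polys d"
  unfolding polys_def
proof (clarsimp)
  fix c c' assume "\<forall>w. p w = (\<Sum>\<alpha> | mi_abs \<alpha> \<le> d. c \<alpha> * monomial \<alpha> w)" "\<forall>w. r w = (\<Sum>\<alpha> | mi_abs \<alpha> \<le> d. c' \<alpha> * monomial \<alpha> w)"
  then show "\<exists>ca. \<forall>w. (\<Sum>\<alpha> | mi_abs \<alpha> \<le> d. c \<alpha> * monomial \<alpha> w) + (\<Sum>\<alpha> | mi_abs \<alpha> \<le> d. c' \<alpha> * monomial \<alpha> w) =
             (\<Sum>\<alpha> | mi_abs \<alpha> \<le> d. ca \<alpha> * monomial \<alpha> w)"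
    by (intro exI[of _ "\<lambda>\<alpha>. c \<alpha> + c' \<alpha>"]) (simp add: sum.distrib distrib_right)
qed

lemma polys_cmult: "p \<in> polys d \<Longrightarrow> (\<lambda>w. c * p w) \<in> polys d"
  unfolding polys_def
proof (clarsimp)
  fix c'
  show "\<exists>ca. \<forall>w. c * (\<Sum>\<alpha> | mi_abs \<alpha> \<le> d. c' \<alpha> * monomial \<alpha> w) = (\<Sum>\<alpha> | mi_abs \<alpha> \<le> d. ca \<alpha> * monomial \<alpha> w)"
    by (intro exI[of _ "\<lambda>\<alpha>. c * c' \<alpha>"]) (simp add: sum_distrib_left mult.assoc)
qed

lemma polys_zero: "(\<lambda>w. 0) \<in> polys d"
  unfolding polys_def by (auto intro: exI[of _ "\<lambda>_. 0"])

lemma polys_sum: "(\<And>a. a \<in> A \<Longrightarrow> f a \<in> polys d) \<Longrightarrow> (\<lambda>w. \<Sum>a\<in>A. f a w) \<in> polys d"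
  by (induction A rule: infinite_finite_induct) (auto intro: polys_zero polys_add)

lemma polys_induct [consumes 1, case_names zero add cmult monomial]:
  assumes "p \<in> polys d" "P (\<lambda>w. 0)" "\<And>p r. P p \<Longrightarrow> P r \<Longrightarrow> P (\<lambda>w. p w + r w)"
    "\<And>c p. P p \<Longrightarrow> P (\<lambda>w. c * p w)" "\<And>\<alpha>. mi_abs \<alpha> \<le> d \<Longrightarrow> P (monomial \<alpha>)"
  shows "P p"
proof -
  obtain c where "\<forall>w. p w = (\<Sum>\<alpha> | mi_abs \<alpha> \<le> d. c \<alpha> * monomial \<alpha> w)" using assms(1) by (auto simp: polys_def)
  then have p: "p = (\<lambda>w. \<Sum>\<alpha> | mi_abs \<alpha> \<le> d. c \<alpha> * monomial \<alpha> w)" by auto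
  have "P (\<lambda>w. \<Sum>\<alpha>\<in>A. c \<alpha> * monomial \<alpha> w)" if "finite A" "A \<subseteq> {\<alpha>. mi_abs \<alpha> \<le> d}" for A
    using that
  proof (induction A rule: finite_induct)
    case empty show ?case using assms(2) by simp
  next
    case (insert x F)
    then have "P (\<lambda>w. c x * monomial x w + (\<Sum>\<alpha>\<in>F. c \<alpha> * monomial \<alpha> w))"
      by (intro assms(3) assms(4)[of "monomial x"] assms(5)) auto
    then show ?case using insert by simp
  qed
  then show ?thesis unfolding p using finite_mi by blast
qed

lemma polys_mono: "p \<in> polys d \<Longrightarrow> d \<le> d' \<Longrightarrow> p \<in> polys d'"
  by (induction rule: polys_induct) (auto intro: polys_zero polys_add polys_cmult polys_monomial)

lemma polys_const: "(\<lambda>w. c) \<in> polys d"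
proof -
  have "monomial (\<lambda>_. 0) \<in> polys d" by (rule polys_monomial) (simp add: mi_abs_def)
  from polys_cmult[OF this, of c] show ?thesis by (simp add: monomial_def)
qed

lemma polys_coordinate_mult: "p \<in> polys d \<Longrightarrow> (\<lambda>w. w $ i * p w) \<in> polys (Suc d)"
proof (induction rule: polys_induct)
  case zero then show ?case by (simp add: polys_zero)
next
  case (add p r) then show ?case using polys_add by (fastforce simp: distrib_left)
next
  case (cmult c p) then show ?case using polys_cmult[of "\<lambda>w. w $ i * p w" _ c] by (simp add: mult.left_commute)
next
  case (monomial \<alpha>)
  have "monomial (\<alpha>(i := Suc (\<alpha> i))) w = w $ i * monomial \<alpha> w" for w
    unfolding monomial_def by (subst (1 2) prod.remove[of UNIV i]) (auto simp: mult.assoc intro!: prod.cong)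
  moreover have "mi_abs (\<alpha>(i := Suc (\<alpha> i))) = Suc (mi_abs \<alpha>)"
    unfolding mi_abs_def by (subst (1 2) sum.remove[of UNIV i]) (auto intro!: sum.cong)
  ultimately show ?case
    using polys_monomial[of "\<alpha>(i := Suc (\<alpha> i))" "Suc d"] monomial by (metis (no_types, lifting) Suc_le_mono ext)
qed

lemma polys_affine_mult:
  "p \<in> polys d \<Longrightarrow> (\<lambda>w. ((A *v w + b) $ i) * p w) \<in> polys (Suc d)"
proof -
  assume p: "p \<in> polys d"
  have "(\<lambda>w. (\<Sum>j\<in>UNIV. A $ i $ j * (w $ j * p w)) + b $ i * p w) \<in> polys (Suc d)"
    by (intro polys_add polys_sum polys_cmult polys_coordinate_mult p polys_mono[OF p]) auto
  then show ?thesis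
    by (simp add: matrix_vector_mult_def distrib_right sum_distrib_right mult.assoc)
qed

text \<open>Vanishing moments up to degree \<open>d\<close> do not depend on affine coordinates, which is what allows
  working in the coordinates of an ellipsoid.\<close>

lemma polys_affine:
  fixes A :: "real^'n^'n"
  assumes "p \<in> polys d" shows "(\<lambda>w. p (A *v w + b)) \<in> polys d"
  using assms
proof (induction rule: polys_induct)
  case (monomial \<alpha>)
  have pw: "(\<lambda>w. ((A *v w + b) $ i) ^ k * p w) \<in> polys (k + d)" if "p \<in> polys d" for i k p d
    using that
  proof (induction k)
    case (Suc k)
    then show ?case using polys_affine_mult[of "\<lambda>w. ((A *v w + b) $ i) ^ k * p w" "k + d" A b i] by (simp add: mult.assoc)
  qed simp
  have "(\<lambda>w. \<Prod>i\<in>I. ((A *v w + b) $ i) ^ \<alpha> i) \<in> polys (\<Sum>i\<in>I. \<alpha> i)" if "finite I" for I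
    using that
  proof (induction I rule: finite_induct)
    case empty show ?case by (simp add: polys_const)
  next
    case (insert i I)
    from pw[OF insert.IH, of i "\<alpha> i"] show ?case using insert by (simp del: vector_add_component)
  qed
  from this[of UNIV] show ?case using monomial polys_mono[of _ "\<Sum>i\<in>UNIV. \<alpha> i" d]
    unfolding monomial_def mi_abs_def by simp
qed (auto intro: polys_zero polys_add polys_cmult)

lemma polys_bounded_derivs:
  fixes p :: "real^'n \<Rightarrow> real"
  shows "p \<in> polys d \<Longrightarrow> \<exists>K\<ge>0. bounded_derivs N K (ball 0 1) p"
proof (induction rule: polys_induct)
  case zero
  then show ?case using bounded_derivs_const[of N 0] by auto
next
  case (add p r)
  then obtain K L where "0 \<le> K" "0 \<le> L" "bounded_derivs N K (ball 0 1) p" "bounded_derivs N L (ball 0 1) r" by blast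
  then show ?case using bounded_derivs_add[of N K "ball 0 1" p L r] by (intro exI[of _ "K + L"]) simp
next
  case (cmult c p)
  then obtain K where "0 \<le> K" "bounded_derivs N K (ball 0 1) p" by blast
  then show ?case using bounded_derivs_cmult[of N K "ball 0 1" p c] by (intro exI[of _ "\<bar>c\<bar> * K"]) simp
next
  case (monomial \<alpha>)
  have pw: "bounded_derivs N ((2 ^ N * 1) ^ card {..<k}) (ball 0 1) (\<lambda>w. \<Prod>j<k. w $ i)" for i and k :: nat
    by (rule bounded_derivs_prod) (auto intro: bounded_derivs_coordinate)
  define L where "L = (\<Sum>i\<in>UNIV. (2 ^ N) ^ \<alpha> i :: real)"
  have "bounded_derivs N L (ball 0 1) (\<lambda>w. (w $ i) ^ \<alpha> i)" for i
  proof (rule bounded_derivs_mono)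
    show "bounded_derivs N ((2 ^ N) ^ \<alpha> i) (ball 0 1) (\<lambda>w. (w $ i) ^ \<alpha> i)" using pw[of "\<alpha> i" i] by simp
    show "(2 ^ N) ^ \<alpha> i \<le> L" unfolding L_def by (rule member_le_sum) auto
  qed simp
  note power = this
  have "0 \<le> L" by (auto simp: L_def intro: sum_nonneg)
  have "bounded_derivs N ((2 ^ N * L) ^ card (UNIV :: 'n set)) (ball 0 1) (monomial \<alpha>)"
    unfolding monomial_def[abs_def] by (rule bounded_derivs_prod) (simp_all add: power \<open>0 \<le> L\<close>)
  then show ?case using \<open>0 \<le> L\<close> by (intro exI[of _ "(2 ^ N * L) ^ card (UNIV :: 'n set)"]) auto
qed

lemma continuous_polys: "p \<in> polys d \<Longrightarrow> continuous_on S p"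
proof (induction rule: polys_induct)
  case (monomial \<alpha>)
  show ?case unfolding monomial_def by (intro continuous_intros)
qed (auto intro!: continuous_intros)

text \<open>The inner product of \<open>L\<^sup>2\<close> on the ball of radius \<open>1/2\<close>, where the cutoffs live.\<close>

definition ball_inner :: "(real^'n \<Rightarrow> real) \<Rightarrow> (real^'n \<Rightarrow> real) \<Rightarrow> real" where
  "ball_inner p r = (LINT w|lborel. indicator (cball 0 (1/2)) w * (p w * r w))"

lemma integrable_ball:
  "continuous_on UNIV p \<Longrightarrow> integrable lborel (\<lambda>w::real^'n. indicator (cball 0 (1/2)) w * (p w :: real))"
  using borel_integrable_compact[of "cball 0 (1/2)" p] continuous_on_subset[of UNIV p "cball 0 (1/2)"]
  by (simp add: mult.commute)

lemma integrable_ball_mult: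
  assumes "p \<in> polys d" "r \<in> polys d"
  shows "integrable lborel (\<lambda>w. indicator (cball 0 (1/2)) w * (p w * r w))"
  using assms by (intro integrable_ball continuous_intros continuous_polys)

lemma ball_inner_simps:
  assumes "p \<in> polys d" "r \<in> polys d" "u \<in> polys d"
  shows "ball_inner (\<lambda>w. p w + r w) u = ball_inner p u + ball_inner r u"
    "ball_inner (\<lambda>w. c * p w) u = c * ball_inner p u"
    "ball_inner p r = ball_inner r p"
  unfolding ball_inner_def
  using Bochner_Integration.integral_add[OF integrable_ball_mult[OF assms(1,3)] integrable_ball_mult[OF assms(2,3)]]
  by (simp_all add: algebra_simps flip: integral_mult_right_zero)

lemma ball_inner_sum:
  assumes "finite G" "\<And>e. e \<in> G \<Longrightarrow> e \<in> polys d" "u \<in> polys d"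
  shows "ball_inner (\<lambda>w. \<Sum>e\<in>G. c e * e w) u = (\<Sum>e\<in>G. c e * ball_inner e u)"
  using assms
proof (induction G rule: finite_induct)
  case empty then show ?case by (simp add: ball_inner_def)
next
  case (insert e G)
  have "ball_inner (\<lambda>w. c e * e w + (\<Sum>e\<in>G. c e * e w)) u = ball_inner (\<lambda>w. c e * e w) u + ball_inner (\<lambda>w. \<Sum>e\<in>G. c e * e w) u"
    by (rule ball_inner_simps(1)[of _ d]) (use insert in \<open>auto intro!: polys_cmult polys_sum\<close>)
  moreover have "ball_inner (\<lambda>w. c e * e w) u = c e * ball_inner e u"
    by (rule ball_inner_simps(2)[of _ d u]) (use insert in auto)
  ultimately show ?case using insert by simp
qed

lemma ball_inner_cong_AE:
  assumes "AE w in lborel. w \<in> cball 0 (1/2) \<longrightarrow> p w = r w" "continuous_on UNIV p" "continuous_on UNIV r" "continuous_on UNIV u"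
  shows "ball_inner p u = ball_inner r u"
proof -
  have [measurable]: "p \<in> borel_measurable borel" "r \<in> borel_measurable borel" "u \<in> borel_measurable borel"
    using assms by (auto intro: borel_measurable_continuous_onI)
  show ?thesis unfolding ball_inner_def
    by (rule integral_cong_AE) (use assms(1) in \<open>auto elim!: eventually_mono simp: indicator_def\<close>)
qed

text \<open>Gram--Schmidt orthogonalisation. Since \<open>ball_inner\<close> sees functions only almost everywhere on
  the ball, a vanishing remainder yields an identity that holds almost everywhere there.\<close>

lemma orthonormal_basis:
  assumes "finite F" "F \<subseteq> polys d"
  shows "\<exists>G. finite G \<and> G \<subseteq> polys d \<and> (\<forall>e\<in>G. \<forall>e'\<in>G. ball_inner e e' = (if e = e' then 1 else 0)) \<and>
    (\<forall>p\<in>F. AE w in lborel. w \<in> cball 0 (1/2) \<longrightarrow> p w = (\<Sum>e\<in>G. ball_inner p e * e w))"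
  using assms
proof (induction F rule: finite_induct)
  case empty then show ?case by (intro exI[of _ "{}"]) auto
next
  case (insert m F)
  then obtain G where G: "finite G" "G \<subseteq> polys d" "\<forall>e\<in>G. \<forall>e'\<in>G. ball_inner e e' = (if e = e' then 1 else 0)"
    and F: "\<forall>p\<in>F. AE w in lborel. w \<in> cball 0 (1/2) \<longrightarrow> p w = (\<Sum>e\<in>G. ball_inner p e * e w)" by auto
  have m: "m \<in> polys d" using insert by simp
  define s where "s = (\<lambda>w. \<Sum>e\<in>G. ball_inner m e * e w)"
  define r where "r = (\<lambda>w. m w + (-1) * s w)"
  have s: "s \<in> polys d" unfolding s_def using G by (intro polys_sum polys_cmult) auto
  have r: "r \<in> polys d" unfolding r_def by (intro polys_add polys_cmult m s)
  have s_inner: "ball_inner s e = ball_inner m e" if "e \<in> G" for e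
  proof -
    have "ball_inner s e = (\<Sum>e'\<in>G. ball_inner m e' * ball_inner e' e)"
      unfolding s_def by (rule ball_inner_sum[OF G(1), of d]) (use G that in auto)
    also have "\<dots> = (\<Sum>e'\<in>G. if e' = e then ball_inner m e' else 0)"
      using G(3) that by (intro sum.cong) auto
    finally show ?thesis using that G(1) by simp
  qed
  have r_inner: "ball_inner r u = ball_inner m u - ball_inner s u" if "u \<in> polys d" for u
    unfolding r_def using ball_inner_simps(1)[OF m polys_cmult[OF s, of "-1"] that] ball_inner_simps(2)[OF s m that, of "-1"]
    by simp
  have orth: "ball_inner r e = 0" if "e \<in> G" for e
    using r_inner[of e] s_inner[OF that] that G(2) by auto
  show ?case
  proof (cases "ball_inner r r = 0")
    case True
    have "AE w in lborel. indicator (cball 0 (1/2)) w * (r w * r w) = 0"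
      using integral_nonneg_eq_0_iff_AE[OF integrable_ball_mult[OF r r]] True by (auto simp: ball_inner_def)
    then have "AE w in lborel. w \<in> cball 0 (1/2) \<longrightarrow> m w = (\<Sum>e\<in>G. ball_inner m e * e w)"
      by eventually_elim (auto simp: r_def s_def)
    then show ?thesis using G F by (intro exI[of _ G]) auto
  next
    case False
    have "0 \<le> ball_inner r r" unfolding ball_inner_def by (intro integral_nonneg_AE) auto
    with False have rr: "0 < ball_inner r r" by simp
    define a where "a = sqrt (ball_inner r r)"
    have a: "0 < a" "a * a = ball_inner r r" using rr by (auto simp: a_def)
    define n where "n = (\<lambda>w. (1 / a) * r w)"
    have n: "n \<in> polys d" unfolding n_def by (rule polys_cmult[OF r])
    have n_inner: "ball_inner n u = ball_inner r u / a" if "u \<in> polys d" for u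
      unfolding n_def using ball_inner_simps(2)[OF r r that, of "1/a"] by simp
    have n_e: "ball_inner n e = 0" "ball_inner e n = 0" if "e \<in> G" for e
      using n_inner[of e] orth[OF that] that G(2) ball_inner_simps(3)[of e d n] n by auto
    have n_n: "ball_inner n n = 1"
      using n_inner[OF n] ball_inner_simps(3)[OF r n r] n_inner[OF r] a rr by (simp add: field_simps)
    have nG: "n \<notin> G" using n_e(1)[of n] n_n by auto
    have "AE w in lborel. w \<in> cball 0 (1/2) \<longrightarrow> p w = (\<Sum>e\<in>insert n G. ball_inner p e * e w)" if "p \<in> F" for p
    proof -
      have pp: "p \<in> polys d" using insert that by auto
      have "ball_inner p n = ball_inner (\<lambda>w. \<Sum>e\<in>G. ball_inner p e * e w) n"
        using F that G pp by (intro ball_inner_cong_AE continuous_polys[of _ d] n polys_sum polys_cmult) auto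
      also have "\<dots> = (\<Sum>e\<in>G. ball_inner p e * ball_inner e n)"
        by (rule ball_inner_sum[OF G(1), of d]) (use G n in auto)
      also have "\<dots> = 0" using n_e by simp
      finally show ?thesis using F that nG G(1) by simp
    qed
    moreover have "m w = (\<Sum>e\<in>insert n G. ball_inner m e * e w)" for w
    proof -
      have "ball_inner s n = (\<Sum>e\<in>G. ball_inner m e * ball_inner e n)"
        unfolding s_def by (rule ball_inner_sum[OF G(1), of d]) (use G n in auto)
      then have "ball_inner s n = 0" using n_e by simp
      then have "ball_inner m n = ball_inner r n" using r_inner[OF n] by simp
      then have "a * ball_inner m n = a * a"
        using ball_inner_simps(3)[OF r n r] n_inner[OF r] a by (simp add: field_simps)
      then have "ball_inner m n = a" using a(1) by simp
      then have "ball_inner m n * n w = r w" using a by (simp add: n_def)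
      then show ?thesis using nG G(1) by (simp add: r_def s_def)
    qed
    moreover have "\<forall>e\<in>insert n G. \<forall>e'\<in>insert n G. ball_inner e e' = (if e = e' then 1 else 0)"
      using G(3) n_e n_n nG by auto
    ultimately show ?thesis using G n by (intro exI[of _ "insert n G"]) auto
  qed
qed

text \<open>By linearity the expansion formula extends from the monomials to all polynomials. It makes the
  orthogonal projection of a function onto the polynomials reproduce its moments up to degree \<open>d\<close>.\<close>

lemma moment_basis:
  "\<exists>G :: (real^'n \<Rightarrow> real) set. finite G \<and> G \<subseteq> polys d \<and>
     (\<forall>p\<in>polys d. AE w in lborel. w \<in> cball 0 (1/2) \<longrightarrow> p w = (\<Sum>e\<in>G. ball_inner p e * e w))"
proof -
  let ?F = "monomial ` {\<alpha> :: 'n \<Rightarrow> nat. mi_abs \<alpha> \<le> d}"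
  have "finite ?F" "?F \<subseteq> polys d" using finite_mi polys_monomial by auto
  from orthonormal_basis[OF this] obtain G where G: "finite G" "G \<subseteq> polys d"
    and F: "\<forall>p\<in>?F. AE w in lborel. w \<in> cball 0 (1/2) \<longrightarrow> p w = (\<Sum>e\<in>G. ball_inner p e * e w)" by blast
  have "p \<in> polys d \<and> (AE w in lborel. w \<in> cball 0 (1/2) \<longrightarrow> p w = (\<Sum>e\<in>G. ball_inner p e * e w))"
    if "p \<in> polys d" for p
    using that
  proof (induction rule: polys_induct)
    case zero show ?case by (simp add: polys_zero ball_inner_def)
  next
    case (add p r)
    then have eq: "ball_inner (\<lambda>w. p w + r w) e = ball_inner p e + ball_inner r e" if "e \<in> G" for e
      using ball_inner_simps(1)[of p d r e] that G by auto
    from add have "AE w in lborel. w \<in> cball 0 (1/2) \<longrightarrow> p w = (\<Sum>e\<in>G. ball_inner p e * e w)"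
      "AE w in lborel. w \<in> cball 0 (1/2) \<longrightarrow> r w = (\<Sum>e\<in>G. ball_inner r e * e w)" by auto
    then have "AE w in lborel. w \<in> cball 0 (1/2) \<longrightarrow> p w + r w = (\<Sum>e\<in>G. ball_inner (\<lambda>w. p w + r w) e * e w)"
      by eventually_elim (simp add: eq distrib_right sum.distrib)
    then show ?case using add by (auto intro: polys_add)
  next
    case (cmult c p)
    then have eq: "ball_inner (\<lambda>w. c * p w) e = c * ball_inner p e" if "e \<in> G" for e
      using ball_inner_simps(2)[of p d p e c] that G by auto
    from cmult have "AE w in lborel. w \<in> cball 0 (1/2) \<longrightarrow> p w = (\<Sum>e\<in>G. ball_inner p e * e w)" by auto
    then have "AE w in lborel. w \<in> cball 0 (1/2) \<longrightarrow> c * p w = (\<Sum>e\<in>G. ball_inner (\<lambda>w. c * p w) e * e w)"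
      by eventually_elim (simp add: eq sum_distrib_left mult.assoc)
    then show ?case using cmult by (auto intro: polys_cmult)
  next
    case (monomial \<alpha>) then show ?case using F polys_monomial by auto
  qed
  then show ?thesis using G by blast
qed

section \<open>Compactly supported smooth functions are Schwartz functions\<close>

lemma partial_deriv_of_real:
  fixes \<phi> :: "real^'n \<Rightarrow> real"
  assumes "(\<phi> has_derivative (\<lambda>h. \<Sum>i\<in>UNIV. D i * h $ i)) (at x)"
  shows "partial_deriv i (\<lambda>x. complex_of_real (\<phi> x)) x = complex_of_real (D i)"
proof -
  have lin: "((\<lambda>h::real. x + h *\<^sub>R axis i 1) has_derivative (\<lambda>h. h *\<^sub>R axis i 1)) (at 0)"
    by (auto intro!: derivative_eq_intros)
  have "((\<lambda>h. \<phi> (x + h *\<^sub>R axis i 1)) has_derivative (\<lambda>h. \<Sum>j\<in>UNIV. D j * (h *\<^sub>R axis i 1 :: real^'n) $ j)) (at 0)"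
    using has_derivative_compose[OF lin, of \<phi> "\<lambda>h. \<Sum>j\<in>UNIV. D j * h $ j"] assms by simp
  moreover have "(\<Sum>j\<in>UNIV. D j * (h *\<^sub>R axis i 1 :: real^'n) $ j) = h * D i" for h
    by (simp add: axis_def if_distrib cong: if_cong)
  ultimately have "((\<lambda>h. \<phi> (x + h *\<^sub>R axis i 1)) has_derivative (\<lambda>h. h * D i)) (at 0)" by simp
  from has_derivative_of_real[OF this, where ?'a=complex]
  have "((\<lambda>h. complex_of_real (\<phi> (x + h *\<^sub>R axis i 1))) has_vector_derivative complex_of_real (D i)) (at 0)"
    by (simp add: has_vector_derivative_def scaleR_conv_of_real)
  then show ?thesis unfolding partial_deriv_def by (rule vector_derivative_at)
qed

lemma iterated_partial_deriv:
  fixes \<phi> :: "real^'n \<Rightarrow> real"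
  assumes "bounded_derivs (length is + k) K UNIV \<phi>"
  shows "\<exists>D. foldr partial_deriv is (\<lambda>x. complex_of_real (\<phi> x)) = (\<lambda>x. complex_of_real (D x)) \<and> bounded_derivs k K UNIV D"
  using assms
proof (induction "is" arbitrary: \<phi> rule: rev_induct)
  case Nil then show ?case by auto
next
  case (snoc i "is")
  then obtain D where D: "\<forall>x. (\<phi> has_derivative (\<lambda>h. \<Sum>i\<in>UNIV. D i x * h $ i)) (at x)"
    "\<forall>i. bounded_derivs (length is + k) K UNIV (D i)" by auto
  have "partial_deriv i (\<lambda>x. complex_of_real (\<phi> x)) = (\<lambda>x. complex_of_real (D i x))"
    using partial_deriv_of_real[of \<phi> "\<lambda>i. D i _"] D(1) by blast
  then show ?case using snoc.IH[of "D i"] D(2) by simp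
qed

lemma iterated_partial_deriv_eq_0:
  fixes f :: "real^'n \<Rightarrow> complex"
  assumes "open U" "\<And>x. x \<in> U \<Longrightarrow> f x = 0" "x \<in> U"
  shows "foldr partial_deriv is f x = 0"
  using assms(3)
proof (induction "is" arbitrary: x)
  case Nil then show ?case using assms(2) by simp
next
  case (Cons i "is")
  let ?g = "foldr partial_deriv is f"
  have "continuous_on UNIV (\<lambda>h::real. x + h *\<^sub>R axis i 1)" by (intro continuous_intros)
  then have op: "open ((\<lambda>h::real. x + h *\<^sub>R axis i 1) -` U)" using assms(1) by (simp add: open_vimage)
  have "((\<lambda>h::real. 0 :: complex) has_vector_derivative 0) (at 0)" by simp
  then have "((\<lambda>h. ?g (x + h *\<^sub>R axis i 1)) has_vector_derivative 0) (at 0)"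
    by (rule has_vector_derivative_transform_within_open[OF _ op]) (use Cons in auto)
  then have "partial_deriv i ?g x = 0" unfolding partial_deriv_def[of i ?g] by (rule vector_derivative_at)
  then show ?case by simp
qed

text \<open>All words with the counts prescribed by a multi-index have the same length, and the length is
  what enters the bounds on derivatives.\<close>

lemma length_mi_word:
  "length (SOME is. \<forall>i. count_list is i = \<alpha> i) = mi_abs (\<alpha> :: 'n::finite \<Rightarrow> nat)"
proof -
  obtain xs where xs: "mset xs = Abs_multiset \<alpha>" using ex_mset by blast
  have "count (mset xs) i = \<alpha> i" for i unfolding xs by (subst count_Abs_multiset) auto
  then have "\<exists>is. \<forall>i. count_list is i = \<alpha> i" by (intro exI[of _ xs]) (simp add: count_mset)
  then have *: "\<forall>i. count_list (SOME is. \<forall>i. count_list is i = \<alpha> i) i = \<alpha> i" by (rule someI_ex)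
  show ?thesis
    using sum_count_set[of "SOME is. \<forall>i. count_list is i = \<alpha> i" UNIV] * by (simp add: mi_abs_def)
qed

lemma schwartz_of_compact_support:
  fixes \<phi> :: "real^'n \<Rightarrow> real"
  assumes smooth: "\<And>m. \<exists>K. bounded_derivs m K UNIV \<phi>" and supp: "\<And>w. R < norm w \<Longrightarrow> \<phi> w = 0" and R: "0 \<le> R"
    and bd: "bounded_derivs N K UNIV \<phi>"
  shows "(\<lambda>x. complex_of_real (\<phi> x)) \<in> schwartz"
    and "schwartz_norm N Nt (\<lambda>x. complex_of_real (\<phi> x)) \<le> (1 + R) ^ Nt * K"
proof -
  let ?f = "\<lambda>x. complex_of_real (\<phi> x)"
  have K: "0 \<le> K" using bounded_derivs_bound[OF bd, of 0] by simp
  have bound: "(1 + norm y) ^ m * cmod (mi_deriv \<alpha> ?f y) \<le> (1 + R) ^ m * L"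
    if L: "bounded_derivs (mi_abs \<alpha>) L UNIV \<phi>" for \<alpha> y m L
  proof -
    have L0: "0 \<le> L" using bounded_derivs_bound[OF L, of 0] by simp
    show ?thesis
    proof (cases "norm y \<le> R")
      case True
      obtain D where D: "mi_deriv \<alpha> ?f = (\<lambda>x. complex_of_real (D x))" "bounded_derivs 0 L UNIV D"
        using iterated_partial_deriv[of "SOME is. \<forall>i. count_list is i = \<alpha> i" 0 L \<phi>] L
        unfolding mi_deriv_def length_mi_word by auto
      then have "cmod (mi_deriv \<alpha> ?f y) \<le> L" by simp
      then show ?thesis using True L0 R by (intro mult_mono power_mono) auto
    next
      case False
      have "open (- cball (0::real^'n) R)" by (simp add: open_Compl)
      from iterated_partial_deriv_eq_0[OF this, of ?f y] have "mi_deriv \<alpha> ?f y = 0"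
        unfolding mi_deriv_def using supp False by auto
      then show ?thesis using R L0 by simp
    qed
  qed
  have "smooth ?f" unfolding smooth_def
  proof (intro allI)
    fix "is" :: "'n list" and x :: "real^'n"
    obtain L where "bounded_derivs (length is + 1) L UNIV \<phi>" using smooth by blast
    from iterated_partial_deriv[OF this] obtain D where
      D: "foldr partial_deriv is ?f = (\<lambda>x. complex_of_real (D x))" "bounded_derivs 1 L UNIV D" by blast
    from D(2) obtain D' where "(D has_derivative D') (at x)" by auto
    from has_derivative_of_real[OF this, where ?'a=complex] show "foldr partial_deriv is ?f differentiable (at x)"
      unfolding D differentiable_def by blast
  qed
  moreover have "bdd_above (range (\<lambda>y. (1 + norm y) ^ m * cmod (mi_deriv \<alpha> ?f y)))" for \<alpha> m
  proof -
    obtain L where "bounded_derivs (mi_abs \<alpha>) L UNIV \<phi>" using smooth by blast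
    from bound[OF this] show ?thesis by (auto intro!: bdd_aboveI2)
  qed
  ultimately show "?f \<in> schwartz" by (simp add: schwartz_def)
  have "bounded_derivs (mi_abs \<alpha>) K UNIV \<phi>" if "mi_abs \<alpha> \<le> N" for \<alpha> :: "'n \<Rightarrow> nat"
    using that bd
  proof (induction rule: inc_induct)
    case base then show ?case by simp
  next
    case (step n) then show ?case using bounded_derivs_lower by blast
  qed
  then have "(SUP y. (1 + norm y) ^ Nt * cmod (mi_deriv \<alpha> ?f y)) \<le> (1 + R) ^ Nt * K" if "mi_abs \<alpha> \<le> N" for \<alpha> :: "'n \<Rightarrow> nat"
    using bound that by (intro cSUP_least) auto
  moreover have "(\<lambda>_. 0) \<in> {\<alpha> :: 'n \<Rightarrow> nat. mi_abs \<alpha> \<le> N}" by (simp add: mi_abs_def)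
  ultimately show "schwartz_norm N Nt ?f \<le> (1 + R) ^ Nt * K"
    unfolding schwartz_norm_def using finite_mi by (intro Max.boundedI) auto
qed

lemma borel_measurable_lebesgue:
  "f \<in> borel_measurable borel \<Longrightarrow> f \<in> borel_measurable lebesgue"
  by (rule measurable_completion) (simp add: measurable_lborel1)

lemma matrix_vector_mult_uminus: "(- A) *v w = - (A *v (w :: real^'n))"
  by (simp add: matrix_vector_mult_def vec_eq_iff sum_negf)

section \<open>A lower semicontinuous maximal function\<close>

definition test_functions :: "nat \<Rightarrow> (real^'n \<Rightarrow> real) set" where
  "test_functions N = {\<phi>. (\<forall>m. \<exists>K. bounded_derivs m K UNIV \<phi>) \<and> bounded_derivs N 1 UNIV \<phi> \<and>
     (\<forall>w. 1 \<le> norm w \<longrightarrow> \<phi> w = 0)}"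

context ellipsoid_cover begin

text \<open>The supremum runs over all ellipsoids that contain \<open>x\<close>, whatever their centre, which makes the
  superlevel sets unions of ellipsoids and hence open. The factor \<open>2 powr t\<close> is comparable to
  the reciprocal of the volume of the ellipsoid.\<close>

definition maximal :: "nat \<Rightarrow> (real^'n \<Rightarrow> real) \<Rightarrow> real^'n \<Rightarrow> ennreal" where
  "maximal N f x = (SUP (y, t, \<phi>) \<in> {(y, t, \<phi>). x \<in> E y t \<and> \<phi> \<in> test_functions N}.
      ennreal (2 powr t * \<bar>LINT z|lebesgue. f z * \<phi> (chart y t z)\<bar>))"

lemma open_maximal_superlevel: "open {x. c < maximal N f x}"
proof -
  have "{x. c < maximal N f x} = (\<Union>(y, t, \<phi>) \<in> {(y, t, \<phi>). \<phi> \<in> test_functions N \<and>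
      c < ennreal (2 powr t * \<bar>LINT z|lebesgue. f z * \<phi> (chart y t z)\<bar>)}. E y t)"
    unfolding maximal_def less_SUP_iff by auto
  then show ?thesis using open_E by auto
qed

lemma maximal_test_bound:
  assumes "x \<in> E y t" "maximal N f x \<le> ennreal c" "0 \<le> c"
    and smooth: "\<And>m. \<exists>K. bounded_derivs m K UNIV \<phi>" and bd: "bounded_derivs N K UNIV \<phi>" "0 < K"
    and supp: "\<And>w. 1 \<le> norm w \<Longrightarrow> \<phi> w = 0"
  shows "\<bar>LINT z|lebesgue. f z * \<phi> (chart y t z)\<bar> \<le> K * c * 2 powr (- t)"
proof -
  define \<psi> where "\<psi> = (\<lambda>w. (1 / K) * \<phi> w)"
  have "bounded_derivs N (\<bar>1 / K\<bar> * K) UNIV \<psi>" unfolding \<psi>_def by (rule bounded_derivs_cmult[OF bd(1)])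
  moreover have "\<exists>L. bounded_derivs m L UNIV \<psi>" for m
    using smooth[of m] bounded_derivs_cmult unfolding \<psi>_def by blast
  ultimately have "\<psi> \<in> test_functions N" using supp bd(2) by (simp add: test_functions_def \<psi>_def)
  then have "ennreal (2 powr t * \<bar>LINT z|lebesgue. f z * \<psi> (chart y t z)\<bar>) \<le> maximal N f x"
    unfolding maximal_def using assms(1) by (intro SUP_upper2[of "(y, t, \<psi>)"]) auto
  then have "2 powr t * \<bar>LINT z|lebesgue. f z * \<psi> (chart y t z)\<bar> \<le> c"
    using assms(2,3) by (meson ennreal_le_iff order_trans)
  moreover have "(LINT z|lebesgue. f z * \<psi> (chart y t z)) = (1 / K) * (LINT z|lebesgue. f z * \<phi> (chart y t z))"
    unfolding \<psi>_def by (subst integral_mult_right_zero[symmetric]) (simp add: mult_ac)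
  ultimately have "2 powr t * \<bar>LINT z|lebesgue. f z * \<phi> (chart y t z)\<bar> \<le> K * c"
    using bd(2) by (simp add: abs_mult field_simps)
  then show ?thesis by (simp add: powr_minus field_simps)
qed

lemma measure_E_eq: "measure lebesgue (E x t) = \<bar>det (M x t)\<bar> * measure lebesgue (ball (0::real^'n) 1)"
proof -
  have "E x t = (+) x ` ((*v) (M x t) ` ball 0 1)" unfolding ellipsoid_def image_image by (simp add: add.commute)
  then have "measure lebesgue (E x t) = measure lebesgue ((*v) (M x t) ` ball 0 1)" by (simp only: measure_translation)
  also have "\<dots> = \<bar>det (M x t)\<bar> * measure lebesgue (ball (0::real^'n) 1)"
    by (subst measure_linear_image_finite(2)) (simp_all add: matrix_vector_mul_linear)
  finally show ?thesis .
qed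

lemma unit_ball_measure_pos: "0 < measure lebesgue (ball (0::real^'n) 1)"
  by (simp add: content_ball_pos)

lemma det_inv: "\<bar>det (matrix_inv (M x t))\<bar> = 1 / \<bar>det (M x t)\<bar>" "det (M x t) \<noteq> 0"
proof -
  have "det (M x t) * det (matrix_inv (M x t)) = 1" using matrix_inv_MM(1)[of x t] by (metis det_I det_mul)
  then have "\<bar>det (M x t)\<bar> * \<bar>det (matrix_inv (M x t))\<bar> = 1" by (metis abs_mult abs_one)
  moreover from this show "det (M x t) \<noteq> 0" by auto
  ultimately show "\<bar>det (matrix_inv (M x t))\<bar> = 1 / \<bar>det (M x t)\<bar>" by (simp add: field_simps)
qed

lemma det_M_bounds:
  "\<bar>det (M x t)\<bar> * measure lebesgue (ball (0::real^'n) 1) \<le> a2 * 2 powr (- t)"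
  "a1 * 2 powr (- t) \<le> \<bar>det (M x t)\<bar> * measure lebesgue (ball (0::real^'n) 1)"
  using measure_E[where x=x and t=t] unfolding measure_E_eq by auto

lemma integrable_test:
  fixes f :: "real^'n \<Rightarrow> 'b::{real_normed_vector, banach, second_countable_topology}" and \<phi> :: "real^'n \<Rightarrow> real"
  assumes loc: "\<And>r. integrable lebesgue (\<lambda>z. indicator (cball 0 r) z *\<^sub>R f z)"
    and "continuous_on UNIV \<phi>" "\<And>z. \<bar>\<phi> z\<bar> \<le> K" "bounded {z. \<phi> z \<noteq> 0}"
  shows "integrable lebesgue (\<lambda>z. \<phi> z *\<^sub>R f z)"
proof -
  obtain r where r: "{z. \<phi> z \<noteq> 0} \<subseteq> cball 0 r" using bounded_subset_ballD[OF assms(4), of 0] ball_subset_cball by blast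
  have "\<phi> \<in> borel_measurable borel" using assms(2) by (rule borel_measurable_continuous_onI)
  then have [measurable]: "\<phi> \<in> borel_measurable lebesgue" by (rule borel_measurable_lebesgue)
  have [measurable]: "(\<lambda>z. indicator (cball 0 r) z *\<^sub>R f z) \<in> borel_measurable lebesgue" using loc by auto
  have "integrable lebesgue (\<lambda>z. \<phi> z *\<^sub>R (indicator (cball 0 r) z *\<^sub>R f z))"
  proof (rule Bochner_Integration.integrable_bound[OF integrable_scaleR_right[OF loc, of K r]])
    show "(\<lambda>z. \<phi> z *\<^sub>R (indicator (cball 0 r) z *\<^sub>R f z)) \<in> borel_measurable lebesgue" by measurable
    show "AE z in lebesgue. norm (\<phi> z *\<^sub>R (indicator (cball 0 r) z *\<^sub>R f z)) \<le> norm (K *\<^sub>R (indicator (cball 0 r) z *\<^sub>R f z))"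
      using order.trans[OF assms(3) abs_ge_self] by (auto intro!: AE_I2 simp: indicator_def mult_right_mono)
  qed
  moreover have "\<phi> z *\<^sub>R (indicator (cball 0 r) z *\<^sub>R f z) = \<phi> z *\<^sub>R f z" for z
    using r by (cases "\<phi> z = 0") (auto simp: indicator_def)
  ultimately show ?thesis by (simp only:)
qed

text \<open>If \<open>x\<close> lies in the ellipsoid of centre \<open>y\<close> and scale \<open>t\<close>, then this ellipsoid is comparable to
  the one of the same scale centred at \<open>x\<close>. A bump for the first is, written in coordinates of
  the second, a compactly supported function with derivatives bounded uniformly, hence a fixed
  multiple of an element of the Schwartz unit ball. Real and imaginary parts of the integral
  are bounded by its modulus.\<close>

lemma maximal_le_radial:
  "\<exists>C>0. \<forall>f :: real^'n \<Rightarrow> complex. (\<forall>r. integrable lebesgue (\<lambda>z. indicator (cball 0 r) z *\<^sub>R f z)) \<longrightarrow>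
     (\<forall>x. maximal (Np CARD('n) a4 a6 p) (\<lambda>z. Re (f z)) x \<le> ennreal C * radial_grand_maximal M a4 a6 p (distribution_of f) x \<and>
          maximal (Np CARD('n) a4 a6 p) (\<lambda>z. Im (f z)) x \<le> ennreal C * radial_grand_maximal M a4 a6 p (distribution_of f) x)"
proof -
  define N where "N = Np CARD('n) a4 a6 p"
  define Nt where "Nt = Np_tilde CARD('n) a4 a6 p"
  define R where "R = 2 * a5"
  define m where "m = max 1 (real CARD('n) * (1 / a3))"
  define C1 where "C1 = (1 + R) ^ Nt * (m ^ N * 1)"
  define \<omega> where "\<omega> = measure lebesgue (ball (0::real^'n) 1)"
  define C where "C = C1 * a2 / \<omega>"
  have R: "0 < R" using pos by (simp add: R_def)
  have m: "1 \<le> m" by (simp add: m_def)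
  have C1: "0 < C1" using R m by (simp add: C1_def)
  have \<omega>: "0 < \<omega>" using unit_ball_measure_pos by (simp add: \<omega>_def)
  have C: "0 < C" using C1 \<omega> pos by (simp add: C_def)
  have key: "ennreal (2 powr t * cmod (LINT z|lebesgue. \<phi> (chart y t z) *\<^sub>R f z))
      \<le> ennreal C * radial_grand_maximal M a4 a6 p (distribution_of f) x"
    if xy: "x \<in> E y t" and \<phi>: "\<phi> \<in> test_functions N" for f :: "real^'n \<Rightarrow> complex" and x y t \<phi>
  proof -
    have ne: "E y t \<inter> E x t \<noteq> {}" "E x t \<inter> E y t \<noteq> {}" using xy center_mem[of x t] by blast+
    define A where "A = matrix_inv (M y t) ** M x t"
    define b where "b = chart y t x"
    \<comment> \<open>The convolution reflects its argument, whence the sign of the matrix.\<close>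
    define \<phi>' where "\<phi>' = (\<lambda>w. \<phi> ((- A) *v w + b))"
    define \<psi> where "\<psi> = (\<lambda>w. (1 / C1) * \<phi>' w)"
    have Aw: "A *v w = matrix_inv (M y t) *v (M x t *v w)" for w by (simp add: A_def matrix_vector_mul_assoc)
    have Anorm: "norm ((- A) *v w) \<le> (1 / a3) * norm w" for w
      using expand[OF ne(2), of "M x t *v w"] by (simp add: Aw inv_M matrix_vector_mult_uminus)
    have Alow: "norm w \<le> a5 * norm (A *v w)" for w
      using shrink[OF ne(2), of "M x t *v w"] by (simp add: Aw inv_M)
    have b: "norm b < 1" using xy by (simp add: b_def mem_E)
    have bd': "bounded_derivs k (m ^ k * K) UNIV \<phi>'" if "bounded_derivs k K UNIV \<phi>" for k K
      unfolding \<phi>'_def m_def using that by (rule bounded_derivs_affine[OF _ Anorm]) (use pos in auto)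
    have \<psi>1: "bounded_derivs N (\<bar>1 / C1\<bar> * (m ^ N * 1)) UNIV \<psi>"
      unfolding \<psi>_def using \<phi> by (intro bounded_derivs_cmult bd') (auto simp: test_functions_def)
    have \<psi>2: "\<exists>K. bounded_derivs k K UNIV \<psi>" for k
    proof -
      obtain K where "bounded_derivs k K UNIV \<phi>" using \<phi> by (auto simp: test_functions_def)
      from bounded_derivs_cmult[OF bd'[OF this], of "1 / C1"] show ?thesis unfolding \<psi>_def by blast
    qed
    \<comment> \<open>The coordinates of the two ellipsoids distort lengths by at most the factor \<open>a5\<close>, which
      bounds the support by \<open>R = 2 * a5\<close>.\<close>
    have \<psi>3: "\<psi> w = 0" if "R < norm w" for w
    proof -
      have "R < a5 * norm (A *v w)" using that Alow[of w] by simp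
      then have "2 < norm (A *v w)" using pos by (simp add: R_def)
      then have "1 \<le> norm ((- A) *v w + b)"
        using b norm_triangle_ineq2[of "A *v w" b] by (simp add: matrix_vector_mult_uminus norm_minus_commute)
      then show ?thesis using \<phi> by (simp add: \<psi>_def \<phi>'_def test_functions_def)
    qed
    have "schwartz_norm N Nt (\<lambda>x. complex_of_real (\<psi> x)) \<le> (1 + R) ^ Nt * (\<bar>1 / C1\<bar> * (m ^ N * 1))"
      using R by (intro schwartz_of_compact_support(2)[OF \<psi>2 \<psi>3 _ \<psi>1]) auto
    also have "\<dots> = C1 / C1" using C1 unfolding C1_def by (simp add: abs_of_pos)
    also have "\<dots> = 1" using C1 by simp
    finally have unit: "(\<lambda>x. complex_of_real (\<psi> x)) \<in> schwartz_unit N Nt"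
      using schwartz_of_compact_support(1)[OF \<psi>2 \<psi>3 _ \<psi>1] R by (simp add: schwartz_unit_def)
    have "\<psi> (matrix_inv (M x t) *v (x - z)) = \<phi> (chart y t z) / C1" for z
    proof -
      have "(- A) *v (matrix_inv (M x t) *v (x - z)) + b = chart y t z"
        by (simp add: matrix_vector_mult_uminus Aw M_inv b_def chart_def flip: matrix_vector_mult_diff_distrib)
      then show ?thesis by (simp add: \<psi>_def \<phi>'_def)
    qed
    then have "dist_conv (distribution_of f) (dilate M (\<lambda>x. complex_of_real (\<psi> x)) x t) x
        = (LINT z|lebesgue. (\<bar>det (matrix_inv (M x t))\<bar> / C1) *\<^sub>R (\<phi> (chart y t z) *\<^sub>R f z))"
      unfolding dist_conv_def distribution_of_def dilate_def
      by (intro Bochner_Integration.integral_cong) (simp_all add: scaleR_conv_of_real)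
    also have "\<dots> = (\<bar>det (matrix_inv (M x t))\<bar> / C1) *\<^sub>R (LINT z|lebesgue. \<phi> (chart y t z) *\<^sub>R f z)"
      by (rule integral_scaleR_right)
    finally have conv: "cmod (dist_conv (distribution_of f) (dilate M (\<lambda>x. complex_of_real (\<psi> x)) x t) x)
        = \<bar>det (matrix_inv (M x t))\<bar> / C1 * cmod (LINT z|lebesgue. \<phi> (chart y t z) *\<^sub>R f z)"
      using C1 by simp
    have "2 powr t \<le> C * (\<bar>det (matrix_inv (M x t))\<bar> / C1)"
      using det_M_bounds(1)[of x t] det_inv(2)[of x t] \<omega> C1 pos
      unfolding det_inv(1) C_def by (simp add: \<omega>_def powr_minus field_simps)
    then have "2 powr t * cmod (LINT z|lebesgue. \<phi> (chart y t z) *\<^sub>R f z)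
        \<le> C * cmod (dist_conv (distribution_of f) (dilate M (\<lambda>x. complex_of_real (\<psi> x)) x t) x)"
      unfolding conv mult.assoc[symmetric] by (rule mult_right_mono) simp
    then have "ennreal (2 powr t * cmod (LINT z|lebesgue. \<phi> (chart y t z) *\<^sub>R f z))
        \<le> ennreal C * ennreal (cmod (dist_conv (distribution_of f) (dilate M (\<lambda>x. complex_of_real (\<psi> x)) x t) x))"
      using C by (simp add: ennreal_leI flip: ennreal_mult)
    also have "\<dots> \<le> ennreal C * radial_grand_maximal M a4 a6 p (distribution_of f) x"
      unfolding radial_grand_maximal_def N_def[symmetric] Nt_def[symmetric]
      by (intro mult_left_mono SUP_upper2[OF unit] SUP_upper2[of t]) auto
    finally show ?thesis .
  qed
  have "maximal N (\<lambda>z. Re (f z)) x \<le> ennreal C * radial_grand_maximal M a4 a6 p (distribution_of f) x \<and>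
        maximal N (\<lambda>z. Im (f z)) x \<le> ennreal C * radial_grand_maximal M a4 a6 p (distribution_of f) x"
    if loc: "\<And>r. integrable lebesgue (\<lambda>z. indicator (cball 0 r) z *\<^sub>R f z)" for f :: "real^'n \<Rightarrow> complex" and x
  proof -
    have *: "\<bar>LINT z|lebesgue. Re (f z) * \<phi> (chart y t z)\<bar> \<le> cmod (LINT z|lebesgue. \<phi> (chart y t z) *\<^sub>R f z) \<and>
        \<bar>LINT z|lebesgue. Im (f z) * \<phi> (chart y t z)\<bar> \<le> cmod (LINT z|lebesgue. \<phi> (chart y t z) *\<^sub>R f z)"
      if "\<phi> \<in> test_functions N" for y t \<phi>
    proof -
      from that obtain K where K: "bounded_derivs (Suc 0) K UNIV \<phi>" by (auto simp: test_functions_def simp del: bounded_derivs.simps)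
      have "continuous_on UNIV (\<lambda>z. \<phi> (chart y t z))"
        using continuous_on_compose2[OF bounded_derivs_continuous[OF K] continuous_chart] by simp
      moreover have "bounded {z. \<phi> (chart y t z) \<noteq> 0}"
        by (rule bounded_subset[OF bounded_E[of y t]]) (use that in \<open>auto simp: test_functions_def mem_E not_le[symmetric]\<close>)
      ultimately have int: "integrable lebesgue (\<lambda>z. \<phi> (chart y t z) *\<^sub>R f z)"
        using bounded_derivs_bound[OF K] by (intro integrable_test[OF loc]) auto
      have "(LINT z|lebesgue. Re (f z) * \<phi> (chart y t z)) = Re (LINT z|lebesgue. \<phi> (chart y t z) *\<^sub>R f z)"
        "(LINT z|lebesgue. Im (f z) * \<phi> (chart y t z)) = Im (LINT z|lebesgue. \<phi> (chart y t z) *\<^sub>R f z)"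
        using integral_Re[OF int] integral_Im[OF int] by (simp_all add: mult.commute)
      then show ?thesis by (simp add: abs_Re_le_cmod abs_Im_le_cmod)
    qed
    show ?thesis unfolding maximal_def
      by (intro conjI SUP_least; clarify)
        (rule order_trans[OF ennreal_leI[OF mult_left_mono[OF conjunct1[OF *]]] key],
         auto intro: order_trans[OF ennreal_leI[OF mult_left_mono[OF conjunct2[OF *]]] key])+
  qed
  then show ?thesis using C unfolding N_def by blast
qed

end

section \<open>A smooth partition of unity\<close>

definition bump :: "real^'n \<Rightarrow> real" where
  "bump = (SOME \<psi>. (\<forall>N. \<exists>K. bounded_derivs N K UNIV \<psi>) \<and> (\<forall>w. 0 \<le> \<psi> w \<and> \<psi> w \<le> 1) \<and>
     (\<forall>w. norm w \<le> 1/4 \<longrightarrow> \<psi> w = 1) \<and> (\<forall>w. norm w \<ge> 1/2 \<longrightarrow> \<psi> w = 0))"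

lemma bump:
  fixes w :: "real^'n"
  shows "\<exists>K. bounded_derivs N K UNIV (bump :: real^'n \<Rightarrow> real)" "0 \<le> bump w" "bump w \<le> 1"
  "norm w \<le> 1/4 \<Longrightarrow> bump w = 1" "norm w \<ge> 1/2 \<Longrightarrow> bump w = 0"
proof -
  obtain \<psi> :: "real^'n \<Rightarrow> real" where \<psi>: "\<And>N. \<exists>K. bounded_derivs N K UNIV \<psi>" "\<And>w. 0 \<le> \<psi> w" "\<And>w. \<psi> w \<le> 1"
    "\<And>w. norm w \<le> 1/4 \<Longrightarrow> \<psi> w = 1" "\<And>w. norm w \<ge> 1/2 \<Longrightarrow> \<psi> w = 0"
    by (rule smooth_bump_exists) blast
  have "\<exists>\<psi> :: real^'n \<Rightarrow> real. (\<forall>N. \<exists>K. bounded_derivs N K UNIV \<psi>) \<and> (\<forall>w. 0 \<le> \<psi> w \<and> \<psi> w \<le> 1) \<and>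
     (\<forall>w. norm w \<le> 1/4 \<longrightarrow> \<psi> w = 1) \<and> (\<forall>w. norm w \<ge> 1/2 \<longrightarrow> \<psi> w = 0)"
    using \<psi> by blast
  from someI_ex[OF this, folded bump_def]
  show "\<exists>K. bounded_derivs N K UNIV (bump :: real^'n \<Rightarrow> real)" "0 \<le> bump w" "bump w \<le> 1"
    "norm w \<le> 1/4 \<Longrightarrow> bump w = 1" "norm w \<ge> 1/2 \<Longrightarrow> bump w = 0" by blast+
qed

context ellipsoid_cover begin

text \<open>Whichever of the two meeting ellipsoids is the smaller, one of the two cover bounds applies;
  the constant is the sum of both.\<close>

lemma comparable_norm:
  assumes "E y s' \<inter> E x s \<noteq> {}" "s' - s \<le> D"
  shows "norm (matrix_inv (M y s') *v v) \<le> (a5 + 2 powr (a4 * D) / a3) * norm (matrix_inv (M x s) *v v)"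
proof (cases "s' \<le> s")
  case True
  have "2 powr (- a6 * (s - s')) \<le> 2 powr 0" using True pos by (intro powr_mono) auto
  then have "a5 * 2 powr (- a6 * (s - s')) \<le> a5 + 2 powr (a4 * D) / a3"
    using pos by (intro add_increasing2) (auto intro: mult_left_le)
  from mult_right_mono[OF this norm_ge_zero] shrink[OF assms(1) True, of v] show ?thesis
    by (rule order.trans[rotated])
next
  case False
  have ne: "E x s \<inter> E y s' \<noteq> {}" using assms(1) by (simp add: Int_commute)
  have "2 powr (a4 * (s' - s)) / a3 \<le> 2 powr (a4 * D) / a3"
    using pos assms(2) by (intro divide_right_mono powr_mono) auto
  then have "2 powr (a4 * (s' - s)) / a3 \<le> a5 + 2 powr (a4 * D) / a3" using pos by simp
  from mult_right_mono[OF this norm_ge_zero] expand[OF ne, of v] False show ?thesis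
    by (meson order.trans less_imp_le not_le)
qed

lemma chart_affine:
  "chart y s' (M x s *v w + x) = (matrix_inv (M y s') ** M x s) *v w + chart y s' x"
  unfolding chart_def
  by (simp add: matrix_vector_right_distrib matrix_vector_mult_diff_distrib flip: matrix_vector_mul_assoc)

definition distortion :: "real \<Rightarrow> real" where
  "distortion D = max 1 (real CARD('n) * (a5 + 2 powr (a4 * D) / a3))"

text \<open>Passing from the coordinates of one ellipsoid to those of another that it meets and that is
  not much smaller costs a fixed factor in the derivatives.\<close>

lemma bounded_derivs_rechart:
  assumes "bounded_derivs N K UNIV \<phi>" "E y s' \<inter> E x s \<noteq> {}" "s' - s \<le> D"
  shows "bounded_derivs N (distortion D ^ N * K) UNIV (\<lambda>w. \<phi> (chart y s' (M x s *v w + x)))"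
  unfolding chart_affine distortion_def
proof (rule bounded_derivs_affine[OF assms(1)])
  show "norm ((matrix_inv (M y s') ** M x s) *v v) \<le> (a5 + 2 powr (a4 * D) / a3) * norm v" for v
    using comparable_norm[OF assms(2,3), of "M x s *v v"] by (simp add: inv_M flip: matrix_vector_mul_assoc)
qed (use pos in auto)

lemma distortion_ge_1: "1 \<le> distortion D" by (simp add: distortion_def)

text \<open>A test function adapted to an ellipsoid is also adapted to its enlargement by a fixed
  number of scales, so it suffices that the enlargement contains a point where the maximal
  function is small.\<close>

lemma maximal_test_bound_enlarged:
  assumes "x \<in> E y (s - D)" "J0 \<le> D" "maximal N f x \<le> ennreal c" "0 \<le> c"
    and smooth: "\<And>m. \<exists>K. bounded_derivs m K UNIV \<phi>" and bd: "bounded_derivs N K UNIV \<phi>" "0 < K"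
    and supp: "\<And>w. 1 \<le> norm w \<Longrightarrow> \<phi> w = 0"
  shows "\<bar>LINT z|lebesgue. f z * \<phi> (chart y s z)\<bar> \<le> distortion D ^ N * K * c * 2 powr D * 2 powr (- s)"
proof -
  define \<phi>' where "\<phi>' = (\<lambda>w. \<phi> (chart y s (M y (s - D) *v w + y)))"
  have ne: "E y s \<inter> E y (s - D) \<noteq> {}" using center_mem by blast
  have bd': "bounded_derivs m (distortion D ^ m * L) UNIV \<phi>'" if "bounded_derivs m L UNIV \<phi>" for m L
    unfolding \<phi>'_def using that ne by (rule bounded_derivs_rechart) simp
  have supp': "\<phi>' w = 0" if "1 \<le> norm w" for w
  proof -
    have "chart y (s - D) (M y (s - D) *v w + y) = w" by (rule chart_M)
    then have "M y (s - D) *v w + y \<notin> E y (s - D)" using that by (simp add: mem_E)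
    then have "M y (s - D) *v w + y \<notin> E y s" using nested[OF assms(2)] by blast
    then show ?thesis unfolding \<phi>'_def by (intro supp) (simp add: mem_E)
  qed
  have "\<bar>LINT z|lebesgue. f z * \<phi>' (chart y (s - D) z)\<bar> \<le> (distortion D ^ N * K) * c * 2 powr (- (s - D))"
  proof (rule maximal_test_bound[OF assms(1,3,4) _ bd'[OF bd(1)] _ supp'])
    show "\<exists>L. bounded_derivs m L UNIV \<phi>'" for m using smooth[of m] bd' by blast
    show "0 < distortion D ^ N * K" using distortion_ge_1[of D] bd(2) by simp
  qed
  moreover have "\<phi>' (chart y (s - D) z) = \<phi> (chart y s z)" for z by (simp add: \<phi>'_def M_chart)
  moreover have "2 powr (- (s - D)) = 2 powr D * 2 powr (- s)" by (simp add: powr_add[symmetric])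
  ultimately show ?thesis by (simp add: mult.assoc)
qed

definition bump_on :: "nat set \<Rightarrow> (nat \<Rightarrow> real^'n) \<Rightarrow> (nat \<Rightarrow> real) \<Rightarrow> nat \<Rightarrow> real^'n \<Rightarrow> real" where
  "bump_on I x t i z = (if i \<in> I then bump (chart (x i) (t i + J3) z) else 0)"

text \<open>The usual quotient of a bump by the sum of all bumps is replaced by a product: a point is
  attributed to the first bump that claims it. The partial sums telescope to one minus the
  product of all complements.\<close>

definition pou :: "nat set \<Rightarrow> (nat \<Rightarrow> real^'n) \<Rightarrow> (nat \<Rightarrow> real) \<Rightarrow> nat \<Rightarrow> real^'n \<Rightarrow> real" where
  "pou I x t i z = bump_on I x t i z * (\<Prod>j<i. 1 - bump_on I x t j z)"

lemma bump_on_range: "0 \<le> bump_on I x t i z" "bump_on I x t i z \<le> 1"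
  using bump by (auto simp: bump_on_def)

lemma pou_range: "0 \<le> pou I x t i z" "pou I x t i z \<le> 1"
proof -
  have p: "0 \<le> (\<Prod>j<i. 1 - bump_on I x t j z)" "(\<Prod>j<i. 1 - bump_on I x t j z) \<le> 1"
    using bump_on_range by (auto intro!: prod_nonneg prod_le_1)
  then show "0 \<le> pou I x t i z" "pou I x t i z \<le> 1"
    using bump_on_range[of I x t i z] unfolding pou_def by (auto intro: mult_le_one)
qed

lemma pou_support:
  assumes "pou I x t i z \<noteq> 0" shows "i \<in> I" "norm (chart (x i) (t i + J3) z) < 1/2" "z \<in> E (x i) (t i + J3)"
proof -
  have "bump_on I x t i z \<noteq> 0" using assms by (auto simp: pou_def)
  then show "i \<in> I" and *: "norm (chart (x i) (t i + J3) z) < 1/2"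
    using bump(5)[of "chart (x i) (t i + J3) z"] by (auto simp: bump_on_def not_le[symmetric] split: if_splits)
  then show "z \<in> E (x i) (t i + J3)" by (simp add: mem_E)
qed

lemma sum_pou: "(\<Sum>i<m. pou I x t i z) = 1 - (\<Prod>i<m. 1 - bump_on I x t i z)"
  by (induction m) (auto simp: pou_def algebra_simps)

lemma J3_ge: "J0 \<le> J3" "J0 \<le> J1" "0 \<le> J1" "0 \<le> J3" using J0_pos by (auto simp: J1_def J3_def)

lemma support_sub_E: "E x (t + J3) \<subseteq> E x t"
  using nested[OF J3_ge(1), of x "t + J3"] by simp

lemma whitney_simps:
  assumes "whitney \<Omega> I x t" "i \<in> I"
  shows "E (x i) (t i - J0) \<subseteq> \<Omega>" "\<not> E (x i) (t i - J1) \<subseteq> \<Omega>" "E (x i) (t i) \<subseteq> \<Omega>" "E (x i) (t i + J3) \<subseteq> \<Omega>"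
proof -
  show 1: "E (x i) (t i - J0) \<subseteq> \<Omega>" and "\<not> E (x i) (t i - J1) \<subseteq> \<Omega>" using assms by (auto simp: whitney_def)
  show 2: "E (x i) (t i) \<subseteq> \<Omega>" using 1 nested[of J0 "x i" "t i"] by auto
  then show "E (x i) (t i + J3) \<subseteq> \<Omega>" using support_sub_E by blast
qed

lemma pou_sums:
  assumes "whitney \<Omega> I x t"
  shows "(\<lambda>i. pou I x t i z) sums indicator \<Omega> z"
proof (cases "z \<in> \<Omega>")
  case True
  then obtain k where k: "k \<in> I" "norm (chart (x k) (t k + J3) z) \<le> 1/4" using assms by (auto simp: whitney_def)
  then have "bump_on I x t k z = 1" by (simp add: bump_on_def bump)
  then have "(\<Sum>i<m. pou I x t i z) = 1" if "m > k" for m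
    unfolding sum_pou using that by (simp add: prod_zero_iff) (metis lessThan_iff)
  then have "(\<lambda>m. \<Sum>i<m. pou I x t i z) \<longlonglongrightarrow> 1"
    by (intro tendsto_eventually eventually_sequentiallyI[of "Suc k"]) auto
  then show ?thesis using True by (simp add: sums_def)
next
  case False
  then have "pou I x t i z = 0" for i using pou_support[of I x t i z] whitney_simps(4)[OF assms] by blast
  then show ?thesis using False by simp
qed

text \<open>Only boundedly many of the factors differ from one near the support, and they live on
  ellipsoids of comparable size; hence all derivatives are bounded uniformly after rescaling.\<close>

lemma pou_bounded_derivs:
  "\<exists>K>0. \<forall>\<Omega> I x t i. whitney \<Omega> I x t \<longrightarrow> i \<in> I \<longrightarrow>
     bounded_derivs N K UNIV (\<lambda>w. pou I x t i (M (x i) (t i + J3) *v w + x i))"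
proof -
  obtain K0 where K0: "bounded_derivs N K0 UNIV (bump :: real^'n \<Rightarrow> real)" using bump(1) by blast
  have K0_0: "0 \<le> K0" using bounded_derivs_bound[OF K0, of 0] by simp
  define K1 where "K1 = 1 + distortion J1 ^ N * K0"
  have K1: "1 \<le> K1" using K0_0 distortion_ge_1[of J1] by (simp add: K1_def)
  define K2 where "K2 = 2 ^ N * (K0 * (2 ^ N * K1) ^ overlap) + 1"
  have base: "1 \<le> 2 ^ N * K1" using mult_mono[of 1 "2 ^ N" 1 K1] K1 by simp
  have "bounded_derivs N K2 UNIV (\<lambda>w. pou I x t i (M (x i) (t i + J3) *v w + x i))"
    if W: "whitney \<Omega> I x t" and i: "i \<in> I" for \<Omega> I x t i
  proof (rule bounded_derivs_extend_by_zero)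
    let ?L = "\<lambda>w. M (x i) (t i + J3) *v w + x i"
    let ?S = "\<lambda>j. E (x j) (t j + J3)"
    define B where "B = {j\<in>I. j < i \<and> ?S j \<inter> ?S i \<noteq> {}}"
    have B: "j \<in> I" "?S j \<inter> ?S i \<noteq> {}" if "j \<in> B" for j using that by (auto simp: B_def)
    have close: "t j - J1 < t i" "t i - J1 < t j" "?S i \<subseteq> E (x j) (t j)" if j: "j \<in> B" for j
    proof -
      have "?S i \<inter> ?S j \<noteq> {}" using B[OF j] by blast
      then show "t j - J1 < t i" "t i - J1 < t j" "?S i \<subseteq> E (x j) (t j)"
        using support_in_enlarged[OF whitney_simps(2)[OF W B(1)[OF j]] whitney_simps(1)[OF W i] B(2)[OF j]]
          support_in_enlarged[OF whitney_simps(2)[OF W i] whitney_simps(1)[OF W B(1)[OF j]]] by blast+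
    qed
    have "B \<subseteq> {j\<in>I. x i \<in> E (x j) (t j)}" using B close center_mem by blast
    then have cardB: "card B \<le> overlap" and finB: "finite B"
      using W card_mono[of "{j\<in>I. x i \<in> E (x j) (t j)}" B] finite_subset[of B "{j\<in>I. x i \<in> E (x j) (t j)}"]
      unfolding whitney_def by (auto intro: order.trans)
    have fac: "bounded_derivs N K1 (ball 0 1) (\<lambda>w. 1 - bump (chart (x j) (t j + J3) (?L w)))" if j: "j \<in> B" for j
    proof -
      have "bounded_derivs N (distortion J1 ^ N * K0) UNIV (\<lambda>w. bump (chart (x j) (t j + J3) (?L w)))"
        by (rule bounded_derivs_rechart[OF K0 B(2)[OF j]]) (use close[OF j] in auto)
      from bounded_derivs_add[OF bounded_derivs_const[of N 1] bounded_derivs_cmult[OF this, of "-1"]]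
      have "bounded_derivs N K1 UNIV (\<lambda>w. 1 - bump (chart (x j) (t j + J3) (?L w)))" by (simp add: K1_def)
      then show ?thesis by (rule bounded_derivs_mono) auto
    qed
    have "bounded_derivs N (2 ^ N * (K0 * (2 ^ N * K1) ^ card B)) (ball 0 1)
        (\<lambda>w. bump w * (\<Prod>j\<in>B. 1 - bump (chart (x j) (t j + J3) (?L w))))"
      by (intro bounded_derivs_mult bounded_derivs_prod finB fac bounded_derivs_mono[OF K0])
         (use K1 K0_0 in auto)
    moreover have "2 ^ N * (K0 * (2 ^ N * K1) ^ card B) \<le> K2"
      using power_increasing[OF cardB base] K0_0 unfolding K2_def by (simp add: mult_left_mono add_increasing2)
    ultimately have "bounded_derivs N K2 (ball 0 1) (\<lambda>w. bump w * (\<Prod>j\<in>B. 1 - bump (chart (x j) (t j + J3) (?L w))))"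
      by (rule bounded_derivs_mono) simp
    then show "bounded_derivs N K2 (ball 0 1) (\<lambda>w. pou I x t i (?L w))"
    proof (rule bounded_derivs_cong[OF open_ball, rotated])
      fix w :: "real^'n" assume "w \<in> ball 0 1"
      then have "?L w \<in> ?S i" by (simp add: mem_E chart_M)
      have one: "bump_on I x t j (?L w) = 0" if "j < i" "j \<notin> B" for j
      proof (cases "j \<in> I")
        case True
        then have "?L w \<notin> ?S j" using that \<open>?L w \<in> ?S i\<close> by (auto simp: B_def)
        then show ?thesis by (simp add: bump_on_def bump mem_E)
      qed (simp add: bump_on_def)
      have "(\<Prod>j<i. 1 - bump_on I x t j (?L w)) = (\<Prod>j\<in>B. 1 - bump_on I x t j (?L w))"
        by (rule prod.mono_neutral_right) (use one in \<open>auto simp: B_def\<close>)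
      also have "\<dots> = (\<Prod>j\<in>B. 1 - bump (chart (x j) (t j + J3) (?L w)))"
        by (rule prod.cong) (auto simp: bump_on_def B_def)
      finally show "bump w * (\<Prod>j\<in>B. 1 - bump (chart (x j) (t j + J3) (?L w))) = pou I x t i (?L w)"
        using i by (simp add: pou_def bump_on_def chart_M)
    qed
    show "pou I x t i (?L w) = 0" if "1/2 \<le> norm w" for w
      using pou_support(2)[of I x t i "?L w"] that by (auto simp: chart_M)
    show "0 \<le> K2" using K0_0 K1 by (simp add: K2_def)
  qed
  moreover have "0 < K2" using K0_0 K1 by (simp add: K2_def add_nonneg_pos)
  ultimately show ?thesis by blast
qed

lemma continuous_bump_on: "continuous_on UNIV (bump_on I x t i)"
proof -
  obtain K where "bounded_derivs (Suc 0) K UNIV (bump :: real^'n \<Rightarrow> real)" using bump(1) by blast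
  then have "continuous_on UNIV (bump :: real^'n \<Rightarrow> real)" by (rule bounded_derivs_continuous)
  then show ?thesis
    using continuous_on_compose2[OF _ continuous_chart[of UNIV "x i" "t i + J3"], of UNIV bump]
    unfolding bump_on_def[abs_def] by (cases "i \<in> I") auto
qed

lemma continuous_pou: "continuous_on UNIV (pou I x t i)"
  unfolding pou_def[abs_def] by (intro continuous_intros continuous_bump_on)

lemma measurable_pou [measurable]: "pou I x t i \<in> borel_measurable borel" "pou I x t i \<in> borel_measurable lebesgue"
  using continuous_pou borel_measurable_continuous_onI borel_measurable_lebesgue by blast+

text \<open>Bounded overlap makes all sums over the Whitney index set locally finite, uniformly.\<close>

lemma overlap_sum:
  fixes u :: "nat \<Rightarrow> real" and c :: real
  assumes "whitney \<Omega> I x t" "\<And>i. u i \<noteq> (0::real) \<Longrightarrow> i \<in> I \<and> z \<in> E (x i) (t i)" "\<And>i. \<bar>u i\<bar> \<le> c"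
  shows "finite {i. u i \<noteq> 0}" "\<bar>\<Sum>i\<in>F. u i\<bar> \<le> overlap * c" "\<bar>suminf u\<bar> \<le> overlap * c" "summable u"
    "(\<Sum>i\<in>F. \<bar>u i\<bar>) \<le> overlap * c" "z \<notin> \<Omega> \<Longrightarrow> u i = 0"
proof -
  have sub: "{i. u i \<noteq> 0} \<subseteq> {i\<in>I. z \<in> E (x i) (t i)}" using assms(2) by auto
  have fin': "finite {i\<in>I. z \<in> E (x i) (t i)}" and cd: "card {i\<in>I. z \<in> E (x i) (t i)} \<le> overlap"
    using assms(1) by (auto simp: whitney_def)
  show fin: "finite {i. u i \<noteq> 0}" using finite_subset[OF sub fin'] .
  have card: "card {i. u i \<noteq> 0} \<le> overlap" using card_mono[OF fin' sub] cd by simp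
  have c: "0 \<le> c" using assms(3)[of 0] by simp
  have *: "(\<Sum>i\<in>F. \<bar>u i\<bar>) \<le> overlap * c" for F
  proof (cases "finite F")
    case True
    have "(\<Sum>i\<in>F. \<bar>u i\<bar>) = (\<Sum>i\<in>F \<inter> {i. u i \<noteq> 0}. \<bar>u i\<bar>)"
      by (rule sum.mono_neutral_right) (use True in auto)
    also have "\<dots> \<le> (\<Sum>i\<in>F \<inter> {i. u i \<noteq> 0}. c)" by (intro sum_mono assms(3))
    also have "\<dots> = card (F \<inter> {i. u i \<noteq> 0}) * c" by simp
    also have "\<dots> \<le> overlap * c"
      using card_mono[OF fin, of "F \<inter> {i. u i \<noteq> 0}"] card c by (intro mult_right_mono) auto
    finally show ?thesis .
  qed (use c in simp)
  show "(\<Sum>i\<in>F. \<bar>u i\<bar>) \<le> overlap * c" by (rule *)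
  show **: "\<bar>\<Sum>i\<in>F. u i\<bar> \<le> overlap * c" for F using sum_abs[of u F] *[of F] by linarith
  have "u sums (\<Sum>i | u i \<noteq> 0. u i)" using fin by (intro sums_finite) auto
  then show "\<bar>suminf u\<bar> \<le> overlap * c" "summable u" using ** by (auto simp: sums_iff)
  show "u i = 0" if "z \<notin> \<Omega>" using assms(2)[of i] whitney_simps(3)[OF assms(1), of i] that by blast
qed

end

section \<open>Moment matching on ellipsoids\<close>

text \<open>Linear independence is replaced by the expansion formula, which is the property that moment
  matching relies on.\<close>

definition basis :: "nat \<Rightarrow> (real^'n \<Rightarrow> real) set" where
  "basis d = (SOME G. finite G \<and> G \<subseteq> polys d \<and>
     (\<forall>p\<in>polys d. AE w in lborel. w \<in> cball 0 (1/2) \<longrightarrow> p w = (\<Sum>e\<in>G. ball_inner p e * e w)))"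

lemma basis:
  shows "finite (basis d :: (real^'n \<Rightarrow> real) set)" "(basis d :: (real^'n \<Rightarrow> real) set) \<subseteq> polys d"
    "\<And>p :: real^'n \<Rightarrow> real. p \<in> polys d \<Longrightarrow>
      AE w in lborel. w \<in> cball 0 (1/2) \<longrightarrow> p w = (\<Sum>e\<in>basis d. ball_inner p e * e w)"
  using someI_ex[OF moment_basis[of d, where 'n='n], folded basis_def] by blast+

lemma basis_bounded_derivs: "\<exists>L>0. \<forall>e\<in>basis d. bounded_derivs N L (ball 0 1) (e :: real^'n \<Rightarrow> real)"
proof -
  have "\<forall>e\<in>basis d. \<exists>K\<ge>0. bounded_derivs N K (ball 0 1) (e :: real^'n \<Rightarrow> real)"
    using polys_bounded_derivs basis(2) by blast
  then obtain K where K: "\<And>e. e \<in> basis d \<Longrightarrow> 0 \<le> K e \<and> bounded_derivs N (K e) (ball 0 1) (e :: real^'n \<Rightarrow> real)" by metis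
  define L where "L = 1 + (\<Sum>e\<in>(basis d :: (real^'n \<Rightarrow> real) set). K e)"
  have "K e \<le> L" if "e \<in> basis d" for e
    using member_le_sum[OF that, of K] K basis(1) by (force simp: L_def)
  then have "\<forall>e\<in>basis d. bounded_derivs N L (ball 0 1) (e :: real^'n \<Rightarrow> real)"
    using K bounded_derivs_mono by blast
  moreover have "0 \<le> (\<Sum>e\<in>(basis d :: (real^'n \<Rightarrow> real) set). K e)" using K by (intro sum_nonneg) auto
  ultimately show ?thesis by (intro exI[of _ L]) (auto simp: L_def)
qed

lemma bounded_derivs_cutoff_mult:
  assumes "bounded_derivs N K UNIV \<phi>" "bounded_derivs N L (ball 0 1) e" "0 \<le> K" "0 \<le> L"
    "\<And>w. 1/2 \<le> norm w \<Longrightarrow> \<phi> w = 0"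
  shows "bounded_derivs N (2 ^ N * (K * L)) UNIV (\<lambda>w. \<phi> w * e w)"
proof (rule bounded_derivs_extend_by_zero)
  show "bounded_derivs N (2 ^ N * (K * L)) (ball 0 1) (\<lambda>w. \<phi> w * e w)"
    by (intro bounded_derivs_mult assms(2-4) bounded_derivs_mono[OF assms(1)]) auto
qed (use assms in auto)

definition locally_integrable :: "(real^'n \<Rightarrow> real) \<Rightarrow> bool" where
  "locally_integrable f \<longleftrightarrow> (\<forall>r. integrable lebesgue (\<lambda>z. indicator (cball 0 r) z *\<^sub>R f z))"

lemma locally_integrable_bounded:
  assumes "locally_integrable f" "bounded S" "S \<in> sets lebesgue" "g \<in> borel_measurable lebesgue"
    "\<And>z. z \<in> S \<Longrightarrow> \<bar>g z\<bar> \<le> a * \<bar>f z\<bar> + b" "\<And>z. z \<notin> S \<Longrightarrow> g z = 0" "0 \<le> a" "0 \<le> b"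
  shows "integrable lebesgue g"
proof -
  obtain r where r: "S \<subseteq> cball 0 r" using bounded_subset_ballD[OF assms(2), of 0] ball_subset_cball by blast
  have "integrable lebesgue (\<lambda>z. indicator (cball 0 r) z *\<^sub>R f z)" using assms(1) by (simp add: locally_integrable_def)
  moreover have "integrable lebesgue (\<lambda>z::real^'a. indicator (cball 0 r) z * b)"
    using emeasure_bounded_finite[OF bounded_cball, of "0::real^'a" r]
    by (intro integrable_mult_left integrable_real_indicator) (auto simp: top.not_eq_extremum)
  ultimately have "integrable lebesgue (\<lambda>z. a * \<bar>indicator (cball 0 r) z *\<^sub>R f z\<bar> + indicator (cball 0 r) z * b)"
    by (intro Bochner_Integration.integrable_add integrable_mult_right integrable_abs)
  then show ?thesis
  proof (rule Bochner_Integration.integrable_bound[OF _ assms(4)], intro AE_I2)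
    fix z
    show "norm (g z) \<le> norm (a * \<bar>indicator (cball 0 r) z *\<^sub>R f z\<bar> + indicator (cball 0 r) z * b)"
      using assms(5)[of z] assms(6)[of z] r assms(7,8) by (cases "z \<in> S") (auto simp: indicator_def)
  qed
qed

context ellipsoid_cover begin

lemma measurable_chart [measurable]: "chart y s \<in> borel \<rightarrow>\<^sub>M borel"
  by (rule borel_measurable_continuous_onI[OF continuous_chart])

lemma measurable_poly_chart:
  assumes "p \<in> polys d" shows "(\<lambda>z. p (chart y s z)) \<in> borel_measurable borel" "(\<lambda>z. p (chart y s z)) \<in> borel_measurable lebesgue"
proof -
  have [measurable]: "p \<in> borel_measurable borel" by (rule borel_measurable_continuous_onI[OF continuous_polys[OF assms]])
  show 1: "(\<lambda>z. p (chart y s z)) \<in> borel_measurable borel" by measurable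
  show "(\<lambda>z. p (chart y s z)) \<in> borel_measurable lebesgue" by (rule borel_measurable_lebesgue[OF 1])
qed

lemma integral_chart:
  assumes "g \<in> borel_measurable borel"
  shows "(LINT z|lebesgue. g (chart y s z)) = \<bar>det (M y s)\<bar> * (LINT w|lborel. g w :: real)"
proof -
  have m: "(\<lambda>z. g (chart y s z)) \<in> borel_measurable borel" using assms by measurable
  have "(LINT z|lebesgue. g (chart y s z)) = (LINT z|lborel. g (chart y s z))"
    by (rule integral_completion) (use m in simp)
  also have "\<dots> = \<bar>det (M y s)\<bar> * (LINT w|lborel. g w)"
    by (subst integral_affine_matrix[OF invM m, of y s y]) (simp add: chart_M)
  finally show ?thesis .
qed

lemma AE_chart:
  assumes "AE w in lborel. P w"
  shows "AE z in lebesgue. P (chart y s z)"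
proof -
  obtain N where N: "{w. \<not> P w} \<subseteq> N" "N \<in> null_sets lborel" using assms by (auto simp: eventually_ae_filter)
  have [measurable]: "N \<in> sets borel" using N(2) by auto
  have T[measurable]: "(\<lambda>w. M y s *v w + y) \<in> borel \<rightarrow>\<^sub>M borel"
    by (intro borel_measurable_continuous_onI continuous_intros linear_continuous_on_compose matrix_vector_mul_linear)
  have "AE w in lborel. w \<notin> N" using N(2) by (rule AE_not_in)
  then have "AE w in lborel. chart y s (M y s *v w + y) \<notin> N" by (simp add: chart_M)
  then have "AE z in distr lborel borel (\<lambda>w. M y s *v w + y). chart y s z \<notin> N"
    by (subst AE_distr_iff) auto
  then have "AE z in density (distr lborel borel (\<lambda>w. M y s *v w + y)) (\<lambda>_. ennreal \<bar>det (M y s)\<bar>). chart y s z \<notin> N"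
    by (subst AE_density) auto
  then have "AE z in lborel. chart y s z \<notin> N"
    by (subst lborel_affine_matrix[OF invM, where x=y])
  then have "AE z in lebesgue. chart y s z \<notin> N" by (rule AE_completion)
  then show ?thesis by eventually_elim (use N(1) in auto)
qed

text \<open>The polynomial with the same moments as \<open>u\<close>, cut off to the half-size ellipsoid. Its
  coefficients are moments of \<open>u\<close> and are therefore meaningful, and small, when \<open>u\<close> is
  controlled by testing against smooth functions only. The determinant converts integrals to
  the coordinates of the ellipsoid.\<close>

definition proj :: "nat \<Rightarrow> real^'n \<Rightarrow> real \<Rightarrow> (real^'n \<Rightarrow> real) \<Rightarrow> real^'n \<Rightarrow> real" where
  "proj d y s u z = indicator (cball 0 (1/2)) (chart y s z) *
     (\<Sum>e\<in>basis d. ((LINT v|lebesgue. u v * e (chart y s v)) / \<bar>det (M y s)\<bar>) * e (chart y s z))"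

lemma measurable_proj [measurable]: "proj d y s u \<in> borel_measurable borel" "proj d y s u \<in> borel_measurable lebesgue"
proof -
  have "e \<in> polys d" if "e \<in> basis d" for e using basis(2) that by auto
  note poly = measurable_poly_chart(1)[OF this]
  have [measurable]: "cball (0::real^'n) (1/2) \<in> sets borel" by simp
  have "(\<lambda>z. indicator (cball 0 (1/2)) (chart y s z) :: real) \<in> borel_measurable borel" by measurable
  then show 1: "proj d y s u \<in> borel_measurable borel"
    unfolding proj_def[abs_def] by (intro borel_measurable_times borel_measurable_sum borel_measurable_const) (auto intro: poly)
  show "proj d y s u \<in> borel_measurable lebesgue" by (rule borel_measurable_lebesgue[OF 1])
qed

lemma proj_support: "proj d y s u z \<noteq> 0 \<Longrightarrow> norm (chart y s z) \<le> 1/2"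
  by (auto simp: proj_def indicator_def split: if_splits)

lemma half_mem_E: "norm (chart y s z) \<le> 1/2 \<Longrightarrow> z \<in> E y s" by (simp add: mem_E)

lemma proj_zero: "(\<And>z. u z = 0) \<Longrightarrow> proj d y s u z = 0" by (simp add: proj_def)

lemma integrable_mult_poly:
  assumes "integrable lebesgue u" "\<And>z. u z \<noteq> 0 \<Longrightarrow> norm (chart y s z) \<le> 1/2" "p \<in> polys d"
  shows "integrable lebesgue (\<lambda>z. u z * p (chart y s z))"
proof -
  obtain K where K: "0 \<le> K" "bounded_derivs 0 K (ball 0 1) p" using polys_bounded_derivs[OF assms(3)] by blast
  have m: "(\<lambda>z. u z * p (chart y s z)) \<in> borel_measurable lebesgue"
    using measurable_poly_chart(2)[OF assms(3)] assms(1) by (intro borel_measurable_times) auto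
  show ?thesis
  proof (rule Bochner_Integration.integrable_bound[OF integrable_mult_right[OF assms(1), of K] m], intro AE_I2)
    fix z
    show "norm (u z * p (chart y s z)) \<le> norm (K * u z)"
    proof (cases "u z = 0")
      case False
      then have "chart y s z \<in> ball 0 1" using assms(2)[of z] by simp
      then have "\<bar>p (chart y s z)\<bar> \<le> K" using bounded_derivs_bound[OF K(2)] by blast
      from mult_left_mono[OF this, of "\<bar>u z\<bar>"] show ?thesis using K(1) by (simp add: abs_mult mult.commute)
    qed simp
  qed
qed

text \<open>Expanding \<open>p\<close> in the basis, both sides equal the sum of the moments of \<open>u\<close> weighted by the
  coefficients of \<open>p\<close>. The expansion holds almost everywhere on the ball that carries \<open>u\<close>.\<close>

lemma proj_moment_chart:
  assumes "integrable lebesgue u" "\<And>z. u z \<noteq> 0 \<Longrightarrow> norm (chart y s z) \<le> 1/2" "p \<in> polys d"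
  shows "(LINT z|lebesgue. proj d y s u z * p (chart y s z)) = (LINT z|lebesgue. u z * p (chart y s z))"
proof -
  define c where "c = (\<lambda>e. (LINT v|lebesgue. u v * e (chart y s v)) / \<bar>det (M y s)\<bar>)"
  have e: "e \<in> polys d" if "e \<in> basis d" for e using basis(2) that by auto
  have poly: "q \<in> borel_measurable borel" if "q \<in> polys d" for q :: "real^'n \<Rightarrow> real"
    by (rule borel_measurable_continuous_onI[OF continuous_polys[OF that]])
  define g where "g = (\<lambda>w. \<Sum>e\<in>basis d. c e * (indicator (cball 0 (1/2)) w * (e w * p w)))"
  have gm: "g \<in> borel_measurable borel" unfolding g_def using e assms(3)
    by (intro borel_measurable_sum borel_measurable_times borel_measurable_const borel_measurable_indicator poly) auto
  have "(LINT z|lebesgue. proj d y s u z * p (chart y s z)) = (LINT z|lebesgue. g (chart y s z))"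
    by (rule Bochner_Integration.integral_cong) (auto simp: proj_def g_def c_def sum_distrib_left sum_distrib_right mult_ac)
  also have "\<dots> = \<bar>det (M y s)\<bar> * (LINT w|lborel. g w)" by (rule integral_chart[OF gm])
  also have "(LINT w|lborel. g w) = (\<Sum>e\<in>basis d. c e * ball_inner e p)"
    unfolding g_def ball_inner_def using e assms(3)
    by (subst Bochner_Integration.integral_sum) (auto intro: integrable_ball_mult)
  also have "\<bar>det (M y s)\<bar> * \<dots> = (\<Sum>e\<in>basis d. (LINT v|lebesgue. u v * e (chart y s v)) * ball_inner p e)"
    unfolding sum_distrib_left using det_inv(2)[of y s] ball_inner_simps(3)[OF e assms(3) assms(3)]
    by (intro sum.cong refl) (simp add: c_def)
  also have "\<dots> = (LINT v|lebesgue. (\<Sum>e\<in>basis d. ball_inner p e * (u v * e (chart y s v))))"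
    using e integrable_mult_poly[OF assms(1,2)]
    by (subst Bochner_Integration.integral_sum) (auto simp: mult.commute)
  also have "\<dots> = (LINT z|lebesgue. u z * p (chart y s z))"
  proof (rule integral_cong_AE)
    show "(\<lambda>v. \<Sum>e\<in>basis d. ball_inner p e * (u v * e (chart y s v))) \<in> borel_measurable lebesgue"
      using assms(1) measurable_poly_chart(2)[OF e] by (intro borel_measurable_sum borel_measurable_times) auto
    show "(\<lambda>z. u z * p (chart y s z)) \<in> borel_measurable lebesgue"
      using assms measurable_poly_chart(2) by (intro borel_measurable_times) auto
    show "AE z in lebesgue. (\<Sum>e\<in>basis d. ball_inner p e * (u z * e (chart y s z))) = u z * p (chart y s z)"
      using AE_chart[OF basis(3)[OF assms(3)], of y s]
    proof eventually_elim
      case (elim z)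
      then show ?case using assms(2)[of z] by (cases "u z = 0") (auto simp: sum_distrib_left mult_ac)
    qed
  qed
  finally show ?thesis .
qed

lemma proj_moment:
  assumes "integrable lebesgue u" "\<And>z. u z \<noteq> 0 \<Longrightarrow> norm (chart y s z) \<le> 1/2" "p \<in> polys d"
  shows "(LINT z|lebesgue. proj d y s u z * p z) = (LINT z|lebesgue. u z * p z)"
  using proj_moment_chart[OF assms(1,2) polys_affine[OF assms(3), of "M y s" y]] by (simp add: M_chart)

lemma proj_sum:
  assumes "finite A" "\<And>i. i \<in> A \<Longrightarrow> integrable lebesgue (u i)" "\<And>i z. i \<in> A \<Longrightarrow> u i z \<noteq> 0 \<Longrightarrow> norm (chart y s z) \<le> 1/2"
  shows "proj d y s (\<lambda>z. \<Sum>i\<in>A. u i z) z = (\<Sum>i\<in>A. proj d y s (u i) z)"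
proof -
  have "(LINT v|lebesgue. (\<Sum>i\<in>A. u i v) * e (chart y s v)) = (\<Sum>i\<in>A. LINT v|lebesgue. u i v * e (chart y s v))"
    if "e \<in> basis d" for e
    unfolding sum_distrib_right using that basis(2)[of d] assms
    by (intro Bochner_Integration.integral_sum integrable_mult_poly) auto
  then have "proj d y s (\<lambda>z. \<Sum>i\<in>A. u i z) z = indicator (cball 0 (1/2)) (chart y s z) *
     (\<Sum>e\<in>basis d. (\<Sum>i\<in>A. (LINT v|lebesgue. u i v * e (chart y s v)) / \<bar>det (M y s)\<bar> * e (chart y s z)))"
    unfolding proj_def by (simp add: sum_divide_distrib sum_distrib_right)
  also have "\<dots> = (\<Sum>i\<in>A. proj d y s (u i) z)"
    unfolding proj_def sum_distrib_left by (subst sum.swap) simp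
  finally show ?thesis .
qed

text \<open>Normalised moments of size \<open>c\<close> give a projection of size \<open>c\<close>, since the volume of the
  ellipsoid is comparable to \<open>2 powr (- s)\<close> and the basis is bounded on the ball.\<close>

lemma proj_bound:
  "\<exists>K>0. \<forall>y s u c z. 0 \<le> c \<longrightarrow> (\<forall>e\<in>basis d. \<bar>LINT v|lebesgue. u v * e (chart y s v)\<bar> \<le> c * 2 powr (- s)) \<longrightarrow>
     \<bar>proj d y s u z\<bar> \<le> K * c"
proof -
  obtain L where L: "0 < L" "\<And>e. e \<in> basis d \<Longrightarrow> bounded_derivs 0 L (ball 0 1) (e :: real^'n \<Rightarrow> real)"
    using basis_bounded_derivs by blast
  define \<omega> where "\<omega> = measure lebesgue (ball (0::real^'n) 1)"
  have \<omega>: "0 < \<omega>" using unit_ball_measure_pos by (simp add: \<omega>_def)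
  let ?n = "real (card (basis d :: (real^'n \<Rightarrow> real) set))"
  define K where "K = ?n * (\<omega> / a1 * L) + 1"
  have K: "0 < K" using \<omega> pos L(1) by (simp add: K_def add_nonneg_pos)
  have "\<bar>proj d y s u z\<bar> \<le> K * c"
    if c: "0 \<le> c" and b: "\<forall>e\<in>basis d. \<bar>LINT v|lebesgue. u v * e (chart y s v)\<bar> \<le> c * 2 powr (- s)" for y s u c z
  proof (cases "norm (chart y s z) \<le> 1/2")
    case True
    have det: "2 powr (- s) / \<bar>det (M y s)\<bar> \<le> \<omega> / a1"
      using det_M_bounds(2)[of s y] det_inv(2)[of y s] pos \<omega> by (simp add: \<omega>_def field_simps)
    have "\<bar>proj d y s u z\<bar> \<le> (\<Sum>e\<in>basis d. \<bar>(LINT v|lebesgue. u v * e (chart y s v)) / \<bar>det (M y s)\<bar> * e (chart y s z)\<bar>)"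
      using True sum_abs[of "\<lambda>e. (LINT v|lebesgue. u v * e (chart y s v)) / \<bar>det (M y s)\<bar> * e (chart y s z)" "basis d"]
      unfolding proj_def by simp
    also have "\<dots> \<le> (\<Sum>e\<in>(basis d :: (real^'n \<Rightarrow> real) set). (c * (\<omega> / a1)) * L)"
    proof (rule sum_mono)
      fix e :: "real^'n \<Rightarrow> real" assume e: "e \<in> basis d"
      have "\<bar>(LINT v|lebesgue. u v * e (chart y s v)) / \<bar>det (M y s)\<bar>\<bar> \<le> c * 2 powr (- s) / \<bar>det (M y s)\<bar>"
        using b e by (simp add: divide_right_mono)
      also have "\<dots> \<le> c * (\<omega> / a1)" using mult_left_mono[OF det c] by simp
      finally have 1: "\<bar>(LINT v|lebesgue. u v * e (chart y s v)) / \<bar>det (M y s)\<bar>\<bar> \<le> c * (\<omega> / a1)" .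
      have 2: "\<bar>e (chart y s z)\<bar> \<le> L" using bounded_derivs_bound[OF L(2)[OF e]] True by simp
      show "\<bar>(LINT v|lebesgue. u v * e (chart y s v)) / \<bar>det (M y s)\<bar> * e (chart y s z)\<bar> \<le> (c * (\<omega> / a1)) * L"
        unfolding abs_mult[of "_ / _"] by (rule mult_mono[OF 1 2]) (use c \<omega> pos in auto)
    qed
    also have "\<dots> = (?n * (\<omega> / a1 * L)) * c" by simp
    also have "\<dots> \<le> K * c" using c by (intro mult_right_mono) (simp_all add: K_def)
    finally show ?thesis .
  next
    case False
    then have "proj d y s u z = 0" using proj_support by blast
    then show ?thesis using K c by simp
  qed
  then show ?thesis using K by blast
qed

section \<open>The Calderon--Zygmund decomposition\<close>

text \<open>For a Whitney cover of the set where the maximal function exceeds some height: on each Whitney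
  ellipsoid, \<open>approx\<close> is the projection of the localised function and \<open>bad\<close> the remainder,
  which has vanishing moments. The function \<open>good\<close> is the sum of the projections on the set
  and \<open>f\<close> off it.

  For two nested sets, with primed data for the smaller one, \<open>piece\<close> is a summand of the
  difference of the two good functions. Localising that difference with \<open>pou\<close> destroys the
  vanishing moments of the bad parts of the smaller set; \<open>correction\<close> restores them.\<close>

definition approx where
  "approx d f I x t i = proj d (x i) (t i + J3) (\<lambda>z. f z * pou I x t i z)"

definition bad where
  "bad d f I x t i z = f z * pou I x t i z - approx d f I x t i z"

definition good where
  "good d f I x t z = f z - (\<Sum>i. bad d f I x t i z)"

definition correction where
  "correction d f I x t I' x' t' i j = proj d (x' j) (t' j + J3) (\<lambda>z. bad d f I' x' t' j z * pou I x t i z)"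

definition piece where
  "piece d f I x t I' x' t' i z = good d f I' x' t' z * pou I x t i z - approx d f I x t i z
     + (\<Sum>j. correction d f I x t I' x' t' i j z)"

lemma approx_support:
  assumes "approx d f I x t i z \<noteq> 0" shows "i \<in> I" "norm (chart (x i) (t i + J3) z) \<le> 1/2"
proof -
  show "norm (chart (x i) (t i + J3) z) \<le> 1/2" using proj_support assms unfolding approx_def by blast
  show "i \<in> I"
  proof (rule ccontr)
    assume "i \<notin> I"
    then have "approx d f I x t i z = 0" unfolding approx_def using pou_support(1) by (intro proj_zero) auto
    then show False using assms by simp
  qed
qed

lemma bad_support:
  assumes "bad d f I x t i z \<noteq> 0" shows "i \<in> I" "norm (chart (x i) (t i + J3) z) \<le> 1/2"
proof -
  have "pou I x t i z \<noteq> 0 \<or> approx d f I x t i z \<noteq> 0" using assms by (auto simp: bad_def)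
  then show "i \<in> I" "norm (chart (x i) (t i + J3) z) \<le> 1/2"
    using pou_support[of I x t i z] approx_support[of d f I x t i z] by auto
qed

lemma integrable_mult_pou:
  assumes "locally_integrable f" "f \<in> borel_measurable lebesgue"
  shows "integrable lebesgue (\<lambda>z. f z * pou I x t i z)"
proof (rule locally_integrable_bounded[OF assms(1) bounded_E[of "x i" "t i + J3"]])
  show "E (x i) (t i + J3) \<in> sets lebesgue" using E_lmeasurable by auto
  show "(\<lambda>z. f z * pou I x t i z) \<in> borel_measurable lebesgue" using assms(2) by measurable
  show "\<bar>f z * pou I x t i z\<bar> \<le> 1 * \<bar>f z\<bar> + 0" for z
    using pou_range[of I x t i z] by (simp add: abs_mult mult_left_le)
  show "f z * pou I x t i z = 0" if "z \<notin> E (x i) (t i + J3)" for z using that pou_support(3) by fastforce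
qed auto

lemma integrable_proj: "integrable lebesgue (proj d y s u)"
proof -
  define g where "g = (\<lambda>w. \<Sum>e\<in>basis d. ((LINT v|lebesgue. u v * e (chart y s v)) / \<bar>det (M y s)\<bar>) * e w)"
  have g: "g \<in> polys d" unfolding g_def using basis(2) by (intro polys_sum polys_cmult) auto
  obtain K where K: "0 \<le> K" "bounded_derivs 0 K (ball 0 1) g" using polys_bounded_derivs[OF g] by blast
  have zero: "locally_integrable (\<lambda>_. 0 :: real)" by (simp add: locally_integrable_def)
  show ?thesis
  proof (rule locally_integrable_bounded[OF zero bounded_E[of y s]])
    show "\<bar>proj d y s u z\<bar> \<le> 0 * \<bar>0\<bar> + K" for z
    proof (cases "norm (chart y s z) \<le> 1/2")
      case True
      then have "proj d y s u z = g (chart y s z)" by (simp add: proj_def g_def)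
      then show ?thesis using bounded_derivs_bound[OF K(2), of "chart y s z"] True by simp
    next
      case False
      then have "proj d y s u z = 0" using proj_support by blast
      then show ?thesis using K by simp
    qed
    show "proj d y s u z = 0" if "z \<notin> E y s" for z using proj_support half_mem_E that by blast
  qed (use E_lmeasurable K in auto)
qed

lemma integrable_bad:
  assumes "locally_integrable f" "f \<in> borel_measurable lebesgue"
  shows "integrable lebesgue (bad d f I x t i)"
  unfolding bad_def[abs_def] approx_def
  by (intro Bochner_Integration.integrable_diff integrable_mult_pou[OF assms] integrable_proj)

lemma integrable_poly_on_bounded:
  assumes "integrable lebesgue u" "\<And>z. u z \<noteq> 0 \<Longrightarrow> norm (chart y s z) \<le> 1/2" "p \<in> polys d"
  shows "integrable lebesgue (\<lambda>z. u z * p z)"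
  using integrable_mult_poly[OF assms(1,2) polys_affine[OF assms(3), of "M y s" y]] by (simp add: M_chart)

lemma bad_moment:
  assumes "locally_integrable f" "f \<in> borel_measurable lebesgue" "p \<in> polys d"
  shows "(LINT z|lebesgue. bad d f I x t i z * p z) = 0"
proof -
  have sup: "norm (chart (x i) (t i + J3) z) \<le> 1/2" if "f z * pou I x t i z \<noteq> 0" for z
    using that pou_support(2)[of I x t i z] by force
  have "(LINT z|lebesgue. bad d f I x t i z * p z)
      = (LINT z|lebesgue. (f z * pou I x t i z) * p z) - (LINT z|lebesgue. approx d f I x t i z * p z)"
    unfolding bad_def left_diff_distrib approx_def
    by (intro Bochner_Integration.integral_diff integrable_poly_on_bounded[OF integrable_mult_pou[OF assms(1,2)] sup assms(3)]
         integrable_poly_on_bounded[OF integrable_proj proj_support assms(3)])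
  also have "\<dots> = 0"
    using proj_moment[OF integrable_mult_pou[OF assms(1,2)] sup assms(3)] unfolding approx_def by simp
  finally show ?thesis .
qed

text \<open>A Whitney ellipsoid, enlarged by boundedly many scales, contains a point off \<open>\<Omega>\<close>. There the
  maximal function is at most \<open>c\<close>, and the localised basis functions are multiples of test
  functions.\<close>

lemma approx_bound:
  "\<exists>K>0. \<forall>f \<Omega> I x t c i z. whitney \<Omega> I x t \<longrightarrow> 0 \<le> c \<longrightarrow> (\<forall>v. v \<notin> \<Omega> \<longrightarrow> maximal N f v \<le> ennreal c) \<longrightarrow>
     \<bar>approx d f I x t i z\<bar> \<le> K * c"
proof -
  obtain Kp where Kp: "0 < Kp" "\<And>y s u c z. 0 \<le> c \<Longrightarrow>
      (\<forall>e\<in>basis d. \<bar>LINT v|lebesgue. u v * e (chart y s v)\<bar> \<le> c * 2 powr (- s)) \<Longrightarrow> \<bar>proj d y s u z\<bar> \<le> Kp * c"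
    using proj_bound[of d] by blast
  obtain Ku where Ku: "0 < Ku" "\<And>\<Omega> I x t i. whitney \<Omega> I x t \<Longrightarrow> i \<in> I \<Longrightarrow>
     bounded_derivs N Ku UNIV (\<lambda>w. pou I x t i (M (x i) (t i + J3) *v w + x i))" using pou_bounded_derivs[of N] by blast
  obtain L where L: "0 < L" "\<And>e. e \<in> basis d \<Longrightarrow> bounded_derivs N L (ball 0 1) (e :: real^'n \<Rightarrow> real)"
    using basis_bounded_derivs by blast
  define D where "D = J3 + J1"
  have D: "J0 \<le> D" using J3_ge J0_pos by (simp add: D_def)
  define K where "K = distortion D ^ N * (2 ^ N * (Ku * L)) * 2 powr D"
  have K: "0 < K" using distortion_ge_1[of D] Ku L by (simp add: K_def)
  have "\<bar>approx d f I x t i z\<bar> \<le> Kp * K * c"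
    if W: "whitney \<Omega> I x t" and c: "0 \<le> c" and mx: "\<forall>v. v \<notin> \<Omega> \<longrightarrow> maximal N f v \<le> ennreal c" for f \<Omega> I x t c i z
  proof (cases "i \<in> I")
    case i: True
    let ?s = "t i + J3"
    let ?\<phi> = "\<lambda>w. pou I x t i (M (x i) ?s *v w + x i)"
    have supp: "?\<phi> w = 0" if "1/2 \<le> norm w" for w
      using pou_support(2)[of I x t i "M (x i) ?s *v w + x i"] that by (auto simp: chart_M)
    obtain v where v: "v \<in> E (x i) (?s - D)" "v \<notin> \<Omega>"
      using whitney_simps(2)[OF W i] by (auto simp: D_def)
    have "\<bar>LINT v|lebesgue. (f v * pou I x t i v) * e (chart (x i) ?s v)\<bar> \<le> (K * c) * 2 powr (- ?s)" if e: "e \<in> basis d" for e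
    proof -
      have "\<bar>LINT z|lebesgue. f z * (?\<phi> (chart (x i) ?s z) * e (chart (x i) ?s z))\<bar>
          \<le> distortion D ^ N * (2 ^ N * (Ku * L)) * c * 2 powr D * 2 powr (- ?s)"
      proof (rule maximal_test_bound_enlarged[OF v(1) D _ c])
        show "maximal N f v \<le> ennreal c" using mx v by blast
        show "bounded_derivs N (2 ^ N * (Ku * L)) UNIV (\<lambda>w. ?\<phi> w * e w)"
          by (rule bounded_derivs_cutoff_mult[OF Ku(2)[OF W i] L(2)[OF e]]) (use Ku L supp in auto)
        show "\<exists>K. bounded_derivs m K UNIV (\<lambda>w. ?\<phi> w * e w)" for m
        proof -
          obtain K1 where K1: "0 < K1" "bounded_derivs m K1 UNIV ?\<phi>" using pou_bounded_derivs[of m] W i by blast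
          obtain K2 where K2: "0 \<le> K2" "bounded_derivs m K2 (ball 0 1) e"
            using polys_bounded_derivs basis(2) e by blast
          show ?thesis using bounded_derivs_cutoff_mult[OF K1(2) K2(2) _ K2(1) supp] K1(1) by auto
        qed
      qed (use Ku L supp in auto)
      then show ?thesis by (simp add: M_chart K_def mult_ac)
    qed
    then show ?thesis unfolding approx_def using Kp(2)[of "K * c"] K c by (simp add: mult_ac)
  next
    case False
    then have "approx d f I x t i z = 0" using approx_support by blast
    then show ?thesis using c K Kp by simp
  qed
  then show ?thesis using K Kp by (intro exI[of _ "Kp * K"]) auto
qed

end

context ellipsoid_cover begin

text \<open>A partition function of the smaller set whose support meets that of one of the larger set
  belongs to an ellipsoid that is not much larger and lies in the Whitney ellipsoid of the
  latter.\<close>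

lemma nested_whitney:
  assumes "whitney \<Omega> I x t" "whitney \<Omega>' I' x' t'" "\<Omega>' \<subseteq> \<Omega>" "i \<in> I" "j \<in> I'"
    "E (x i) (t i + J3) \<inter> E (x' j) (t' j + J3) \<noteq> {}"
  shows "t i - J1 < t' j" "E (x' j) (t' j + J3) \<subseteq> E (x i) (t i)"
  using support_in_enlarged[OF whitney_simps(2)[OF assms(1,4)] order.trans[OF whitney_simps(1)[OF assms(2,5)] assms(3)] assms(6)]
  by blast+

lemma correction_support:
  assumes "correction d f I x t I' x' t' i j z \<noteq> 0"
  shows "i \<in> I" "j \<in> I'" "norm (chart (x' j) (t' j + J3) z) \<le> 1/2"
    "E (x i) (t i + J3) \<inter> E (x' j) (t' j + J3) \<noteq> {}"
proof -
  show "norm (chart (x' j) (t' j + J3) z) \<le> 1/2" using assms proj_support unfolding correction_def by blast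
  obtain v where "bad d f I' x' t' j v * pou I x t i v \<noteq> 0"
    using assms proj_zero[of "\<lambda>z. bad d f I' x' t' j z * pou I x t i z"] unfolding correction_def by blast
  then have v: "bad d f I' x' t' j v \<noteq> 0" "pou I x t i v \<noteq> 0" by auto
  show "i \<in> I" "j \<in> I'" using bad_support(1)[OF v(1)] pou_support(1)[OF v(2)] by auto
  show "E (x i) (t i + J3) \<inter> E (x' j) (t' j + J3) \<noteq> {}"
    using half_mem_E[OF bad_support(2)[OF v(1)]] pou_support(3)[OF v(2)] by blast
qed

lemma integrable_mult_pou':
  assumes "integrable lebesgue u" shows "integrable lebesgue (\<lambda>z. u z * pou I x t i z)"
proof (rule Bochner_Integration.integrable_bound[OF assms])
  have [measurable]: "u \<in> borel_measurable lebesgue" using assms by auto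
  show "(\<lambda>z. u z * pou I x t i z) \<in> borel_measurable lebesgue" by measurable
  show "AE z in lebesgue. norm (u z * pou I x t i z) \<le> norm (u z)"
    using pou_range[of I x t i] by (intro AE_I2) (simp add: abs_mult mult_left_le)
qed

lemma measurable_approx [measurable]: "approx d f I x t i \<in> borel_measurable lebesgue"
  unfolding approx_def by measurable

lemma integral_abs_le_measure:
  assumes "integrable lebesgue g" "S \<in> lmeasurable" "\<And>z. z \<in> S \<Longrightarrow> \<bar>g z\<bar> \<le> c" "\<And>z. z \<notin> S \<Longrightarrow> g z = (0::real)"
  shows "\<bar>LINT z|lebesgue. g z\<bar> \<le> c * measure lebesgue S"
proof -
  have "\<bar>LINT z|lebesgue. g z\<bar> \<le> (LINT z|lebesgue. \<bar>g z\<bar>)" by (rule integral_abs_bound)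
  also have "\<dots> \<le> (LINT z|lebesgue. indicator S z * c)"
  proof (rule integral_mono)
    show "integrable lebesgue (\<lambda>z. indicator S z * c)"
      using assms(2) by (intro integrable_mult_left integrable_real_indicator) (auto simp: fmeasurable_def)
    show "\<bar>g z\<bar> \<le> indicator S z * c" for z using assms(3,4)[of z] by (cases "z \<in> S") auto
  qed (use assms(1) in auto)
  also have "\<dots> = c * measure lebesgue S" using assms(2) by (simp add: fmeasurable_def mult.commute)
  finally show ?thesis .
qed

text \<open>The bad part is a localised \<open>f\<close> minus a projection. The first gives moments against smooth
  bumps, controlled by the maximal function at a point off the smaller set, since by
  \<open>nested_whitney\<close> the partition function of the larger set has bounded derivatives in the
  coordinates of the smaller ellipsoid. The second is bounded by \<open>approx_bound\<close>, so that its
  moments are bounded by the volume.\<close>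

lemma correction_bound:
  "\<exists>K>0. \<forall>f \<Omega> I x t \<Omega>' I' x' t' c i j z. locally_integrable f \<longrightarrow> f \<in> borel_measurable lebesgue \<longrightarrow>
     whitney \<Omega> I x t \<longrightarrow> whitney \<Omega>' I' x' t' \<longrightarrow> \<Omega>' \<subseteq> \<Omega> \<longrightarrow> 0 \<le> c \<longrightarrow>
     (\<forall>v. v \<notin> \<Omega>' \<longrightarrow> maximal N f v \<le> ennreal c) \<longrightarrow>
     \<bar>correction d f I x t I' x' t' i j z\<bar> \<le> K * c"
proof -
  obtain Kp where Kp: "0 < Kp" "\<And>y s u c z. 0 \<le> c \<Longrightarrow>
      (\<forall>e\<in>basis d. \<bar>LINT v|lebesgue. u v * e (chart y s v)\<bar> \<le> c * 2 powr (- s)) \<Longrightarrow> \<bar>proj d y s u z\<bar> \<le> Kp * c"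
    using proj_bound[of d] by blast
  obtain Ka where Ka: "0 < Ka" "\<And>f \<Omega> I x t c i z. whitney \<Omega> I x t \<Longrightarrow> 0 \<le> c \<Longrightarrow>
      \<forall>v. v \<notin> \<Omega> \<longrightarrow> maximal N f v \<le> ennreal c \<Longrightarrow> \<bar>approx d f I x t i z\<bar> \<le> Ka * c"
    using approx_bound[of N d] by blast
  obtain Ku where Ku: "0 < Ku" "\<And>\<Omega> I x t i. whitney \<Omega> I x t \<Longrightarrow> i \<in> I \<Longrightarrow>
     bounded_derivs N Ku UNIV (\<lambda>w. pou I x t i (M (x i) (t i + J3) *v w + x i))" using pou_bounded_derivs[of N] by blast
  obtain L where L: "0 < L" "\<And>e. e \<in> basis d \<Longrightarrow> bounded_derivs N L (ball 0 1) (e :: real^'n \<Rightarrow> real)"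
    using basis_bounded_derivs by blast
  define D where "D = J3 + J1"
  have D: "J0 \<le> D" using J3_ge J0_pos by (simp add: D_def)
  define Kpp where "Kpp = 2 ^ N * (Ku * (distortion J1 ^ N * Ku))"
  have Kpp: "0 < Kpp" using Ku distortion_ge_1[of J1] by (simp add: Kpp_def)
  define K where "K = distortion D ^ N * (2 ^ N * (Kpp * L)) * 2 powr D + Ka * L * a2"
  have K: "0 < K" using distortion_ge_1[of D] Ku L Kpp Ka pos unfolding K_def by (intro add_pos_pos mult_pos_pos) auto
  have key: "\<bar>correction d f I x t I' x' t' i j z\<bar> \<le> (Kp * K) * c"
    if loc: "locally_integrable f" "f \<in> borel_measurable lebesgue"
      and W: "whitney \<Omega> I x t" and W': "whitney \<Omega>' I' x' t'" and sub: "\<Omega>' \<subseteq> \<Omega>" and c: "0 \<le> c"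
      and mx: "\<forall>v. v \<notin> \<Omega>' \<longrightarrow> maximal N f v \<le> ennreal c" for f \<Omega> I x t \<Omega>' I' x' t' c i j z
  proof (cases "correction d f I x t I' x' t' i j z = 0")
    case True
    then show ?thesis using c K Kp by simp
  next
    case False
    note i = correction_support(1)[OF False] and j = correction_support(2)[OF False] and meet = correction_support(4)[OF False]
    let ?s = "t' j + J3"
    let ?L = "\<lambda>w. M (x' j) ?s *v w + x' j"
    let ?ch = "chart (x' j) ?s"
    let ?\<phi> = "\<lambda>w. pou I' x' t' j (?L w)"
    let ?\<psi> = "\<lambda>w. pou I x t i (?L w)"
    have close: "t i - J1 < t' j" by (rule nested_whitney(1)[OF W W' sub i j meet])
    have \<psi>_bd: "bounded_derivs m (distortion J1 ^ m * k) UNIV ?\<psi>"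
      if "bounded_derivs m k UNIV (\<lambda>w. pou I x t i (M (x i) (t i + J3) *v w + x i))" for m k
      using bounded_derivs_rechart[OF that meet, of J1] close by (simp add: M_chart)
    have supp: "?\<phi> w * ?\<psi> w = 0" if "1/2 \<le> norm w" for w
      using pou_support(2)[of I' x' t' j "?L w"] that by (auto simp: chart_M)
    obtain v where v: "v \<in> E (x' j) (?s - D)" "v \<notin> \<Omega>'"
      using whitney_simps(2)[OF W' j] by (auto simp: D_def)
    have "\<bar>LINT v|lebesgue. (bad d f I' x' t' j v * pou I x t i v) * e (?ch v)\<bar> \<le> (K * c) * 2 powr (- ?s)"
      if e: "e \<in> basis d" for e
    proof -
      have ep: "e \<in> polys d" using e basis(2) by blast
      have A: "\<bar>LINT z|lebesgue. f z * ((?\<phi> (?ch z) * ?\<psi> (?ch z)) * e (?ch z))\<bar>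
          \<le> distortion D ^ N * (2 ^ N * (Kpp * L)) * c * 2 powr D * 2 powr (- ?s)"
      proof (rule maximal_test_bound_enlarged[OF v(1) D _ c])
        show "maximal N f v \<le> ennreal c" using mx v by blast
        have "bounded_derivs N Kpp UNIV (\<lambda>w. ?\<phi> w * ?\<psi> w)"
          unfolding Kpp_def using Ku distortion_ge_1[of J1]
          by (intro bounded_derivs_mult Ku(2)[OF W' j] \<psi>_bd Ku(2)[OF W i]) auto
        then show "bounded_derivs N (2 ^ N * (Kpp * L)) UNIV (\<lambda>w. (?\<phi> w * ?\<psi> w) * e w)"
          by (rule bounded_derivs_cutoff_mult[OF _ L(2)[OF e]]) (use Kpp L supp in auto)
        show "\<exists>K. bounded_derivs m K UNIV (\<lambda>w. (?\<phi> w * ?\<psi> w) * e w)" for m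
        proof -
          obtain K1 where K1: "0 < K1" "bounded_derivs m K1 UNIV ?\<phi>"
            "bounded_derivs m K1 UNIV (\<lambda>w. pou I x t i (M (x i) (t i + J3) *v w + x i))"
            using pou_bounded_derivs[of m] W i W' j by blast
          obtain K2 where K2: "0 \<le> K2" "bounded_derivs m K2 (ball 0 1) e"
            using polys_bounded_derivs[OF ep] by blast
          have nn: "0 \<le> distortion J1 ^ m * K1" using K1(1) distortion_ge_1[of J1] by simp
          have "bounded_derivs m (2 ^ m * (K1 * (distortion J1 ^ m * K1))) UNIV (\<lambda>w. ?\<phi> w * ?\<psi> w)"
            by (rule bounded_derivs_mult[OF K1(2) \<psi>_bd[OF K1(3)] less_imp_le[OF K1(1)] nn])
          from bounded_derivs_cutoff_mult[OF this K2(2) _ K2(1) supp] K1(1) nn show ?thesis by auto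
        qed
        show "(?\<phi> w * ?\<psi> w) * e w = 0" if "1 \<le> norm w" for w using supp[of w] that by simp
      qed (use Kpp L in auto)
      define u1 where "u1 = (\<lambda>v. (f v * pou I' x' t' j v) * pou I x t i v)"
      define u2 where "u2 = (\<lambda>v. approx d f I' x' t' j v * pou I x t i v)"
      have u1: "integrable lebesgue u1" unfolding u1_def by (intro integrable_mult_pou' integrable_mult_pou loc)
      have u2: "integrable lebesgue u2" unfolding u2_def approx_def by (intro integrable_mult_pou' integrable_proj)
      have s1: "norm (?ch z) \<le> 1/2" if "u1 z \<noteq> 0" for z
        using that pou_support(2)[of I' x' t' j z] by (auto simp: u1_def)
      have s2: "norm (?ch z) \<le> 1/2" if "u2 z \<noteq> 0" for z
        using that approx_support(2)[of d f I' x' t' j z] by (auto simp: u2_def)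
      have B: "\<bar>LINT v|lebesgue. u2 v * e (?ch v)\<bar> \<le> (Ka * c * L) * measure lebesgue (E (x' j) ?s)"
      proof (rule integral_abs_le_measure[OF integrable_mult_poly[OF u2 s2 ep] E_lmeasurable])
        fix z assume z: "z \<in> E (x' j) ?s"
        have "\<bar>u2 z\<bar> \<le> Ka * c"
          using Ka(2)[OF W' c mx, of j z] pou_range[of I x t i z] mult_mono[of "\<bar>approx d f I' x' t' j z\<bar>" "Ka * c" "pou I x t i z" 1]
          by (simp add: u2_def abs_mult)
        moreover have "\<bar>e (?ch z)\<bar> \<le> L" using bounded_derivs_bound[OF L(2)[OF e]] z by (simp add: mem_E)
        ultimately show "\<bar>u2 z * e (?ch z)\<bar> \<le> Ka * c * L"
          unfolding abs_mult using Ka(1) c by (intro mult_mono) auto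
      next
        fix z assume "z \<notin> E (x' j) ?s"
        then show "u2 z * e (?ch z) = 0" using s2 half_mem_E by fastforce
      qed
      have "(Ka * c * L) * measure lebesgue (E (x' j) ?s) \<le> (Ka * c * L) * (a2 * 2 powr (- ?s))"
        using Ka(1) c L(1) by (intro mult_left_mono measure_E) auto
      with B have B: "\<bar>LINT v|lebesgue. u2 v * e (?ch v)\<bar> \<le> (Ka * c * L) * (a2 * 2 powr (- ?s))" by linarith
      have "(LINT v|lebesgue. (bad d f I' x' t' j v * pou I x t i v) * e (?ch v))
          = (LINT v|lebesgue. u1 v * e (?ch v)) - (LINT v|lebesgue. u2 v * e (?ch v))"
        by (subst Bochner_Integration.integral_diff[symmetric, OF integrable_mult_poly[OF u1 s1 ep] integrable_mult_poly[OF u2 s2 ep]])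
           (auto simp: bad_def u1_def u2_def algebra_simps)
      moreover have "(LINT v|lebesgue. u1 v * e (?ch v)) = (LINT z|lebesgue. f z * ((?\<phi> (?ch z) * ?\<psi> (?ch z)) * e (?ch z)))"
        by (simp add: u1_def M_chart mult_ac)
      ultimately have "\<bar>LINT v|lebesgue. (bad d f I' x' t' j v * pou I x t i v) * e (?ch v)\<bar>
          \<le> distortion D ^ N * (2 ^ N * (Kpp * L)) * c * 2 powr D * 2 powr (- ?s) + (Ka * c * L) * (a2 * 2 powr (- ?s))"
        using A B by linarith
      also have "\<dots> = (K * c) * 2 powr (- ?s)" by (simp add: K_def algebra_simps)
      finally show ?thesis .
    qed
    then show ?thesis unfolding correction_def using Kp(2)[of "K * c"] K c by (simp add: mult_ac)
  qed
  show ?thesis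
  proof (intro exI[of _ "Kp * K"] conjI allI impI)
    show "0 < Kp * K" using K Kp by simp
  qed (rule key)
qed

text \<open>The bounds just proved depend only on the order \<open>N\<close> and the degree \<open>d\<close>. They get names because
  several estimates below have to share the same constants.\<close>

definition approx_const :: "nat \<Rightarrow> nat \<Rightarrow> real" where
  "approx_const N d = (SOME K. 0 < K \<and> (\<forall>f \<Omega> I x t c i z. whitney \<Omega> I x t \<longrightarrow> 0 \<le> c \<longrightarrow>
     (\<forall>v. v \<notin> \<Omega> \<longrightarrow> maximal N f v \<le> ennreal c) \<longrightarrow> \<bar>approx d f I x t i z\<bar> \<le> K * c))"

definition correction_const :: "nat \<Rightarrow> nat \<Rightarrow> real" where
  "correction_const N d = (SOME K. 0 < K \<and> (\<forall>f \<Omega> I x t \<Omega>' I' x' t' c i j z. locally_integrable f \<longrightarrow>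
     f \<in> borel_measurable lebesgue \<longrightarrow> whitney \<Omega> I x t \<longrightarrow> whitney \<Omega>' I' x' t' \<longrightarrow> \<Omega>' \<subseteq> \<Omega> \<longrightarrow> 0 \<le> c \<longrightarrow>
     (\<forall>v. v \<notin> \<Omega>' \<longrightarrow> maximal N f v \<le> ennreal c) \<longrightarrow>
     \<bar>correction d f I x t I' x' t' i j z\<bar> \<le> K * c))"

lemma approx_const:
  shows "0 < approx_const N d"
    "whitney \<Omega> I x t \<Longrightarrow> 0 \<le> c \<Longrightarrow> (\<forall>v. v \<notin> \<Omega> \<longrightarrow> maximal N f v \<le> ennreal c) \<Longrightarrow>
      \<bar>approx d f I x t i z\<bar> \<le> approx_const N d * c"
  using someI_ex[OF approx_bound[of N d], folded approx_const_def] by blast+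

lemma correction_const:
  shows "0 < correction_const N d"
    "locally_integrable f \<Longrightarrow> f \<in> borel_measurable lebesgue \<Longrightarrow> whitney \<Omega> I x t \<Longrightarrow> whitney \<Omega>' I' x' t' \<Longrightarrow>
      \<Omega>' \<subseteq> \<Omega> \<Longrightarrow> 0 \<le> c \<Longrightarrow> (\<forall>v. v \<notin> \<Omega>' \<longrightarrow> maximal N f v \<le> ennreal c) \<Longrightarrow>
      \<bar>correction d f I x t I' x' t' i j z\<bar> \<le> correction_const N d * c"
proof -
  note * = someI_ex[OF correction_bound[of N d], folded correction_const_def]
  show "0 < correction_const N d" using * by (rule conjunct1)
  show "locally_integrable f \<Longrightarrow> f \<in> borel_measurable lebesgue \<Longrightarrow> whitney \<Omega> I x t \<Longrightarrow> whitney \<Omega>' I' x' t' \<Longrightarrow>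
      \<Omega>' \<subseteq> \<Omega> \<Longrightarrow> 0 \<le> c \<Longrightarrow> (\<forall>v. v \<notin> \<Omega>' \<longrightarrow> maximal N f v \<le> ennreal c) \<Longrightarrow>
      \<bar>correction d f I x t I' x' t' i j z\<bar> \<le> correction_const N d * c"
    using conjunct2[OF *] by blast
qed

lemma support_in_whitney_E: "norm (chart y (s + J3) z) \<le> 1/2 \<Longrightarrow> z \<in> E y s"
  using half_mem_E support_sub_E by blast

lemma approx_finite:
  assumes "whitney \<Omega> I x t"
  shows "finite {i. approx d f I x t i z \<noteq> 0}"
proof (rule overlap_sum(1)[OF assms])
  define c where "c = Max ((\<lambda>i. \<bar>approx d f I x t i z\<bar>) ` {i\<in>I. z \<in> E (x i) (t i)} \<union> {0})"
  show "i \<in> I \<and> z \<in> E (x i) (t i)" if "approx d f I x t i z \<noteq> 0" for i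
    using approx_support[OF that] support_in_whitney_E by blast
  then show "\<bar>approx d f I x t i z\<bar> \<le> c" for i
    using assms unfolding c_def whitney_def
    by (cases "approx d f I x t i z = 0") (auto intro!: Max_ge)
qed

lemma good_eq:
  assumes "whitney \<Omega> I x t"
  shows "z \<in> \<Omega> \<Longrightarrow> (\<lambda>i. approx d f I x t i z) sums good d f I x t z" "z \<notin> \<Omega> \<Longrightarrow> good d f I x t z = f z"
    "z \<notin> \<Omega> \<Longrightarrow> approx d f I x t i z = 0"
proof -
  have "summable (\<lambda>i. approx d f I x t i z)" by (rule summable_finite[OF approx_finite[OF assms, of d f z]]) auto
  then have a: "(\<lambda>i. approx d f I x t i z) sums (\<Sum>i. approx d f I x t i z)" by (rule summable_sums)
  from sums_diff[OF sums_mult[OF pou_sums[OF assms], of "f z" z] a]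
  have b: "(\<lambda>i. bad d f I x t i z) sums (f z * indicator \<Omega> z - (\<Sum>i. approx d f I x t i z))"
    by (simp add: bad_def)
  then have g: "good d f I x t z = f z - f z * indicator \<Omega> z + (\<Sum>i. approx d f I x t i z)"
    by (simp add: good_def sums_iff)
  show "(\<lambda>i. approx d f I x t i z) sums good d f I x t z" if "z \<in> \<Omega>" using a g that by simp
  show z: "approx d f I x t i z = 0" if "z \<notin> \<Omega>" for i
    using approx_support[of d f I x t i z] support_in_whitney_E whitney_simps(3)[OF assms] that by blast
  show "good d f I x t z = f z" if "z \<notin> \<Omega>" using g z[OF that] that by simp
qed

lemma measurable_bad:
  assumes "f \<in> borel_measurable lebesgue" shows "bad d f I x t i \<in> borel_measurable lebesgue"
  unfolding bad_def[abs_def]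
  by (intro borel_measurable_diff borel_measurable_times assms measurable_pou measurable_approx)

lemma measurable_good:
  "f \<in> borel_measurable lebesgue \<Longrightarrow> good d f I x t \<in> borel_measurable lebesgue"
  unfolding good_def[abs_def] by (intro borel_measurable_diff borel_measurable_suminf measurable_bad)

lemma measurable_correction [measurable]: "correction d f I x t I' x' t' i j \<in> borel_measurable lebesgue"
  unfolding correction_def by measurable

lemma measurable_piece:
  assumes "f \<in> borel_measurable lebesgue" shows "piece d f I x t I' x' t' i \<in> borel_measurable lebesgue"
proof -
  have [measurable]: "good d f I' x' t' \<in> borel_measurable lebesgue" by (rule measurable_good[OF assms])
  have [measurable]: "(\<lambda>z. \<Sum>j. correction d f I x t I' x' t' i j z) \<in> borel_measurable lebesgue"
    by (intro borel_measurable_suminf measurable_correction)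
  show ?thesis unfolding piece_def[abs_def] by measurable
qed

lemma correction_location:
  assumes "whitney \<Omega> I x t" "whitney \<Omega>' I' x' t'" "\<Omega>' \<subseteq> \<Omega>" "correction d f I x t I' x' t' i j z \<noteq> 0"
  shows "i \<in> I" "z \<in> E (x i) (t i)" "j \<in> I'" "z \<in> E (x' j) (t' j)"
proof -
  note s = correction_support[OF assms(4)]
  show "i \<in> I" "j \<in> I'" using s by auto
  show "z \<in> E (x' j) (t' j)" using support_in_whitney_E s(3) by blast
  show "z \<in> E (x i) (t i)" using nested_whitney(2)[OF assms(1-3) s(1,2,4)] half_mem_E[OF s(3)] by blast
qed

text \<open>The corrections meeting a Whitney ellipsoid of the larger set live on ellipsoids contained in
  it, so a piece does not leave its Whitney ellipsoid.\<close>

lemma piece_support: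
  assumes "whitney \<Omega> I x t" "whitney \<Omega>' I' x' t'" "\<Omega>' \<subseteq> \<Omega>" "piece d f I x t I' x' t' i z \<noteq> 0"
  shows "i \<in> I" "z \<in> E (x i) (t i)"
proof -
  have "pou I x t i z \<noteq> 0 \<or> approx d f I x t i z \<noteq> 0 \<or> (\<exists>j. correction d f I x t I' x' t' i j z \<noteq> 0)"
  proof (rule ccontr)
    assume "\<not> ?thesis"
    then have "piece d f I x t I' x' t' i z = 0" by (simp add: piece_def)
    then show False using assms(4) by simp
  qed
  then have "i \<in> I \<and> z \<in> E (x i) (t i)"
    using pou_support(1,3)[of I x t i z] approx_support[of d f I x t i z] correction_location[OF assms(1-3), of d f i _ z]
      support_in_whitney_E[of "x i" "t i" z] support_sub_E by blast
  then show "i \<in> I" "z \<in> E (x i) (t i)" by auto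
qed

text \<open>The corrections cancel in the sum over \<open>i\<close>, because the partition functions of the larger set
  add up to one on the smaller set and the bad parts have vanishing moments.\<close>

lemma pieces_sum:
  assumes W: "whitney \<Omega> I x t" and W': "whitney \<Omega>' I' x' t'" and sub: "\<Omega>' \<subseteq> \<Omega>"
    and f: "locally_integrable f" "f \<in> borel_measurable lebesgue"
  shows "(\<lambda>i. piece d f I x t I' x' t' i z) sums (good d f I' x' t' z - good d f I x t z)"
proof (cases "z \<in> \<Omega>")
  case False
  then have "z \<notin> \<Omega>'" using sub by blast
  have "piece d f I x t I' x' t' i z = 0" for i
    using piece_support[OF W W' sub, of d f i z] whitney_simps(3)[OF W, of i] False by blast
  then show ?thesis using good_eq(2)[OF W False] good_eq(2)[OF W' \<open>z \<notin> \<Omega>'\<close>] by simp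
next
  case True
  define A where "A = {i\<in>I. z \<in> E (x i) (t i)}"
  define B where "B = {j\<in>I'. z \<in> E (x' j) (t' j)}"
  have fin: "finite A" "finite B" using W W' by (auto simp: A_def B_def whitney_def)
  let ?c = "\<lambda>i j. correction d f I x t I' x' t' i j z"
  have loc: "i \<in> A" "j \<in> B" if "?c i j \<noteq> 0" for i j
    using correction_location[OF W W' sub that] by (auto simp: A_def B_def)
  have inner: "(\<Sum>j. ?c i j) = (\<Sum>j\<in>B. ?c i j)" for i
    using loc by (intro suminf_finite fin) blast
  have zero: "(\<Sum>i\<in>A. ?c i j) = 0" if j: "j \<in> B" for j
  proof (cases "norm (chart (x' j) (t' j + J3) z) \<le> 1/2")
    case True
    have jI: "j \<in> I'" using j by (simp add: B_def)
    have supp: "norm (chart (x' j) (t' j + J3) v) \<le> 1/2" if "bad d f I' x' t' j v \<noteq> 0" for v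
      using bad_support(2)[OF that] .
    \<comment> \<open>A partition function that is nonzero somewhere on the \<open>j\<close>th ellipsoid belongs to a Whitney
      ellipsoid containing all of it, in particular \<open>z\<close>. So summing over \<open>A\<close> exhausts the
      partition of unity there.\<close>
    have one: "(\<Sum>i\<in>A. bad d f I' x' t' j v * pou I x t i v) = bad d f I' x' t' j v" for v
    proof (cases "bad d f I' x' t' j v = 0")
      case False
      have vS: "v \<in> E (x' j) (t' j + J3)" using half_mem_E[OF supp[OF False]] .
      then have v\<Omega>: "v \<in> \<Omega>" using whitney_simps(4)[OF W' jI] sub by blast
      have "pou I x t i v = 0" if "i \<notin> A" for i
      proof (rule ccontr)
        assume "pou I x t i v \<noteq> 0"
        note s = pou_support[OF this]
        have "E (x i) (t i + J3) \<inter> E (x' j) (t' j + J3) \<noteq> {}" using s(3) vS by blast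
        from nested_whitney(2)[OF W W' sub s(1) jI this] have "z \<in> E (x i) (t i)" using half_mem_E[OF True] by blast
        then show False using that s(1) by (simp add: A_def)
      qed
      then have "(\<lambda>i. pou I x t i v) sums (\<Sum>i\<in>A. pou I x t i v)" by (intro sums_finite fin) auto
      then have "(\<Sum>i\<in>A. pou I x t i v) = 1" using pou_sums[OF W, of v] v\<Omega> sums_unique2 by fastforce
      then show ?thesis by (simp flip: sum_distrib_left)
    qed simp
    have "(\<Sum>i\<in>A. ?c i j) = proj d (x' j) (t' j + J3) (\<lambda>v. \<Sum>i\<in>A. bad d f I' x' t' j v * pou I x t i v) z"
      unfolding correction_def
      by (rule proj_sum[symmetric]) (use fin supp integrable_bad[OF f] integrable_mult_pou' in auto)
    also have "\<dots> = proj d (x' j) (t' j + J3) (bad d f I' x' t' j) z" using one by simp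
    also have "\<dots> = 0"
    proof -
      have "(LINT v|lebesgue. bad d f I' x' t' j v * e (chart (x' j) (t' j + J3) v)) = 0" if "e \<in> basis d" for e
      proof -
        let ?N = "matrix_inv (M (x' j) (t' j + J3))"
        have "chart (x' j) (t' j + J3) v = ?N *v v + - (?N *v x' j)" for v
          by (simp add: chart_def matrix_vector_mult_diff_distrib)
        moreover have "(\<lambda>v. e (?N *v v + - (?N *v x' j))) \<in> polys d" using that basis(2) by (intro polys_affine) auto
        ultimately show ?thesis using bad_moment[OF f] by simp
      qed
      then show ?thesis by (simp add: proj_def)
    qed
    finally show ?thesis .
  next
    case False
    then have "?c i j = 0" for i using correction_support(3)[of d f I x t I' x' t' i j z] by blast
    then show ?thesis by simp
  qed
  have "(\<lambda>i. \<Sum>j. ?c i j) sums (\<Sum>i\<in>A. \<Sum>j. ?c i j)"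
    unfolding inner using loc by (intro sums_finite fin) (auto intro!: sum.neutral)
  also have "(\<Sum>i\<in>A. \<Sum>j. ?c i j) = (\<Sum>j\<in>B. \<Sum>i\<in>A. ?c i j)" unfolding inner by (rule sum.swap)
  also have "\<dots> = 0" using zero by simp
  finally have "(\<lambda>i. \<Sum>j. ?c i j) sums 0" .
  from sums_add[OF sums_diff[OF sums_mult[OF pou_sums[OF W], of "good d f I' x' t' z" z] good_eq(1)[OF W True]] this]
  show ?thesis using True by (simp add: piece_def)
qed

text \<open>Inserting \<open>f = good + \<Sum> bad\<close> for the smaller set rewrites the piece as the bad part of the
  larger set plus the sum over \<open>j\<close> of \<open>correction - bad * pou\<close>, and each of these terms has
  vanishing moments. Dominated convergence exchanges sum and integral.\<close>

lemma piece_moment: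
  assumes W: "whitney \<Omega> I x t" and W': "whitney \<Omega>' I' x' t'" and sub: "\<Omega>' \<subseteq> \<Omega>"
    and f: "locally_integrable f" "f \<in> borel_measurable lebesgue"
    and c: "0 \<le> c" "\<forall>v. v \<notin> \<Omega>' \<longrightarrow> maximal N f v \<le> ennreal c" and p: "p \<in> polys d"
  shows "(LINT z|lebesgue. piece d f I x t I' x' t' i z * p z) = 0"
proof -
  define Ka where "Ka = approx_const N d"
  define Kc where "Kc = correction_const N d"
  have Ka: "0 < Ka" "\<And>j z. \<bar>approx d f I' x' t' j z\<bar> \<le> Ka * c"
    unfolding Ka_def by (rule approx_const(1), rule approx_const(2)[OF W' c])
  have Kc: "0 < Kc" "\<And>i j z. \<bar>correction d f I x t I' x' t' i j z\<bar> \<le> Kc * c"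
    unfolding Kc_def by (rule correction_const(1), rule correction_const(2)[OF f W W' sub c])
  define u where "u = (\<lambda>j z. correction d f I x t I' x' t' i j z - bad d f I' x' t' j z * pou I x t i z)"
  have u_loc: "j \<in> I' \<and> z \<in> E (x' j) (t' j)" "i \<in> I \<and> z \<in> E (x i) (t i)" if "u j z \<noteq> 0" for j z
  proof -
    have "correction d f I x t I' x' t' i j z \<noteq> 0 \<or> (bad d f I' x' t' j z \<noteq> 0 \<and> pou I x t i z \<noteq> 0)"
      using that by (auto simp: u_def)
    then show "j \<in> I' \<and> z \<in> E (x' j) (t' j)" "i \<in> I \<and> z \<in> E (x i) (t i)"
      using correction_location[OF W W' sub, of d f i j z] bad_support[of d f I' x' t' j z] pou_support(1,3)[of I x t i z]
        support_in_whitney_E[of "x' j" "t' j" z] support_sub_E by blast+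
  qed
  have bad_bound: "\<bar>bad d f I' x' t' j z\<bar> \<le> \<bar>f z\<bar> + Ka * c" for j z
    unfolding bad_def using Ka(2)[of j z] pou_range[of I' x' t' j z]
    by (intro order.trans[OF abs_triangle_ineq4] add_mono) (auto simp: abs_mult intro!: mult_left_le)
  have u_bound: "\<bar>u j z\<bar> \<le> Kc * c + (\<bar>f z\<bar> + Ka * c)" for j z
  proof -
    from bad_bound[of j z] have "\<bar>bad d f I' x' t' j z * pou I x t i z\<bar> \<le> (\<bar>f z\<bar> + Ka * c) * 1"
      unfolding abs_mult using pou_range[of I x t i z] by (intro mult_mono) auto
    then have "\<bar>bad d f I' x' t' j z * pou I x t i z\<bar> \<le> \<bar>f z\<bar> + Ka * c" by simp
    with Kc(2) show ?thesis unfolding u_def by (intro order.trans[OF abs_triangle_ineq4] add_mono)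
  qed
  have bad_int: "integrable lebesgue (\<lambda>z. bad d f I' x' t' j z * pou I x t i z)" for j
    by (intro integrable_mult_pou' integrable_bad f)
  have bad_supp: "norm (chart (x' j) (t' j + J3) z) \<le> 1/2" if "bad d f I' x' t' j z * pou I x t i z \<noteq> 0" for j z
    using bad_support(2)[of d f I' x' t' j z] that by auto
  have up_int: "integrable lebesgue (\<lambda>z. u j z * p z)" and up_zero: "(LINT z|lebesgue. u j z * p z) = 0" for j
  proof -
    have 1: "integrable lebesgue (\<lambda>z. correction d f I x t I' x' t' i j z * p z)" unfolding correction_def
      by (rule integrable_poly_on_bounded[OF integrable_proj proj_support p])
    have 2: "integrable lebesgue (\<lambda>z. bad d f I' x' t' j z * pou I x t i z * p z)"
      by (rule integrable_poly_on_bounded[OF bad_int bad_supp p])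
    show "integrable lebesgue (\<lambda>z. u j z * p z)" using Bochner_Integration.integrable_diff[OF 1 2] by (simp add: u_def left_diff_distrib)
    show "(LINT z|lebesgue. u j z * p z) = 0"
      unfolding u_def left_diff_distrib using Bochner_Integration.integral_diff[OF 1 2] proj_moment[OF bad_int bad_supp p]
      by (simp add: correction_def)
  qed
  obtain Kp where Kp: "0 \<le> Kp" "\<And>z. z \<in> E (x i) (t i) \<Longrightarrow> \<bar>p z\<bar> \<le> Kp"
  proof -
    have "compact (closure (E (x i) (t i)))" using bounded_E by (simp add: compact_closure)
    then have "bounded (p ` closure (E (x i) (t i)))"
      by (intro compact_imp_bounded compact_continuous_image continuous_polys[OF p])
    then obtain K where "\<forall>z\<in>closure (E (x i) (t i)). norm (p z) \<le> K" by (auto simp: bounded_iff)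
    then have "\<bar>p z\<bar> \<le> \<bar>K\<bar>" if "z \<in> E (x i) (t i)" for z
      using that closure_subset[of "E (x i) (t i)"] by (metis abs_ge_self order_trans real_norm_def subsetD)
    then show ?thesis using that[of "\<bar>K\<bar>"] by simp
  qed
  have pm[measurable]: "p \<in> borel_measurable lebesgue"
    by (rule borel_measurable_lebesgue[OF borel_measurable_continuous_onI[OF continuous_polys[OF p]]])
  define w where "w = (\<lambda>z. indicator (E (x i) (t i)) z * ((overlap * (Kc * c + (\<bar>f z\<bar> + Ka * c))) * Kp))"
  have w_int: "integrable lebesgue w"
  proof (rule locally_integrable_bounded[OF f(1) bounded_E[of "x i" "t i"]])
    have [measurable]: "E (x i) (t i) \<in> sets lebesgue" using E_lmeasurable by auto
    show "E (x i) (t i) \<in> sets lebesgue" by measurable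
    show "w \<in> borel_measurable lebesgue" unfolding w_def using f(2) by measurable
    show "\<bar>w z\<bar> \<le> (overlap * Kp) * \<bar>f z\<bar> + overlap * (Kc * c + Ka * c) * Kp" if "z \<in> E (x i) (t i)" for z
    proof -
      have "0 \<le> (overlap * (Kc * c + (\<bar>f z\<bar> + Ka * c))) * Kp"
        using Kp(1) Ka(1) Kc(1) c(1) by (intro mult_nonneg_nonneg add_nonneg_nonneg) auto
      then have "\<bar>w z\<bar> = (overlap * (Kc * c + (\<bar>f z\<bar> + Ka * c))) * Kp" using that by (simp add: w_def)
      also have "\<dots> = (overlap * Kp) * \<bar>f z\<bar> + overlap * (Kc * c + Ka * c) * Kp"
        by (simp only: distrib_left distrib_right mult_ac add_ac)
      finally show ?thesis by simp
    qed
    show "w z = 0" if "z \<notin> E (x i) (t i)" for z using that by (simp add: w_def)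
    show "0 \<le> overlap * Kp" using Kp(1) by simp
    show "0 \<le> overlap * (Kc * c + Ka * c) * Kp"
      using Kp(1) Ka(1) Kc(1) c(1) by (intro mult_nonneg_nonneg add_nonneg_nonneg) auto
  qed
  have lim: "(\<lambda>m. (\<Sum>j<m. u j z) * p z) \<longlonglongrightarrow> suminf (\<lambda>j. u j z) * p z" for z
    by (intro tendsto_mult tendsto_const summable_LIMSEQ overlap_sum(4)[OF W', of "\<lambda>j. u j z" z, OF u_loc(1) u_bound])
  have um: "u j \<in> borel_measurable lebesgue" for j
    unfolding u_def using measurable_bad[OF f(2)] by (intro borel_measurable_diff borel_measurable_times measurable_correction) auto
  have int_lim: "(\<lambda>m. LINT z|lebesgue. (\<Sum>j<m. u j z) * p z) \<longlonglongrightarrow> (LINT z|lebesgue. suminf (\<lambda>j. u j z) * p z)"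
    and sp_int: "integrable lebesgue (\<lambda>z. suminf (\<lambda>j. u j z) * p z)"
  proof -
    have m1: "(\<lambda>z. suminf (\<lambda>j. u j z) * p z) \<in> borel_measurable lebesgue"
      by (intro borel_measurable_times borel_measurable_suminf um pm)
    have m2: "(\<lambda>z. (\<Sum>j<m. u j z) * p z) \<in> borel_measurable lebesgue" for m
      by (intro borel_measurable_times borel_measurable_sum um pm)
    have bnd: "AE z in lebesgue. norm ((\<Sum>j<m. u j z) * p z) \<le> w z" for m
    proof (rule AE_I2)
      fix z
      show "norm ((\<Sum>j<m. u j z) * p z) \<le> w z"
      proof (cases "z \<in> E (x i) (t i)")
        case True
        have "\<bar>\<Sum>j<m. u j z\<bar> \<le> overlap * (Kc * c + (\<bar>f z\<bar> + Ka * c))"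
          by (rule overlap_sum(2)[OF W', of "\<lambda>j. u j z" z, OF u_loc(1) u_bound])
        then have "\<bar>\<Sum>j<m. u j z\<bar> * \<bar>p z\<bar> \<le> (overlap * (Kc * c + (\<bar>f z\<bar> + Ka * c))) * Kp"
          using Kp(2)[OF True] by (rule mult_mono) (use Ka(1) Kc(1) c(1) in auto)
        then show ?thesis using True by (simp add: w_def abs_mult)
      next
        case False
        then have "u j z = 0" for j using u_loc(2) by blast
        then show ?thesis using False by (simp add: w_def)
      qed
    qed
    have l: "AE z in lebesgue. (\<lambda>m. (\<Sum>j<m. u j z) * p z) \<longlonglongrightarrow> suminf (\<lambda>j. u j z) * p z" using lim by simp
    show "(\<lambda>m. LINT z|lebesgue. (\<Sum>j<m. u j z) * p z) \<longlonglongrightarrow> (LINT z|lebesgue. suminf (\<lambda>j. u j z) * p z)"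
      by (rule integral_dominated_convergence[OF m1 m2 w_int l bnd])
    show "integrable lebesgue (\<lambda>z. suminf (\<lambda>j. u j z) * p z)"
      by (rule integrable_dominated_convergence[OF m1 m2 w_int l bnd])
  qed
  have "(LINT z|lebesgue. (\<Sum>j<m. u j z) * p z) = 0" for m
    using Bochner_Integration.integral_sum[of "{..<m}" lebesgue "\<lambda>j z. u j z * p z"] up_int up_zero
    by (simp add: sum_distrib_right)
  then have "(\<lambda>m. LINT z|lebesgue. (\<Sum>j<m. u j z) * p z) \<longlonglongrightarrow> 0" by simp
  from LIMSEQ_unique[OF int_lim this] have zero: "(LINT z|lebesgue. suminf (\<lambda>j. u j z) * p z) = 0" .
  \<comment> \<open>The decomposition of the piece that makes the vanishing moments visible.\<close>
  have "piece d f I x t I' x' t' i z = bad d f I x t i z + suminf (\<lambda>j. u j z)" for z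
  proof -
    have cs: "summable (\<lambda>j. correction d f I x t I' x' t' i j z)"
    proof (rule overlap_sum(4)[OF W', of _ z "Kc * c"])
      show "j \<in> I' \<and> z \<in> E (x' j) (t' j)" if "correction d f I x t I' x' t' i j z \<noteq> 0" for j
        using correction_location(3,4)[OF W W' sub that] by simp
    qed (rule Kc(2))
    have bs: "summable (\<lambda>j. bad d f I' x' t' j z)"
    proof (rule overlap_sum(4)[OF W', of _ z "\<bar>f z\<bar> + Ka * c"])
      show "j \<in> I' \<and> z \<in> E (x' j) (t' j)" if "bad d f I' x' t' j z \<noteq> 0" for j
        using bad_support[OF that] support_in_whitney_E[of "x' j" "t' j" z] by simp
    qed (rule bad_bound)
    have "suminf (\<lambda>j. u j z) = (\<Sum>j. correction d f I x t I' x' t' i j z) - (\<Sum>j. bad d f I' x' t' j z) * pou I x t i z"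
      unfolding u_def suminf_mult2[OF bs] by (rule suminf_diff[symmetric, OF cs summable_mult2[OF bs]])
    then show ?thesis by (simp add: piece_def bad_def good_def algebra_simps)
  qed
  then have "(LINT z|lebesgue. piece d f I x t I' x' t' i z * p z)
      = (LINT z|lebesgue. bad d f I x t i z * p z + suminf (\<lambda>j. u j z) * p z)" by (simp add: distrib_right)
  also have "\<dots> = (LINT z|lebesgue. bad d f I x t i z * p z) + (LINT z|lebesgue. suminf (\<lambda>j. u j z) * p z)"
    by (rule Bochner_Integration.integral_add[OF integrable_poly_on_bounded[OF integrable_bad[OF f] bad_support(2) p] sp_int])
  also have "\<dots> = 0" using bad_moment[OF f p] zero by simp
  finally show ?thesis .
qed

end

section \<open>Local integrability of \<open>L\<^sup>q\<close> functions\<close>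

text \<open>Splitting at height \<open>\<tau>\<close> bounds integrals of \<open>\<bar>f\<bar>\<close> over sets of finite measure by the \<open>L\<^sup>q\<close>
  norm, with a free parameter to be optimised.\<close>

lemma abs_le_powr_split:
  fixes a :: real
  assumes "1 < q" "0 < \<tau>" shows "\<bar>a\<bar> \<le> \<tau> + \<tau> powr (1 - q) * \<bar>a\<bar> powr q"
proof (cases "\<bar>a\<bar> \<le> \<tau>")
  case True then show ?thesis by (intro add_increasing2) auto
next
  case False
  then have "\<bar>a\<bar> = \<bar>a\<bar> powr (1 - q) * \<bar>a\<bar> powr q" using assms by (simp flip: powr_add)
  also have "\<dots> \<le> \<tau> powr (1 - q) * \<bar>a\<bar> powr q"
    using False assms by (intro mult_right_mono powr_mono2') auto
  finally show ?thesis using assms by simp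
qed

lemma Lp_spaceD:
  assumes "f \<in> Lp_space q"
  shows "f \<in> borel_measurable lebesgue" "integrable lebesgue (\<lambda>x. norm (f x) powr q)"
  using assms by (auto simp: Lp_space_def)

lemma Lq_integral_bound:
  fixes f :: "real^'n \<Rightarrow> real"
  assumes "f \<in> Lp_space q" "1 < q" "S \<in> lmeasurable"
  shows "integrable lebesgue (\<lambda>z. indicator S z * \<bar>f z\<bar>)"
    and "0 < \<tau> \<Longrightarrow> (LINT z|lebesgue. indicator S z * \<bar>f z\<bar>) \<le> \<tau> * measure lebesgue S
          + \<tau> powr (1 - q) * (LINT z|lebesgue. indicator S z * \<bar>f z\<bar> powr q)"
proof -
  have [measurable]: "f \<in> borel_measurable lebesgue" "S \<in> sets lebesgue" using Lp_spaceD[OF assms(1)] assms(3) by auto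
  have iS: "integrable lebesgue (\<lambda>z. indicator S z * c)" for c :: real
    using assms(3) by (intro integrable_mult_left integrable_real_indicator) (auto simp: fmeasurable_def)
  have "integrable lebesgue (\<lambda>z. \<bar>f z\<bar> powr q)" using Lp_spaceD(2)[OF assms(1)] by simp
  from integrable_mult_indicator[OF \<open>S \<in> sets lebesgue\<close> this]
  have iq: "integrable lebesgue (\<lambda>z. indicator S z * \<bar>f z\<bar> powr q)" by simp
  have i\<tau>: "integrable lebesgue (\<lambda>z. indicator S z * \<tau> + \<tau> powr (1 - q) * (indicator S z * \<bar>f z\<bar> powr q))" for \<tau>
    using iq iS by (intro Bochner_Integration.integrable_add integrable_mult_right) auto
  have le: "indicator S z * \<bar>f z\<bar> \<le> indicator S z * \<tau> + \<tau> powr (1 - q) * (indicator S z * \<bar>f z\<bar> powr q)" if "0 < \<tau>" for \<tau> z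
    using abs_le_powr_split[OF assms(2) that, of "f z"] by (simp add: indicator_def)
  show i: "integrable lebesgue (\<lambda>z. indicator S z * \<bar>f z\<bar>)"
    by (rule Bochner_Integration.integrable_bound[OF i\<tau>[of 1]]) (use le[of 1] in \<open>auto intro!: AE_I2 simp: indicator_def\<close>)
  show "(LINT z|lebesgue. indicator S z * \<bar>f z\<bar>) \<le> \<tau> * measure lebesgue S
          + \<tau> powr (1 - q) * (LINT z|lebesgue. indicator S z * \<bar>f z\<bar> powr q)" if "0 < \<tau>"
  proof -
    have "(LINT z|lebesgue. indicator S z * \<bar>f z\<bar>) \<le> (LINT z|lebesgue. indicator S z * \<tau> + \<tau> powr (1 - q) * (indicator S z * \<bar>f z\<bar> powr q))"
      by (rule integral_mono[OF i i\<tau>]) (rule le[OF that])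
    also have "\<dots> = \<tau> * measure lebesgue S + \<tau> powr (1 - q) * (LINT z|lebesgue. indicator S z * \<bar>f z\<bar> powr q)"
      using iS iq assms(3) by (subst Bochner_Integration.integral_add) (auto simp: mult.commute)
    finally show ?thesis .
  qed
qed

lemma Lq_locally_integrable:
  fixes f :: "real^'n \<Rightarrow> real"
  assumes "f \<in> Lp_space q" "1 < q"
  shows "locally_integrable f"
  unfolding locally_integrable_def
proof
  fix r :: real
  have [measurable]: "f \<in> borel_measurable lebesgue" using Lp_spaceD[OF assms(1)] by auto
  have [measurable]: "cball 0 r \<in> sets (lebesgue :: (real^'n) measure)" by (rule fmeasurableD[OF lmeasurable_cball])
  show "integrable lebesgue (\<lambda>z. indicator (cball 0 r) z *\<^sub>R f z)"
    by (rule Bochner_Integration.integrable_bound[OF Lq_integral_bound(1)[OF assms lmeasurable_cball, of 0 r]])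
      (auto intro!: AE_I2 simp: abs_mult)
qed

context ellipsoid_cover begin

section \<open>A pointwise bound by the maximal function\<close>

lemma whitney_integral_sum:
  assumes W: "whitney \<Omega> I x t" and v: "integrable lebesgue (\<lambda>z. indicator \<Omega> z * v z)" "\<And>z. 0 \<le> (v z :: real)"
    and F: "finite F" "F \<subseteq> I"
  shows "(\<Sum>i\<in>F. LINT z|lebesgue. indicator (E (x i) (t i)) z * v z) \<le> real overlap * (LINT z|lebesgue. indicator \<Omega> z * v z)"
    and "i \<in> I \<Longrightarrow> integrable lebesgue (\<lambda>z. indicator (E (x i) (t i)) z * v z)"
proof -
  show int: "integrable lebesgue (\<lambda>z. indicator (E (x i) (t i)) z * v z)" if "i \<in> I" for i
  proof -
    have "E (x i) (t i) \<in> sets lebesgue" using E_lmeasurable by auto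
    from integrable_mult_indicator[OF this v(1)]
    have "integrable lebesgue (\<lambda>z. indicator (E (x i) (t i)) z * (indicator \<Omega> z * v z))" by simp
    moreover have "indicator (E (x i) (t i)) z * (indicator \<Omega> z * v z) = indicator (E (x i) (t i)) z * v z" for z
      using whitney_simps(3)[OF W that] by (auto simp: indicator_def)
    ultimately show ?thesis by simp
  qed
  have "(\<Sum>i\<in>F. LINT z|lebesgue. indicator (E (x i) (t i)) z * v z) = (LINT z|lebesgue. (\<Sum>i\<in>F. indicator (E (x i) (t i)) z * v z))"
    by (rule Bochner_Integration.integral_sum[symmetric]) (use int F in auto)
  also have "\<dots> \<le> (LINT z|lebesgue. real overlap * (indicator \<Omega> z * v z))"
  proof (rule integral_mono)
    show "integrable lebesgue (\<lambda>z. \<Sum>i\<in>F. indicator (E (x i) (t i)) z * v z)"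
      by (rule Bochner_Integration.integrable_sum) (use int F in auto)
    show "integrable lebesgue (\<lambda>z. real overlap * (indicator \<Omega> z * v z))" by (intro integrable_mult_right v(1))
    fix z
    let ?u = "\<lambda>i. if i \<in> I then indicator (E (x i) (t i)) z else (0::real)"
    have loc: "i \<in> I \<and> z \<in> E (x i) (t i)" if "?u i \<noteq> 0" for i using that by (auto simp: indicator_def split: if_splits)
    have b: "\<bar>?u i\<bar> \<le> 1" for i by (auto simp: indicator_def)
    have eq: "(\<Sum>i\<in>F. indicator (E (x i) (t i)) z * v z) = (\<Sum>i\<in>F. ?u i) * v z"
      unfolding sum_distrib_right using F by (intro sum.cong) auto
    show "(\<Sum>i\<in>F. indicator (E (x i) (t i)) z * v z) \<le> real overlap * (indicator \<Omega> z * v z)"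
    proof (cases "z \<in> \<Omega>")
      case True
      have "(\<Sum>i\<in>F. ?u i) \<le> real overlap" using overlap_sum(2)[OF W, of ?u z 1 F, OF loc b] by simp
      from mult_right_mono[OF this v(2)] show ?thesis unfolding eq using True by simp
    next
      case False
      then have "?u i = 0" for i using overlap_sum(6)[OF W, of ?u z 1 i, OF loc b] by simp
      then show ?thesis unfolding eq using False by simp
    qed
  qed
  also have "\<dots> = real overlap * (LINT z|lebesgue. indicator \<Omega> z * v z)" by simp
  finally show "(\<Sum>i\<in>F. LINT z|lebesgue. indicator (E (x i) (t i)) z * v z) \<le> real overlap * (LINT z|lebesgue. indicator \<Omega> z * v z)" .
qed

lemma whitney_measure_sum:
  assumes W: "whitney \<Omega> I x t" and "\<Omega> \<in> lmeasurable" "finite F" "F \<subseteq> I"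
  shows "(\<Sum>i\<in>F. measure lebesgue (E (x i) (t i))) \<le> real overlap * measure lebesgue \<Omega>"
proof -
  have "integrable lebesgue (\<lambda>z. indicator \<Omega> z * 1 :: real)"
    unfolding mult_1_right using assms(2) by (intro integrable_real_indicator) (auto simp: fmeasurable_def)
  from whitney_integral_sum(1)[OF W this _ assms(3,4)] show ?thesis by simp
qed

lemma maximal_uminus: "maximal N (\<lambda>z. - f z) = maximal N f"
  by (simp add: maximal_def fun_eq_iff)

lemma closed_maximal_sublevel: "closed {z. maximal N f z \<le> c}"
proof -
  have "{z. maximal N f z \<le> c} = - {z. c < maximal N f z}" by auto
  then show ?thesis using open_maximal_superlevel by (simp add: closed_Compl)
qed

text \<open>Each partition function whose support touches the set where the maximal function is at most
  \<open>c\<close> contributes at most a multiple of \<open>c\<close> times the volume of its ellipsoid; bounded overlap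
  sums the volumes.\<close>

lemma sum_pou_integral_bound:
  "\<exists>K>0. \<forall>f \<Omega> I x t c F. locally_integrable f \<longrightarrow> f \<in> borel_measurable lebesgue \<longrightarrow> whitney \<Omega> I x t \<longrightarrow>
     \<Omega> \<in> lmeasurable \<longrightarrow> 0 \<le> c \<longrightarrow> finite F \<longrightarrow> F \<subseteq> I \<longrightarrow>
     (\<forall>i\<in>F. \<exists>v\<in>E (x i) (t i + J3). maximal N f v \<le> ennreal c) \<longrightarrow>
     (LINT z|lebesgue. f z * (\<Sum>i\<in>F. pou I x t i z)) \<le> K * c * measure lebesgue \<Omega>"
proof -
  obtain Ku where Ku: "0 < Ku" "\<And>\<Omega> I x t i. whitney \<Omega> I x t \<Longrightarrow> i \<in> I \<Longrightarrow>
     bounded_derivs N Ku UNIV (\<lambda>w. pou I x t i (M (x i) (t i + J3) *v w + x i))" using pou_bounded_derivs[of N] by blast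
  define K where "K = Ku / a1 * overlap + 1"
  have K: "0 < K" using Ku pos by (simp add: K_def add_nonneg_pos)
  have key: "(LINT z|lebesgue. f z * (\<Sum>i\<in>F. pou I x t i z)) \<le> K * c * measure lebesgue \<Omega>"
    if f: "locally_integrable f" "f \<in> borel_measurable lebesgue" and W: "whitney \<Omega> I x t"
      and \<Omega>: "\<Omega> \<in> lmeasurable" and c: "0 \<le> c" and F: "finite F" "F \<subseteq> I"
      and good: "\<forall>i\<in>F. \<exists>v\<in>E (x i) (t i + J3). maximal N f v \<le> ennreal c" for f \<Omega> I x t c F
  proof -
    have "(LINT z|lebesgue. f z * (\<Sum>i\<in>F. pou I x t i z)) = (\<Sum>i\<in>F. LINT z|lebesgue. f z * pou I x t i z)"
      unfolding sum_distrib_left by (subst Bochner_Integration.integral_sum) (use integrable_mult_pou[OF f] in auto)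
    also have "\<dots> \<le> (\<Sum>i\<in>F. (Ku / a1 * c) * measure lebesgue (E (x i) (t i)))"
    proof (rule sum_mono)
      fix i assume "i \<in> F"
      then have i: "i \<in> I" using F by blast
      obtain v where v: "v \<in> E (x i) (t i + J3)" "maximal N f v \<le> ennreal c" using good \<open>i \<in> F\<close> by blast
      let ?\<phi> = "\<lambda>w. pou I x t i (M (x i) (t i + J3) *v w + x i)"
      have "\<bar>LINT z|lebesgue. f z * ?\<phi> (chart (x i) (t i + J3) z)\<bar> \<le> Ku * c * 2 powr (- (t i + J3))"
      proof (rule maximal_test_bound[OF v c _ Ku(2)[OF W i] Ku(1)])
        show "\<exists>K. bounded_derivs m K UNIV ?\<phi>" for m using pou_bounded_derivs[of m] W i by blast
        show "?\<phi> w = 0" if "1 \<le> norm w" for w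
          using pou_support(2)[of I x t i "M (x i) (t i + J3) *v w + x i"] that by (auto simp: chart_M)
      qed
      then have "(LINT z|lebesgue. f z * pou I x t i z) \<le> Ku * c * 2 powr (- (t i + J3))" by (simp add: M_chart)
      also have "\<dots> \<le> Ku * c * 2 powr (- t i)" using J3_ge(4) Ku c by (intro mult_left_mono powr_mono) auto
      also have "\<dots> = (Ku / a1 * c) * (a1 * 2 powr (- t i))" using pos by simp
      also have "\<dots> \<le> (Ku / a1 * c) * measure lebesgue (E (x i) (t i))"
        using Ku c pos by (intro mult_left_mono measure_E) auto
      finally show "(LINT z|lebesgue. f z * pou I x t i z) \<le> (Ku / a1 * c) * measure lebesgue (E (x i) (t i))" .
    qed
    also have "\<dots> = (Ku / a1 * c) * (\<Sum>i\<in>F. measure lebesgue (E (x i) (t i)))" by (simp add: sum_distrib_left)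
    also have "\<dots> \<le> (Ku / a1 * c) * (overlap * measure lebesgue \<Omega>)"
      using Ku c pos by (intro mult_left_mono whitney_measure_sum[OF W \<Omega> F]) auto
    also have "\<dots> = (Ku / a1 * overlap) * (c * measure lebesgue \<Omega>)" by simp
    also have "\<dots> \<le> K * (c * measure lebesgue \<Omega>)" unfolding K_def using c by (intro mult_right_mono) auto
    finally show ?thesis by (simp add: mult.assoc)
  qed
  show ?thesis
  proof (intro exI[of _ K] conjI allI impI)
    show "0 < K" by (rule K)
  qed (rule key)
qed

text \<open>If \<open>f\<close> exceeded a large multiple of \<open>c\<close> on a set \<open>A\<close> of positive measure where the maximal
  function is at most \<open>c\<close>, testing \<open>f\<close> against the Whitney partition of a thin neighbourhood of
  \<open>A\<close> would give a contradiction.\<close>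

lemma AE_le_of_maximal:
  assumes q: "1 < q"
  shows "\<exists>K>0. \<forall>f c. f \<in> Lp_space q \<longrightarrow> 0 \<le> c \<longrightarrow>
     (AE z in lebesgue. maximal N f z \<le> ennreal c \<longrightarrow> \<bar>f z\<bar> \<le> K * c)"
proof -
  obtain K where K0: "0 < K" and K: "\<forall>f \<Omega> I x t c F. locally_integrable f \<longrightarrow> f \<in> borel_measurable lebesgue \<longrightarrow> whitney \<Omega> I x t \<longrightarrow>
     \<Omega> \<in> lmeasurable \<longrightarrow> 0 \<le> c \<longrightarrow> finite F \<longrightarrow> F \<subseteq> I \<longrightarrow>
     (\<forall>i\<in>F. \<exists>v\<in>E (x i) (t i + J3). maximal N f v \<le> ennreal c) \<longrightarrow>
     (LINT z|lebesgue. f z * (\<Sum>i\<in>F. pou I x t i z)) \<le> K * c * measure lebesgue \<Omega>"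
    using sum_pou_integral_bound[of N] by (elim exE conjE) (rule that)
  have one: "AE z in lebesgue. maximal N f z \<le> ennreal c \<longrightarrow> f z \<le> K * c"
    if fq: "f \<in> Lp_space q" and c: "0 \<le> c" for f :: "real^'n \<Rightarrow> real" and c
  proof -
    have fm[measurable]: "f \<in> borel_measurable lebesgue" using Lp_spaceD(1)[OF fq] .
    have loc: "locally_integrable f" by (rule Lq_locally_integrable[OF fq q])
    have "AE z in lebesgue. z \<in> cball 0 (real n) \<longrightarrow> maximal N f z \<le> ennreal c \<longrightarrow> f z \<le> K * c" for n :: nat
    proof -
      define A where "A = {z. maximal N f z \<le> ennreal c} \<inter> cball 0 (real n) \<inter> {z \<in> space lebesgue. K * c < f z}"
      have "{z. maximal N f z \<le> ennreal c} \<in> sets lebesgue"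
        using closed_maximal_sublevel[of N f "ennreal c"] by (intro sets_completionI_sets) (simp add: borel_closed)
      moreover have "cball 0 (real n) \<in> sets (lebesgue :: (real^'n) measure)" by (rule fmeasurableD[OF lmeasurable_cball])
      moreover have "{z \<in> space lebesgue. K * c < f z} \<in> sets lebesgue" by measurable
      ultimately have Am[measurable]: "A \<in> sets lebesgue" unfolding A_def by (intro sets.Int)
      have Al: "A \<in> lmeasurable"
      proof (rule bounded_set_imp_lmeasurable[OF _ Am])
        show "bounded A" unfolding A_def by (rule bounded_subset[OF bounded_cball[of 0 "real n"]]) auto
      qed
      have fA: "integrable lebesgue (\<lambda>z. indicator A z * f z)"
        by (rule Bochner_Integration.integrable_bound[OF Lq_integral_bound(1)[OF fq q Al]]) (auto simp: indicator_def)
      define Q where "Q = (LINT z|lebesgue. \<bar>f z\<bar> powr q)"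
      \<comment> \<open>The set \<open>U\<close> below is a thin open neighbourhood of \<open>A\<close>, and \<open>\<Phi>\<close> adds up those functions
        of its partition of unity whose support meets \<open>A\<close>. They sum to one on \<open>A\<close>, and the
        excess \<open>U - A\<close> has measure at most \<open>\<delta>\<close>.\<close>
      have step: "(LINT z|lebesgue. indicator A z * f z) \<le> K * c * (measure lebesgue A + \<delta>) + \<tau> * \<delta> + \<tau> powr (1 - q) * Q"
        if \<delta>: "0 < \<delta>" and \<tau>: "0 < \<tau>" for \<delta> \<tau>
      proof -
        obtain U where U: "open U" "A \<subseteq> U" "U - A \<in> lmeasurable" "emeasure lebesgue (U - A) < ennreal \<delta>"
          by (rule sets_lebesgue_outer_open[OF Am \<delta>])
        have Ul: "U \<in> lmeasurable"
        proof -
          have "U = A \<union> (U - A)" using U by blast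
          then show ?thesis using fmeasurable.Un[OF Al U(3)] by simp
        qed
        have mUA: "measure lebesgue (U - A) \<le> \<delta>"
          using U(3,4) \<delta> by (simp add: emeasure_eq_measure2 ennreal_less_iff)
        have mU: "measure lebesgue U \<le> measure lebesgue A + \<delta>"
          using measurable_measure_Diff[OF Ul Am U(2)] mUA by simp
        obtain I x t where W: "whitney U I x t"
          using whitney_exists[OF U(1)] Ul by (auto simp: fmeasurable_def)
        define F where "F = {i\<in>I. E (x i) (t i + J3) \<inter> A \<noteq> {}}"
        define \<Phi> where "\<Phi> = (\<lambda>m z. \<Sum>i\<in>F \<inter> {..<m}. pou I x t i z)"
        have \<Phi>_range: "0 \<le> \<Phi> m z" "\<Phi> m z \<le> 1" "z \<notin> U \<Longrightarrow> \<Phi> m z = 0" for m z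
        proof -
          show "0 \<le> \<Phi> m z" unfolding \<Phi>_def by (intro sum_nonneg pou_range)
          have le: "\<Phi> m z \<le> indicator U z"
            unfolding \<Phi>_def using pou_sums[OF W, of z] pou_range
            by (subst sums_unique[OF pou_sums[OF W]]) (intro sum_le_suminf sums_summable[OF pou_sums[OF W]]; auto)
          then show "\<Phi> m z \<le> 1" by (rule order_trans) (simp add: indicator_def)
          show "\<Phi> m z = 0" if "z \<notin> U" using le \<open>0 \<le> \<Phi> m z\<close> that by simp
        qed
        have \<Phi>m[measurable]: "\<Phi> m \<in> borel_measurable lebesgue" for m unfolding \<Phi>_def by measurable
        have int1: "integrable lebesgue (\<lambda>z. f z * \<Phi> m z)" for m
          unfolding \<Phi>_def sum_distrib_left by (intro Bochner_Integration.integrable_sum integrable_mult_pou[OF loc fm])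
        have int2: "integrable lebesgue (\<lambda>z. indicator A z * f z * \<Phi> m z)" for m
          by (rule Bochner_Integration.integrable_bound[OF fA]) (use \<Phi>_range in \<open>auto simp: abs_mult mult_left_le\<close>)
        have UA_int: "integrable lebesgue (\<lambda>z. indicator (U - A) z * \<bar>f z\<bar>)" by (rule Lq_integral_bound(1)[OF fq q U(3)])
        have "(LINT z|lebesgue. indicator A z * f z * \<Phi> m z) \<le> K * c * measure lebesgue U + (LINT z|lebesgue. indicator (U - A) z * \<bar>f z\<bar>)" for m
        proof -
          have "(LINT z|lebesgue. indicator A z * f z * \<Phi> m z) \<le> (LINT z|lebesgue. f z * \<Phi> m z + indicator (U - A) z * \<bar>f z\<bar>)"
          proof (rule integral_mono[OF int2 Bochner_Integration.integrable_add[OF int1 UA_int]])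
            fix z
            have "\<bar>f z * \<Phi> m z\<bar> \<le> \<bar>f z\<bar>" using \<Phi>_range(1,2)[where z=z and m=m] by (simp add: abs_mult mult_left_le)
            then show "indicator A z * f z * \<Phi> m z \<le> f z * \<Phi> m z + indicator (U - A) z * \<bar>f z\<bar>"
              using \<Phi>_range(3)[where z=z and m=m] by (cases "z \<in> A"; cases "z \<in> U") auto
          qed
          also have "\<dots> = (LINT z|lebesgue. f z * \<Phi> m z) + (LINT z|lebesgue. indicator (U - A) z * \<bar>f z\<bar>)"
            by (rule Bochner_Integration.integral_add[OF int1 UA_int])
          also have "(LINT z|lebesgue. f z * \<Phi> m z) \<le> K * c * measure lebesgue U"
            unfolding \<Phi>_def
          proof (rule K[rule_format, OF loc fm W Ul c])
            fix i assume "i \<in> F \<inter> {..<m}"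
            then obtain v where "v \<in> E (x i) (t i + J3)" "v \<in> A" unfolding F_def by blast
            then show "\<exists>v\<in>E (x i) (t i + J3). maximal N f v \<le> ennreal c" unfolding A_def by blast
          qed (auto simp: F_def)
          finally show ?thesis by simp
        qed
        moreover have "(\<lambda>m. LINT z|lebesgue. indicator A z * f z * \<Phi> m z) \<longlonglongrightarrow> (LINT z|lebesgue. indicator A z * f z)"
        proof (rule integral_dominated_convergence[where w="\<lambda>z. \<bar>indicator A z * f z\<bar>"])
          show "AE z in lebesgue. (\<lambda>m. indicator A z * f z * \<Phi> m z) \<longlonglongrightarrow> indicator A z * f z"
          proof (rule AE_I2)
            fix z
            show "(\<lambda>m. indicator A z * f z * \<Phi> m z) \<longlonglongrightarrow> indicator A z * f z"
            proof (cases "z \<in> A")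
              case True
              have "\<Phi> m z = (\<Sum>i<m. pou I x t i z)" for m
                unfolding \<Phi>_def
              proof (rule sum.mono_neutral_left)
                show "\<forall>i\<in>{..<m} - F \<inter> {..<m}. pou I x t i z = 0"
                  using pou_support(1,3)[of I x t _ z] True unfolding F_def by blast
              qed auto
              then have "(\<lambda>m. \<Phi> m z) \<longlonglongrightarrow> 1" using pou_sums[OF W, of z] True U(2) by (auto simp: sums_def)
              from tendsto_mult[OF tendsto_const this, of "indicator A z * f z"] show ?thesis by simp
            qed simp
          qed
          show "AE z in lebesgue. norm (indicator A z * f z * \<Phi> m z) \<le> \<bar>indicator A z * f z\<bar>" for m
            using \<Phi>_range by (intro AE_I2) (simp add: abs_mult mult_left_le)
        qed (use fA in \<open>auto intro: borel_measurable_integrable int2\<close>)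
        ultimately have "(LINT z|lebesgue. indicator A z * f z) \<le> K * c * measure lebesgue U + (LINT z|lebesgue. indicator (U - A) z * \<bar>f z\<bar>)"
          by (intro LIMSEQ_le_const2) auto
        also have "K * c * measure lebesgue U \<le> K * c * (measure lebesgue A + \<delta>)"
          using mU K0 c by (intro mult_left_mono) auto
        also have "(LINT z|lebesgue. indicator (U - A) z * \<bar>f z\<bar>) \<le> \<tau> * measure lebesgue (U - A)
          + \<tau> powr (1 - q) * (LINT z|lebesgue. indicator (U - A) z * \<bar>f z\<bar> powr q)"
          by (rule Lq_integral_bound(2)[OF fq q U(3) \<tau>])
        also have "\<tau> * measure lebesgue (U - A) \<le> \<tau> * \<delta>" using mUA \<tau> by (intro mult_left_mono) auto
        also have "(LINT z|lebesgue. indicator (U - A) z * \<bar>f z\<bar> powr q) \<le> Q"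
          unfolding Q_def
        proof (rule integral_mono)
          have iq: "integrable lebesgue (\<lambda>z. \<bar>f z\<bar> powr q)" using Lp_spaceD(2)[OF fq] by simp
          then show "integrable lebesgue (\<lambda>z. \<bar>f z\<bar> powr q)" .
          show "integrable lebesgue (\<lambda>z. indicator (U - A) z * \<bar>f z\<bar> powr q)"
            using integrable_mult_indicator[OF _ iq, of "U - A"] U(3) by auto
        qed (auto simp: indicator_def)
        finally show ?thesis using \<tau> by (simp add: mult_left_mono)
      qed
      have "(LINT z|lebesgue. indicator A z * f z) \<le> K * c * measure lebesgue A"
      proof (rule field_le_epsilon)
        fix e :: real assume e: "0 < e"
        have Q0: "0 \<le> Q" unfolding Q_def by simp
        have "((\<lambda>\<tau>. \<tau> powr (1 - q) * Q) \<longlongrightarrow> 0 * Q) at_top"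
          using q by (intro tendsto_mult tendsto_const tendsto_neg_powr filterlim_ident) auto
        then have "\<forall>\<^sub>F \<tau> in at_top. \<tau> powr (1 - q) * Q < e / 2" using e by (intro order_tendstoD) auto
        then obtain \<tau> where \<tau>: "0 < \<tau>" "\<tau> powr (1 - q) * Q < e / 2"
          using eventually_conj[OF eventually_gt_at_top[of 0]] eventually_happens'[OF trivial_limit_at_top_linorder] by blast
        \<comment> \<open>First \<open>\<tau>\<close> is taken large to make the \<open>L\<^sup>q\<close> term small, then \<open>\<delta>\<close> small depending on
          \<open>\<tau>\<close>.\<close>
        define \<delta> where "\<delta> = (e / 2) / (K * c + \<tau>)"
        have Kc: "0 < K * c + \<tau>" using K0 c \<tau> by (simp add: add_nonneg_pos)
        have "0 < \<delta>" unfolding \<delta>_def using Kc e by simp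
        from step[OF this \<tau>(1)] have "(LINT z|lebesgue. indicator A z * f z) \<le> K * c * measure lebesgue A + (K * c + \<tau>) * \<delta> + \<tau> powr (1 - q) * Q"
          by (simp add: algebra_simps)
        also have "(K * c + \<tau>) * \<delta> = e / 2" unfolding \<delta>_def by (rule times_divide_eq_right[THEN trans, OF nonzero_mult_div_cancel_left[OF less_imp_neq[OF Kc, symmetric]]])
        finally show "(LINT z|lebesgue. indicator A z * f z) \<le> K * c * measure lebesgue A + e" using \<tau>(2) by linarith
      qed
      note fA_le = this
      have iA: "integrable lebesgue (\<lambda>z. indicator A z * (K * c))"
        using Al by (intro integrable_mult_left integrable_real_indicator) (auto simp: fmeasurable_def)
      have "(LINT z|lebesgue. indicator A z * (K * c)) = K * c * measure lebesgue A"
        using Al by (simp add: fmeasurable_def)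
      with fA_le have le0: "(LINT z|lebesgue. indicator A z * f z - indicator A z * (K * c)) \<le> 0"
        unfolding Bochner_Integration.integral_diff[OF fA iA] by linarith
      have nn: "0 \<le> indicator A z * f z - indicator A z * (K * c)" for z
        by (auto simp: indicator_def A_def)
      have "(LINT z|lebesgue. indicator A z * f z - indicator A z * (K * c)) = 0"
        by (rule antisym[OF le0]) (intro integral_nonneg_AE AE_I2 nn)
      then have "AE z in lebesgue. indicator A z * f z - indicator A z * (K * c) = 0"
        using integral_nonneg_eq_0_iff_AE[OF Bochner_Integration.integrable_diff[OF fA iA]] nn by auto
      then show ?thesis
      proof eventually_elim
        case (elim z)
        show ?case
        proof (intro impI, rule ccontr)
          assume "z \<in> cball 0 (real n)" "maximal N f z \<le> ennreal c" "\<not> f z \<le> K * c"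
          then have "z \<in> A" by (simp add: A_def)
          then show False using elim \<open>\<not> f z \<le> K * c\<close> by simp
        qed
      qed
    qed
    then have "AE z in lebesgue. \<forall>n::nat. z \<in> cball 0 (real n) \<longrightarrow> maximal N f z \<le> ennreal c \<longrightarrow> f z \<le> K * c"
      by (subst AE_all_countable) blast
    then show ?thesis
    proof eventually_elim
      case (elim z)
      obtain n :: nat where "norm z \<le> real n" using real_arch_simple by blast
      then show ?case using elim by (metis mem_cball_0)
    qed
  qed
  have "AE z in lebesgue. maximal N f z \<le> ennreal c \<longrightarrow> \<bar>f z\<bar> \<le> K * c"
    if fq: "f \<in> Lp_space q" and c: "0 \<le> c" for f :: "real^'n \<Rightarrow> real" and c
  proof -
    have "(\<lambda>z. - f z) \<in> Lp_space q" using fq by (auto simp: Lp_space_def)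
    from one[OF this c] have "AE z in lebesgue. maximal N f z \<le> ennreal c \<longrightarrow> - f z \<le> K * c" unfolding maximal_uminus .
    with one[OF fq c] show ?thesis by eventually_elim auto
  qed
  then show ?thesis using K0 by blast
qed

end

section \<open>Convergence in \<open>L\<^sup>q\<close>\<close>

lemma norm_add_powr_le:
  fixes a b :: "'a::real_normed_vector"
  assumes "0 < q"
  shows "norm (a + b) powr q \<le> 2 powr q * (norm a powr q + norm b powr q)"
proof -
  have "norm (a + b) powr q \<le> (2 * max (norm a) (norm b)) powr q"
    using norm_triangle_ineq[of a b] assms by (intro powr_mono2) auto
  also have "\<dots> = 2 powr q * max (norm a) (norm b) powr q" by (simp add: powr_mult)
  also have "\<dots> \<le> 2 powr q * (norm a powr q + norm b powr q)"
    by (intro mult_left_mono) (auto simp: max_def)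
  finally show ?thesis .
qed

lemma Lp_space_bound:
  fixes u v :: "real^'n \<Rightarrow> 'b::{banach, second_countable_topology}"
  assumes "u \<in> borel_measurable lebesgue" "integrable lebesgue w" "AE z in lebesgue. norm (u z) powr q \<le> w z"
  shows "u \<in> Lp_space q" "(LINT z|lebesgue. norm (u z) powr q) \<le> (LINT z|lebesgue. w z)"
proof -
  have [measurable]: "u \<in> borel_measurable lebesgue" by fact
  have i: "integrable lebesgue (\<lambda>z. norm (u z) powr q)"
    by (rule Bochner_Integration.integrable_bound[OF assms(2)]) (use assms(3) in auto)
  then show "u \<in> Lp_space q" by (simp add: Lp_space_def)
  show "(LINT z|lebesgue. norm (u z) powr q) \<le> (LINT z|lebesgue. w z)"
    by (rule integral_mono_AE[OF i assms(2,3)])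
qed

lemma Lp_space_add:
  fixes u v :: "real^'n \<Rightarrow> 'b::{banach, second_countable_topology}"
  assumes "u \<in> Lp_space q" "v \<in> Lp_space q" "0 < q"
  shows "(\<lambda>z. u z + v z) \<in> Lp_space q"
    "(LINT z|lebesgue. norm (u z + v z) powr q) \<le> 2 powr q * ((LINT z|lebesgue. norm (u z) powr q) + (LINT z|lebesgue. norm (v z) powr q))"
proof -
  note u = Lp_spaceD[OF assms(1)] and v = Lp_spaceD[OF assms(2)]
  have w: "integrable lebesgue (\<lambda>z. 2 powr q * (norm (u z) powr q + norm (v z) powr q))" using u v by simp
  have m: "(\<lambda>z. u z + v z) \<in> borel_measurable lebesgue" using u v by simp
  have le: "AE z in lebesgue. norm (u z + v z) powr q \<le> 2 powr q * (norm (u z) powr q + norm (v z) powr q)"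
    using norm_add_powr_le[OF assms(3)] by (intro AE_I2)
  show "(\<lambda>z. u z + v z) \<in> Lp_space q" by (rule Lp_space_bound(1)[OF m w le])
  show "(LINT z|lebesgue. norm (u z + v z) powr q) \<le> 2 powr q * ((LINT z|lebesgue. norm (u z) powr q) + (LINT z|lebesgue. norm (v z) powr q))"
    using Lp_space_bound(2)[OF m w le] u(2) v(2) by simp
qed

lemma Lp_space_uminus: "u \<in> Lp_space q \<Longrightarrow> (\<lambda>z. - u z) \<in> Lp_space q"
  for u :: "real^'n \<Rightarrow> 'b::{banach, second_countable_topology}"
  by (simp add: Lp_space_def)

lemma Lp_space_diff:
  fixes u v :: "real^'n \<Rightarrow> 'b::{banach, second_countable_topology}"
  assumes "u \<in> Lp_space q" "v \<in> Lp_space q" "0 < q"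
  shows "(\<lambda>z. u z - v z) \<in> Lp_space q"
  using Lp_space_add(1)[OF assms(1) Lp_space_uminus[OF assms(2)] assms(3)] by simp

lemma Lp_tendsto_iff:
  fixes u :: "'i \<Rightarrow> real^'n \<Rightarrow> 'b::{banach, second_countable_topology}"
  assumes "0 < q"
  shows "Lp_tendsto q u g F \<longleftrightarrow> g \<in> Lp_space q \<and> (\<forall>\<^sub>F m in F. u m \<in> Lp_space q) \<and>
     ((\<lambda>m. LINT z|lebesgue. norm (u m z - g z) powr q) \<longlongrightarrow> 0) F"
proof -
  let ?J = "\<lambda>m. LINT z|lebesgue. norm (u m z - g z) powr q"
  have J: "0 \<le> ?J m" for m by simp
  have "((\<lambda>m. ?J m powr (1/q)) \<longlongrightarrow> 0) F \<longleftrightarrow> (?J \<longlongrightarrow> 0) F"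
  proof
    assume "(?J \<longlongrightarrow> 0) F"
    then show "((\<lambda>m. ?J m powr (1/q)) \<longlongrightarrow> 0) F" using assms J by (intro tendsto_zero_powrI[where b="1/q"]) auto
  next
    assume "((\<lambda>m. ?J m powr (1/q)) \<longlongrightarrow> 0) F"
    then have "((\<lambda>m. (?J m powr (1/q)) powr q) \<longlongrightarrow> 0) F"
      by (rule tendsto_zero_powrI[where b=q]) (use assms in auto)
    moreover have "(?J m powr (1/q)) powr q = ?J m" for m using assms J[of m] by (simp add: powr_powr)
    ultimately show "(?J \<longlongrightarrow> 0) F" by simp
  qed
  then show ?thesis by (simp add: Lp_tendsto_def Lp_norm_def)
qed

lemma Lp_tendsto_add:
  fixes u v :: "'i \<Rightarrow> real^'n \<Rightarrow> 'b::{banach, second_countable_topology}"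
  assumes "Lp_tendsto q u g F" "Lp_tendsto q v h F" "0 < q"
  shows "Lp_tendsto q (\<lambda>m z. u m z + v m z) (\<lambda>z. g z + h z) F"
proof -
  note u = assms(1)[unfolded Lp_tendsto_iff[OF assms(3)]] and v = assms(2)[unfolded Lp_tendsto_iff[OF assms(3)]]
  let ?J = "\<lambda>u g m. LINT z|lebesgue. norm (u m z - g z) powr q"
  have ev: "\<forall>\<^sub>F m in F. ?J (\<lambda>m z. u m z + v m z) (\<lambda>z. g z + h z) m \<le> 2 powr q * (?J u g m + ?J v h m)"
  proof -
    from u v have "\<forall>\<^sub>F m in F. u m \<in> Lp_space q \<and> v m \<in> Lp_space q" by (auto intro: eventually_conj)
    then show ?thesis
    proof eventually_elim
      case (elim m)
      have "(\<lambda>z. u m z - g z) \<in> Lp_space q" "(\<lambda>z. v m z - h z) \<in> Lp_space q"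
        using elim u v assms(3) by (auto intro: Lp_space_diff)
      from Lp_space_add(2)[OF this assms(3)] show ?case by (simp add: algebra_simps)
    qed
  qed
  have "((\<lambda>m. 2 powr q * (?J u g m + ?J v h m)) \<longlongrightarrow> 2 powr q * (0 + 0)) F"
    using u v by (intro tendsto_mult tendsto_add tendsto_const) auto
  then have lim: "((\<lambda>m. 2 powr q * (?J u g m + ?J v h m)) \<longlongrightarrow> 0) F" by simp
  have "(?J (\<lambda>m z. u m z + v m z) (\<lambda>z. g z + h z) \<longlongrightarrow> 0) F"
    by (rule tendsto_sandwich[OF _ ev tendsto_const lim]) simp
  moreover have "\<forall>\<^sub>F m in F. (\<lambda>z. u m z + v m z) \<in> Lp_space q"
    using eventually_conj[OF conjunct1[OF conjunct2[OF u]] conjunct1[OF conjunct2[OF v]]]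
    by eventually_elim (auto intro: Lp_space_add(1) assms(3))
  ultimately show ?thesis using u v by (auto simp: Lp_tendsto_iff[OF assms(3)] intro: Lp_space_add(1) assms(3))
qed

lemma Lp_tendsto_complex:
  fixes u :: "'i \<Rightarrow> real^'n \<Rightarrow> real"
  assumes "Lp_tendsto q u g F" "0 < q" "cmod c = 1"
  shows "Lp_tendsto q (\<lambda>m z. c * complex_of_real (u m z)) (\<lambda>z. c * complex_of_real (g z)) F"
proof -
  have sp: "(\<lambda>z. c * complex_of_real (v z)) \<in> Lp_space q" if "v \<in> Lp_space q" for v :: "real^'n \<Rightarrow> real"
    using that assms(3) by (auto simp: Lp_space_def norm_mult)
  have "norm (c * complex_of_real a - c * complex_of_real b) = norm (a - b)" for a b :: real
  proof -
    have "c * complex_of_real a - c * complex_of_real b = c * complex_of_real (a - b)" by (simp add: algebra_simps)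
    then show ?thesis by (simp only: norm_mult assms(3) norm_of_real mult_1_left real_norm_def)
  qed
  then show ?thesis using assms(1,2) sp by (auto simp: Lp_tendsto_iff elim: eventually_mono)
qed

lemma Lp_tendsto_compose:
  assumes "Lp_tendsto q u g F" "filterlim s F F'"
  shows "Lp_tendsto q (\<lambda>m. u (s m)) g F'"
  using assms filterlim_compose[of "\<lambda>m. Lp_norm q (\<lambda>x. u m x - g x)"] eventually_compose_filterlim[of "\<lambda>m. u m \<in> Lp_space q" F s F']
  unfolding Lp_tendsto_def by blast

lemma Lp_tendsto_dominated:
  fixes u :: "nat \<Rightarrow> real^'n \<Rightarrow> real"
  assumes q: "0 < q" and m: "\<And>r. u r \<in> borel_measurable lebesgue" "g \<in> borel_measurable lebesgue"
    and w: "integrable lebesgue (\<lambda>z. w z powr q)"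
    and lim: "\<And>z. (\<lambda>r. u r z) \<longlonglongrightarrow> g z" and bd: "AE z in lebesgue. \<forall>r. \<bar>u r z\<bar> \<le> w z"
  shows "Lp_tendsto q u g sequentially"
proof -
  note [measurable] = m
  have bdg: "AE z in lebesgue. \<bar>g z\<bar> \<le> w z"
    using bd
  proof eventually_elim
    case (elim z)
    then show ?case by (intro LIMSEQ_le_const2[OF tendsto_rabs[OF lim[of z]]]) auto
  qed
  have "g \<in> Lp_space q"
    by (rule Lp_space_bound(1)[OF m(2) w]) (use bdg q in \<open>auto elim!: eventually_mono intro!: powr_mono2\<close>)
  moreover have "u r \<in> Lp_space q" for r
    by (rule Lp_space_bound(1)[OF m(1) w]) (use bd q in \<open>auto elim!: eventually_mono intro!: powr_mono2\<close>)
  moreover have "(\<lambda>r. LINT z|lebesgue. norm (u r z - g z) powr q) \<longlonglongrightarrow> (LINT z|(lebesgue :: (real^'n) measure). 0)"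
  proof (rule integral_dominated_convergence[where w="\<lambda>z. 2 powr q * w z powr q"])
    show "integrable lebesgue (\<lambda>z. 2 powr q * w z powr q)" using w by simp
    show "AE z in lebesgue. (\<lambda>r. norm (u r z - g z) powr q) \<longlonglongrightarrow> 0"
    proof (rule AE_I2)
      fix z
      have "(\<lambda>r. norm (u r z - g z)) \<longlonglongrightarrow> 0" by (rule tendsto_norm_zero[OF LIM_zero[OF lim]])
      then show "(\<lambda>r. norm (u r z - g z) powr q) \<longlonglongrightarrow> 0" using q by (intro tendsto_zero_powrI[where b=q]) auto
    qed
    show "AE z in lebesgue. norm (norm (u r z - g z) powr q) \<le> 2 powr q * w z powr q" for r
      using bd bdg
    proof eventually_elim
      case (elim z)
      then have "\<bar>u r z\<bar> \<le> w z" "\<bar>g z\<bar> \<le> w z" by blast+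
      then have "norm (u r z - g z) \<le> 2 * w z" using abs_triangle_ineq4[of "u r z" "g z"] by simp
      then have "norm (u r z - g z) powr q \<le> (2 * w z) powr q" using q by (intro powr_mono2) auto
      also have "\<dots> = 2 powr q * w z powr q" using elim by (intro powr_mult)
      finally show ?case by simp
    qed
  qed measurable
  ultimately show ?thesis by (simp add: Lp_tendsto_iff[OF q])
qed

section \<open>Level sets of the maximal function\<close>

text \<open>The sum is a geometric series dominated by its largest term, which is less than \<open>x powr p\<close>.\<close>

lemma sum_dyadic_powers_le:
  fixes F :: "int set" and p x :: real
  assumes "finite F" "0 < p" "0 \<le> x"
  shows "(\<Sum>k\<in>{k\<in>F. 2 powr real_of_int k < x}. 2 powr (real_of_int k * p)) \<le> 1 / (1 - 2 powr (- p)) * x powr p"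
proof (cases "{k\<in>F. 2 powr real_of_int k < x} = {}")
  case True
  have "2 powr (- p) < 2 powr 0" using assms by (intro powr_less_mono) auto
  then show ?thesis unfolding True by simp
next
  case False
  define F' where "F' = {k\<in>F. 2 powr real_of_int k < x}"
  have F': "finite F'" "F' \<noteq> {}" using assms False by (auto simp: F'_def)
  define K where "K = Max F'"
  have K: "K \<in> F'" "\<And>k. k \<in> F' \<Longrightarrow> k \<le> K" using F' by (auto simp: K_def)
  define r where "r = 2 powr (- p)"
  have r: "0 \<le> r" "r < 1" using assms powr_less_mono[of "-p" 0 2] by (auto simp: r_def)
  have inj: "inj_on (\<lambda>k. nat (K - k)) F'"
  proof (rule inj_onI)
    fix k l assume kl: "k \<in> F'" "l \<in> F'" "nat (K - k) = nat (K - l)"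
    then show "k = l" using K(2)[OF kl(1)] K(2)[OF kl(2)] by arith
  qed
  have "(\<Sum>k\<in>F'. 2 powr (real_of_int k * p)) = (\<Sum>k\<in>F'. 2 powr (real_of_int K * p) * r ^ nat (K - k))"
  proof (rule sum.cong)
    fix k assume "k \<in> F'"
    then have "real (nat (K - k)) = real_of_int K - real_of_int k" using K(2)[of k] by simp
    then have "r ^ nat (K - k) = 2 powr (- p * (real_of_int K - real_of_int k))"
      unfolding r_def by (simp add: powr_powr flip: powr_realpow)
    then show "2 powr (real_of_int k * p) = 2 powr (real_of_int K * p) * r ^ nat (K - k)"
      by (simp add: algebra_simps flip: powr_add)
  qed simp
  also have "\<dots> = 2 powr (real_of_int K * p) * (\<Sum>j\<in>(\<lambda>k. nat (K - k)) ` F'. r ^ j)"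
    by (simp add: sum.reindex[OF inj] sum_distrib_left)
  also have "(\<Sum>j\<in>(\<lambda>k. nat (K - k)) ` F'. r ^ j) \<le> (\<Sum>j. r ^ j)"
    using r F' by (intro sum_le_suminf summable_geometric) auto
  also have "(\<Sum>j. r ^ j) = 1 / (1 - r)" using r by (intro suminf_geometric) auto
  also have "2 powr (real_of_int K * p) * (1 / (1 - r)) \<le> x powr p * (1 / (1 - r))"
  proof (rule mult_right_mono)
    have "(2 powr real_of_int K) powr p \<le> x powr p" using K(1) assms by (intro powr_mono2) (auto simp: F'_def)
    then show "2 powr (real_of_int K * p) \<le> x powr p" by (simp add: powr_powr)
  qed (use r in auto)
  finally show ?thesis using r by (simp add: F'_def r_def mult.commute)
qed

context ellipsoid_cover begin

definition level :: "nat \<Rightarrow> (real^'n \<Rightarrow> real) \<Rightarrow> int \<Rightarrow> (real^'n) set" where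
  "level N f k = {z. ennreal (2 powr real_of_int k) < maximal N f z}"

lemma level_open: "open (level N f k)"
  unfolding level_def by (rule open_maximal_superlevel)

lemma level_sets [measurable]: "level N f k \<in> sets lebesgue"
  using level_open borel_open by (intro sets_completionI_sets) auto

lemma level_outside: "z \<notin> level N f k \<Longrightarrow> maximal N f z \<le> ennreal (2 powr real_of_int k)"
  by (simp add: level_def)

lemma level_mono: "k \<le> k' \<Longrightarrow> level N f k' \<subseteq> level N f k"
  unfolding level_def by (auto elim!: le_less_trans[rotated] intro!: ennreal_leI powr_mono)

text \<open>The discrete layer cake formula: at each point, the heights below \<open>m\<close> contribute a multiple of
  the \<open>p\<close>th power of \<open>m\<close>.\<close>

lemma level_measure:
  assumes p: "0 < p" and m: "\<And>z. 0 \<le> m z" "integrable lebesgue (\<lambda>z. m z powr p)" "m \<in> borel_measurable lebesgue"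
    and le: "AE z in lebesgue. maximal N f z \<le> ennreal (m z)"
  shows "level N f k \<in> lmeasurable"
    and "finite F \<Longrightarrow> (\<Sum>k\<in>F. 2 powr (real_of_int k * p) * measure lebesgue (level N f k))
        \<le> 1 / (1 - 2 powr (- p)) * (LINT z|lebesgue. m z powr p)"
proof -
  have sub: "AE z in lebesgue. z \<in> level N f k \<longrightarrow> 2 powr real_of_int k < m z" for k
    using le
  proof eventually_elim
    case (elim z)
    show ?case
    proof
      assume "z \<in> level N f k"
      then have "ennreal (2 powr real_of_int k) < ennreal (m z)" using elim by (auto simp: level_def)
      then show "2 powr real_of_int k < m z" by (simp add: ennreal_less_iff)
    qed
  qed
  have int: "integrable lebesgue (\<lambda>z. indicator (level N f k) z :: real)" for k
  proof (rule Bochner_Integration.integrable_bound[OF integrable_mult_right[OF m(2), of "2 powr (- (real_of_int k * p))"]])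
    show "AE z in lebesgue. norm (indicator (level N f k) z :: real) \<le> norm (2 powr (- (real_of_int k * p)) * m z powr p)"
      using sub[of k]
    proof eventually_elim
      case (elim z)
      show ?case
      proof (cases "z \<in> level N f k")
        case True
        then have "(2 powr real_of_int k) powr p \<le> m z powr p" using elim p by (intro powr_mono2) auto
        then show ?thesis using True by (simp add: powr_powr powr_minus field_simps)
      qed simp
    qed
  qed simp
  show lm: "level N f k \<in> lmeasurable" for k
    using int[of k] by (simp add: lmeasurable_iff_integrable)
  assume F: "finite F"
  have "(\<Sum>k\<in>F. 2 powr (real_of_int k * p) * measure lebesgue (level N f k))
      = (LINT z|lebesgue. (\<Sum>k\<in>F. 2 powr (real_of_int k * p) * indicator (level N f k) z))"
    by (subst Bochner_Integration.integral_sum) (use int in auto)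
  also have "\<dots> \<le> (LINT z|lebesgue. 1 / (1 - 2 powr (- p)) * m z powr p)"
  proof (rule integral_mono_AE)
    show "integrable lebesgue (\<lambda>z. \<Sum>k\<in>F. 2 powr (real_of_int k * p) * indicator (level N f k) z)"
      by (intro Bochner_Integration.integrable_sum integrable_mult_right int)
    show "integrable lebesgue (\<lambda>z. 1 / (1 - 2 powr (- p)) * m z powr p)" by (intro integrable_mult_right m(2))
    have "AE z in lebesgue. \<forall>k\<in>F. z \<in> level N f k \<longrightarrow> 2 powr real_of_int k < m z"
      using F sub by (intro AE_finite_allI)
    then show "AE z in lebesgue. (\<Sum>k\<in>F. 2 powr (real_of_int k * p) * indicator (level N f k) z) \<le> 1 / (1 - 2 powr (- p)) * m z powr p"
    proof eventually_elim
      case (elim z)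
      have "(\<Sum>k\<in>F. 2 powr (real_of_int k * p) * indicator (level N f k) z)
          \<le> (\<Sum>k\<in>F. if 2 powr real_of_int k < m z then 2 powr (real_of_int k * p) else 0)"
        by (rule sum_mono) (use elim in \<open>auto simp: indicator_def\<close>)
      also have "\<dots> = (\<Sum>k\<in>{k\<in>F. 2 powr real_of_int k < m z}. 2 powr (real_of_int k * p))"
        using F by (rule sum.inter_filter[symmetric])
      also have "\<dots> \<le> 1 / (1 - 2 powr (- p)) * m z powr p" by (rule sum_dyadic_powers_le[OF F p m(1)])
      finally show ?case .
    qed
  qed
  also have "\<dots> = 1 / (1 - 2 powr (- p)) * (LINT z|lebesgue. m z powr p)" by simp
  finally show "(\<Sum>k\<in>F. 2 powr (real_of_int k * p) * measure lebesgue (level N f k))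
        \<le> 1 / (1 - 2 powr (- p)) * (LINT z|lebesgue. m z powr p)" .
qed

section \<open>Approximation in \<open>L\<^sup>q\<close>\<close>

text \<open>On each Whitney ellipsoid the approximation is controlled by the average of \<open>\<bar>f\<bar>\<close>, hence by
  that of \<open>\<bar>f\<bar>\<^sup>q\<close>; bounded overlap turns this into a bound in \<open>L\<^sup>q\<close>.\<close>

lemma approx_Lq_local:
  assumes q: "1 < q"
  shows "\<exists>K>0. \<forall>f \<Omega> I x t i. f \<in> Lp_space q \<longrightarrow> whitney \<Omega> I x t \<longrightarrow> i \<in> I \<longrightarrow>
     (LINT z|lebesgue. \<bar>approx d f I x t i z\<bar> powr q) \<le> K * (LINT z|lebesgue. indicator (E (x i) (t i)) z * \<bar>f z\<bar> powr q) \<and>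
     integrable lebesgue (\<lambda>z. \<bar>approx d f I x t i z\<bar> powr q)"
proof -
  obtain Kp where Kp: "0 < Kp" "\<And>y s u c z. 0 \<le> c \<Longrightarrow>
      (\<forall>e\<in>basis d. \<bar>LINT v|lebesgue. u v * e (chart y s v)\<bar> \<le> c * 2 powr (- s)) \<Longrightarrow> \<bar>proj d y s u z\<bar> \<le> Kp * c"
    using proj_bound[of d] by blast
  obtain L where L: "0 < L" "\<And>e. e \<in> basis d \<Longrightarrow> bounded_derivs 0 L (ball 0 1) (e :: real^'n \<Rightarrow> real)"
    using basis_bounded_derivs by blast
  define K0 where "K0 = Kp * (L * (a2 + 1))"
  have K0: "0 < K0" using Kp L pos by (simp add: K0_def)
  define K where "K = K0 powr q * a2"
  have K: "0 < K" using K0 pos by (simp add: K_def)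
  have "(LINT z|lebesgue. \<bar>approx d f I x t i z\<bar> powr q) \<le> K * (LINT z|lebesgue. indicator (E (x i) (t i)) z * \<bar>f z\<bar> powr q) \<and>
     integrable lebesgue (\<lambda>z. \<bar>approx d f I x t i z\<bar> powr q)"
    if fq: "f \<in> Lp_space q" and W: "whitney \<Omega> I x t" and i: "i \<in> I" for f :: "real^'n \<Rightarrow> real" and \<Omega> I x t i
  proof -
    let ?s = "t i + J3"
    let ?S = "E (x i) ?s"
    have fm[measurable]: "f \<in> borel_measurable lebesgue" using Lp_spaceD(1)[OF fq] .
    have loc: "locally_integrable f" by (rule Lq_locally_integrable[OF fq q])
    define A where "A = (LINT z|lebesgue. indicator ?S z * \<bar>f z\<bar> powr q)"
    have A0: "0 \<le> A" unfolding A_def by (intro integral_nonneg_AE) auto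
    have iq: "integrable lebesgue (\<lambda>z. \<bar>f z\<bar> powr q)" using Lp_spaceD(2)[OF fq] by simp
    have iqS: "integrable lebesgue (\<lambda>z. indicator S z * \<bar>f z\<bar> powr q)" if "S \<in> sets lebesgue" for S
      using integrable_mult_indicator[OF that iq] by simp
    have Ssets: "?S \<in> sets lebesgue" "E (x i) (t i) \<in> sets lebesgue" using E_lmeasurable by auto
    have bound: "\<bar>approx d f I x t i z\<bar> \<le> K0 * \<tau>" if \<tau>: "0 < \<tau>" "A * 2 powr ?s \<le> \<tau> powr q" for \<tau> z
    proof -
      have "(LINT z|lebesgue. indicator ?S z * \<bar>f z\<bar>) \<le> \<tau> * measure lebesgue ?S + \<tau> powr (1 - q) * A"
        unfolding A_def by (rule Lq_integral_bound(2)[OF fq q E_lmeasurable \<tau>(1)])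
      also have "\<tau> * measure lebesgue ?S \<le> \<tau> * (a2 * 2 powr (- ?s))" using \<tau> by (intro mult_left_mono measure_E) auto
      also have "\<tau> powr (1 - q) * A \<le> \<tau> powr (1 - q) * (\<tau> powr q * 2 powr (- ?s))"
        using mult_right_mono[OF \<tau>(2), of "2 powr (- ?s)"] by (intro mult_left_mono) (simp_all add: mult.assoc flip: powr_add)
      also have "\<dots> = \<tau> * 2 powr (- ?s)" using \<tau>(1) by (simp add: mult.assoc[symmetric] powr_add[symmetric])
      finally have I: "(LINT z|lebesgue. indicator ?S z * \<bar>f z\<bar>) \<le> (a2 + 1) * \<tau> * 2 powr (- ?s)"
        by (simp add: algebra_simps)
      have "\<bar>LINT v|lebesgue. (f v * pou I x t i v) * e (chart (x i) ?s v)\<bar> \<le> (L * ((a2 + 1) * \<tau>)) * 2 powr (- ?s)"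
        if e: "e \<in> basis d" for e
      proof -
        have "\<bar>LINT v|lebesgue. (f v * pou I x t i v) * e (chart (x i) ?s v)\<bar>
            \<le> (LINT v|lebesgue. \<bar>(f v * pou I x t i v) * e (chart (x i) ?s v)\<bar>)" by (rule integral_abs_bound)
        also have "\<dots> \<le> (LINT v|lebesgue. L * (indicator ?S v * \<bar>f v\<bar>))"
        proof (rule integral_mono)
          have sup: "norm (chart (x i) ?s z) \<le> 1/2" if "f z * pou I x t i z \<noteq> 0" for z
            using that pou_support(2)[of I x t i z] by force
          have "e \<in> polys d" using e basis(2) by blast
          from integrable_mult_poly[OF integrable_mult_pou[OF loc fm] sup this]
          show "integrable lebesgue (\<lambda>v. \<bar>(f v * pou I x t i v) * e (chart (x i) ?s v)\<bar>)" by (rule integrable_abs)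
          show "integrable lebesgue (\<lambda>v. L * (indicator ?S v * \<bar>f v\<bar>))"
            by (intro integrable_mult_right Lq_integral_bound(1)[OF fq q E_lmeasurable])
          fix v
          show "\<bar>(f v * pou I x t i v) * e (chart (x i) ?s v)\<bar> \<le> L * (indicator ?S v * \<bar>f v\<bar>)"
          proof (cases "v \<in> ?S")
            case True
            then have "\<bar>e (chart (x i) ?s v)\<bar> \<le> L" using bounded_derivs_bound[OF L(2)[OF e]] by (simp add: mem_E)
            moreover have "\<bar>f v * pou I x t i v\<bar> \<le> \<bar>f v\<bar>" using pou_range[of I x t i v] by (simp add: abs_mult mult_left_le)
            ultimately have "\<bar>f v * pou I x t i v\<bar> * \<bar>e (chart (x i) ?s v)\<bar> \<le> \<bar>f v\<bar> * L" by (intro mult_mono) auto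
            then show ?thesis using True by (simp add: abs_mult mult.commute)
          next
            case False
            then have "pou I x t i v = 0" using pou_support(3) by blast
            then show ?thesis using False by simp
          qed
        qed
        also have "\<dots> = L * (LINT v|lebesgue. indicator ?S v * \<bar>f v\<bar>)" by simp
        also have "\<dots> \<le> L * ((a2 + 1) * \<tau> * 2 powr (- ?s))" using I L by (intro mult_left_mono) auto
        finally show ?thesis by (simp add: mult_ac)
      qed
      then have "\<bar>approx d f I x t i z\<bar> \<le> Kp * (L * ((a2 + 1) * \<tau>))"
        unfolding approx_def using L pos \<tau> by (intro Kp(2)) auto
      then show ?thesis by (simp add: K0_def mult_ac)
    qed
    have pw: "\<bar>approx d f I x t i z\<bar> powr q \<le> K0 powr q * (A * 2 powr ?s) * indicator ?S z" for z
    proof (cases "z \<in> ?S")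
      case True
      show ?thesis
      proof (cases "A = 0")
        case False
        \<comment> \<open>The value of \<open>\<tau>\<close> that balances the two terms of the splitting: the \<open>q\<close>th root of the
          average of \<open>\<bar>f\<bar> powr q\<close>.\<close>
        define \<tau> where "\<tau> = (A * 2 powr ?s) powr (1 / q)"
        have \<tau>: "0 < \<tau>" "\<tau> powr q = A * 2 powr ?s" using False A0 q by (auto simp: \<tau>_def powr_powr)
        from bound[OF \<tau>(1)] \<tau>(2) have "\<bar>approx d f I x t i z\<bar> \<le> K0 * \<tau>" by simp
        then have "\<bar>approx d f I x t i z\<bar> powr q \<le> (K0 * \<tau>) powr q" using q by (intro powr_mono2) auto
        also have "\<dots> = K0 powr q * (A * 2 powr ?s)" unfolding \<tau>(2)[symmetric] using K0 \<tau>(1) by (simp add: powr_mult)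
        finally show ?thesis using True by simp
      next
        \<comment> \<open>If \<open>f\<close> vanishes on the ellipsoid, every positive \<open>\<tau>\<close> is admissible.\<close>
        case A: True
        have "\<bar>approx d f I x t i z\<bar> \<le> 0 + e" if "0 < e" for e
          using bound[of "e / K0" z] that K0 A by simp
        then have "\<bar>approx d f I x t i z\<bar> \<le> 0" by (rule field_le_epsilon)
        then show ?thesis using A by simp
      qed
    next
      case False
      then have "approx d f I x t i z = 0" using approx_support(2)[of d f I x t i z] half_mem_E by blast
      then show ?thesis using False by simp
    qed
    have wint: "integrable lebesgue (\<lambda>z. K0 powr q * (A * 2 powr ?s) * indicator ?S z)"
      using E_lmeasurable[of "x i" ?s] by (intro integrable_mult_right integrable_real_indicator) (auto simp: fmeasurable_def)
    have int: "integrable lebesgue (\<lambda>z. \<bar>approx d f I x t i z\<bar> powr q)"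
      by (rule Bochner_Integration.integrable_bound[OF wint]) (use pw in \<open>auto intro!: AE_I2 order.trans[OF pw abs_ge_self]\<close>)
    have "(LINT z|lebesgue. \<bar>approx d f I x t i z\<bar> powr q) \<le> (LINT z|lebesgue. K0 powr q * (A * 2 powr ?s) * indicator ?S z)"
      by (rule integral_mono[OF int wint pw])
    also have "\<dots> = K0 powr q * (A * 2 powr ?s) * measure lebesgue ?S" using E_lmeasurable[of "x i" ?s] by simp
    also have "\<dots> \<le> K0 powr q * (A * 2 powr ?s) * (a2 * 2 powr (- ?s))" using A0 by (intro mult_left_mono measure_E) auto
    also have "\<dots> = K * A * (2 powr ?s * 2 powr (- ?s))" by (simp only: K_def mult_ac)
    also have "\<dots> = K * A" by (simp flip: powr_add)
    also have "A \<le> (LINT z|lebesgue. indicator (E (x i) (t i)) z * \<bar>f z\<bar> powr q)"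
      unfolding A_def using support_sub_E[of "x i" "t i"]
      by (intro integral_mono iqS Ssets) (auto simp: indicator_def)
    finally show ?thesis using int K by (simp add: mult_left_mono)
  qed
  then show ?thesis using K by blast
qed

end

lemma Lp_tendsto_cong:
  assumes "Lp_tendsto q u g F" "\<forall>\<^sub>F m in F. u m = v m"
  shows "Lp_tendsto q v g F"
proof -
  from assms(1) have sp: "\<forall>\<^sub>F m in F. u m \<in> Lp_space q" and lim: "((\<lambda>m. Lp_norm q (\<lambda>x. u m x - g x)) \<longlongrightarrow> 0) F"
    and g: "g \<in> Lp_space q" unfolding Lp_tendsto_def by auto
  have "\<forall>\<^sub>F m in F. v m \<in> Lp_space q" using sp assms(2) by eventually_elim simp
  moreover have "\<forall>\<^sub>F m in F. Lp_norm q (\<lambda>x. u m x - g x) = Lp_norm q (\<lambda>x. v m x - g x)"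
    using assms(2) by eventually_elim simp
  from tendsto_cong[THEN iffD1, OF this lim] have "((\<lambda>m. Lp_norm q (\<lambda>x. v m x - g x)) \<longlongrightarrow> 0) F" .
  ultimately show ?thesis using g unfolding Lp_tendsto_def by blast
qed

lemma sum_int_telescope:
  fixes G :: "int \<Rightarrow> 'a::ab_group_add"
  assumes "l \<le> m" shows "(\<Sum>k=l..m. G (k + 1) - G k) = G (m + 1) - G l"
  using assms
proof (induction m rule: int_ge_induct)
  case (step m)
  have "{l..m + 1} = insert (m + 1) {l..m}" using step(1) by auto
  then have "(\<Sum>k=l..m + 1. G (k + 1) - G k) = (G (m + 1 + 1) - G (m + 1)) + (\<Sum>k=l..m. G (k + 1) - G k)" by simp
  then show ?case using step(2) by simp
qed simp

context ellipsoid_cover begin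

lemma overlap_powr:
  fixes u :: "nat \<Rightarrow> real"
  assumes W: "whitney \<Omega> I x t" and loc: "\<And>i. u i \<noteq> 0 \<Longrightarrow> i \<in> I \<and> z \<in> E (x i) (t i)" and q: "0 < q" and F: "finite F"
  shows "\<bar>\<Sum>i\<in>F. u i\<bar> powr q \<le> overlap powr q * (\<Sum>i\<in>F. \<bar>u i\<bar> powr q)"
proof (cases "F = {}")
  case False
  obtain i0 where i0: "i0 \<in> F" "\<And>i. i \<in> F \<Longrightarrow> \<bar>u i\<bar> \<le> \<bar>u i0\<bar>"
  proof -
    have "Max ((\<lambda>i. \<bar>u i\<bar>) ` F) \<in> (\<lambda>i. \<bar>u i\<bar>) ` F" using F False by (intro Max_in) auto
    then obtain i where i: "i \<in> F" "\<bar>u i\<bar> = Max ((\<lambda>i. \<bar>u i\<bar>) ` F)" by (metis imageE)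
    have "\<bar>u j\<bar> \<le> \<bar>u i\<bar>" if "j \<in> F" for j unfolding i(2) using that F by (intro Max_ge) auto
    then show ?thesis using that i(1) by blast
  qed
  let ?v = "\<lambda>i. if i \<in> F then u i else 0"
  have "\<bar>\<Sum>i\<in>F. ?v i\<bar> \<le> overlap * \<bar>u i0\<bar>"
  proof (rule overlap_sum(2)[OF W, of ?v z])
    show "i \<in> I \<and> z \<in> E (x i) (t i)" if "?v i \<noteq> 0" for i using loc[of i] that by (cases "i \<in> F") auto
    show "\<bar>?v i\<bar> \<le> \<bar>u i0\<bar>" for i using i0(2)[of i] by simp
  qed
  then have "\<bar>\<Sum>i\<in>F. u i\<bar> \<le> overlap * \<bar>u i0\<bar>" by simp
  then have "\<bar>\<Sum>i\<in>F. u i\<bar> powr q \<le> (overlap * \<bar>u i0\<bar>) powr q" using q by (intro powr_mono2) auto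
  also have "\<dots> = overlap powr q * \<bar>u i0\<bar> powr q" by (simp add: powr_mult)
  also have "\<bar>u i0\<bar> powr q \<le> (\<Sum>i\<in>F. \<bar>u i\<bar> powr q)" using i0(1) F by (intro member_le_sum) auto
  finally show ?thesis by (simp add: mult_left_mono)
qed simp

lemma approx_Lq:
  assumes q: "1 < q"
  shows "\<exists>K>0. \<forall>f \<Omega> I x t c. f \<in> Lp_space q \<longrightarrow> whitney \<Omega> I x t \<longrightarrow> \<Omega> \<in> lmeasurable \<longrightarrow> 0 \<le> c \<longrightarrow>
     (\<forall>v. v \<notin> \<Omega> \<longrightarrow> maximal N f v \<le> ennreal c) \<longrightarrow>
     (LINT z|lebesgue. \<bar>\<Sum>i. approx d f I x t i z\<bar> powr q) \<le> K * (LINT z|lebesgue. indicator \<Omega> z * \<bar>f z\<bar> powr q)"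
proof -
  obtain K0 where K0: "0 < K0" "\<And>f \<Omega> I x t i. f \<in> Lp_space q \<Longrightarrow> whitney \<Omega> I x t \<Longrightarrow> i \<in> I \<Longrightarrow>
     (LINT z|lebesgue. \<bar>approx d f I x t i z\<bar> powr q) \<le> K0 * (LINT z|lebesgue. indicator (E (x i) (t i)) z * \<bar>f z\<bar> powr q) \<and>
     integrable lebesgue (\<lambda>z. \<bar>approx d f I x t i z\<bar> powr q)"
    using approx_Lq_local[OF q, of d] by blast
  define K where "K = overlap powr q * (K0 * overlap) + 1"
  have K: "0 < K" using K0 by (simp add: K_def add_nonneg_pos)
  have key: "(LINT z|lebesgue. \<bar>\<Sum>i. approx d f I x t i z\<bar> powr q) \<le> K * (LINT z|lebesgue. indicator \<Omega> z * \<bar>f z\<bar> powr q)"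
    if fq: "f \<in> Lp_space q" and W: "whitney \<Omega> I x t" and \<Omega>: "\<Omega> \<in> lmeasurable" and c: "0 \<le> c"
      and mx: "\<forall>v. v \<notin> \<Omega> \<longrightarrow> maximal N f v \<le> ennreal c" for f \<Omega> I x t c
  proof -
    let ?a = "\<lambda>i z. approx d f I x t i z"
    have loc: "i \<in> I \<and> z \<in> E (x i) (t i)" if "?a i z \<noteq> 0" for i z
      using approx_support[OF that] support_in_whitney_E[of "x i" "t i" z] by simp
    have iq: "integrable lebesgue (\<lambda>z. \<bar>f z\<bar> powr q)" using Lp_spaceD(2)[OF fq] by simp
    have i\<Omega>: "integrable lebesgue (\<lambda>z. indicator \<Omega> z * \<bar>f z\<bar> powr q)"
      using integrable_mult_indicator[OF _ iq, of \<Omega>] \<Omega> by auto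
    define J where "J = (LINT z|lebesgue. indicator \<Omega> z * \<bar>f z\<bar> powr q)"
    have J: "0 \<le> J" unfolding J_def by (intro integral_nonneg_AE) auto
    define B where "B = overlap * (approx_const N d * c)"
    have part: "(LINT z|lebesgue. \<bar>\<Sum>i<r. ?a i z\<bar> powr q) \<le> K * J" for r
    proof -
      let ?F = "{..<r} \<inter> I"
      have "(\<Sum>i<r. ?a i z) = (\<Sum>i\<in>?F. ?a i z)" for z
        using loc by (intro sum.mono_neutral_right) auto
      then have "(LINT z|lebesgue. \<bar>\<Sum>i<r. ?a i z\<bar> powr q) = (LINT z|lebesgue. \<bar>\<Sum>i\<in>?F. ?a i z\<bar> powr q)" by simp
      also have "\<dots> \<le> (LINT z|lebesgue. overlap powr q * (\<Sum>i\<in>?F. \<bar>?a i z\<bar> powr q))"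
      proof (rule integral_mono_AE')
        show "integrable lebesgue (\<lambda>z. overlap powr q * (\<Sum>i\<in>?F. \<bar>?a i z\<bar> powr q))"
          using K0(2)[OF fq W] by (intro integrable_mult_right Bochner_Integration.integrable_sum) auto
        show "AE z in lebesgue. \<bar>\<Sum>i\<in>?F. ?a i z\<bar> powr q \<le> overlap powr q * (\<Sum>i\<in>?F. \<bar>?a i z\<bar> powr q)"
          by (intro AE_I2 overlap_powr[OF W loc]) (use q in auto)
        show "AE z in lebesgue. 0 \<le> overlap powr q * (\<Sum>i\<in>?F. \<bar>?a i z\<bar> powr q)"
          by (intro AE_I2 mult_nonneg_nonneg sum_nonneg) auto
      qed
      also have "\<dots> = overlap powr q * (\<Sum>i\<in>?F. LINT z|lebesgue. \<bar>?a i z\<bar> powr q)"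
        using K0(2)[OF fq W] by (simp add: Bochner_Integration.integral_sum)
      also have "\<dots> \<le> overlap powr q * (\<Sum>i\<in>?F. K0 * (LINT z|lebesgue. indicator (E (x i) (t i)) z * \<bar>f z\<bar> powr q))"
        using K0(2)[OF fq W] by (intro mult_left_mono sum_mono) auto
      also have "\<dots> = overlap powr q * (K0 * (\<Sum>i\<in>?F. LINT z|lebesgue. indicator (E (x i) (t i)) z * \<bar>f z\<bar> powr q))"
        by (simp add: sum_distrib_left)
      also have "\<dots> \<le> overlap powr q * (K0 * (overlap * J))"
        unfolding J_def using K0(1) by (intro mult_left_mono whitney_integral_sum(1)[OF W i\<Omega>]) auto
      also have "\<dots> \<le> K * J" using J unfolding K_def by (simp add: algebra_simps)
      finally show ?thesis .
    qed
    have bd: "\<bar>\<Sum>i<r. ?a i z\<bar> \<le> B * indicator \<Omega> z" for r z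
    proof (cases "z \<in> \<Omega>")
      case True
      then show ?thesis unfolding B_def
        using overlap_sum(2)[OF W, of "\<lambda>i. ?a i z" z "approx_const N d * c" "{..<r}", OF loc approx_const(2)[OF W c mx]] by simp
    next
      case False
      then have "?a i z = 0" for i using good_eq(3)[OF W] by blast
      then show ?thesis using False by simp
    qed
    have lim: "(\<lambda>r. \<Sum>i<r. ?a i z) \<longlonglongrightarrow> (\<Sum>i. ?a i z)" for z
      using approx_finite[OF W, of d f z] by (intro summable_LIMSEQ summable_finite) auto
    have B: "0 \<le> B" unfolding B_def using c approx_const(1)[of N d] by simp
    have "(\<lambda>r. LINT z|lebesgue. \<bar>\<Sum>i<r. ?a i z\<bar> powr q) \<longlonglongrightarrow> (LINT z|lebesgue. \<bar>\<Sum>i. ?a i z\<bar> powr q)"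
    proof (rule integral_dominated_convergence[where w="\<lambda>z. B powr q * indicator \<Omega> z"])
      show "(\<lambda>z. \<bar>\<Sum>i<r. ?a i z\<bar> powr q) \<in> borel_measurable lebesgue" for r by measurable
      show "(\<lambda>z. \<bar>\<Sum>i. ?a i z\<bar> powr q) \<in> borel_measurable lebesgue"
      proof -
        have [measurable]: "(\<lambda>z. \<Sum>i. ?a i z) \<in> borel_measurable lebesgue" by (intro borel_measurable_suminf measurable_approx)
        show ?thesis by measurable
      qed
      show "integrable lebesgue (\<lambda>z. B powr q * indicator \<Omega> z)"
        using \<Omega> by (intro integrable_mult_right) (simp add: lmeasurable_iff_integrable)
      show "AE z in lebesgue. (\<lambda>r. \<bar>\<Sum>i<r. ?a i z\<bar> powr q) \<longlonglongrightarrow> \<bar>\<Sum>i. ?a i z\<bar> powr q"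
        by (intro AE_I2 tendsto_powr' tendsto_rabs lim tendsto_const) (use q in auto)
      show "AE z in lebesgue. norm (\<bar>\<Sum>i<r. ?a i z\<bar> powr q) \<le> B powr q * indicator \<Omega> z" for r
      proof (rule AE_I2)
        fix z
        have "\<bar>\<Sum>i<r. ?a i z\<bar> powr q \<le> (B * indicator \<Omega> z) powr q" using bd q by (intro powr_mono2) auto
        also have "\<dots> = B powr q * indicator \<Omega> z" by (simp add: indicator_def)
        finally show "norm (\<bar>\<Sum>i<r. ?a i z\<bar> powr q) \<le> B powr q * indicator \<Omega> z" by simp
      qed
    qed
    then show ?thesis using part unfolding J_def by (intro LIMSEQ_le_const2) auto
  qed
  show ?thesis
  proof (intro exI[of _ K] conjI allI impI)
    show "0 < K" by (rule K)
  qed (rule key)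
qed

section \<open>The atomic decomposition\<close>

text \<open>The closed support of a function living on one ellipsoid need not lie in that open ellipsoid,
  but it lies in the ellipsoid enlarged by \<open>J0\<close> scales, with respect to which the function is
  normalised.\<close>

lemma is_atomI:
  assumes "a \<in> borel_measurable lebesgue" "\<And>z. a z \<noteq> 0 \<Longrightarrow> z \<in> E x t"
    and "AE z in lebesgue. \<bar>a z\<bar> \<le> measure lebesgue (E x (t - J0)) powr (- 1 / p)"
    and "\<And>p. p \<in> polys d \<Longrightarrow> (LINT z|lebesgue. a z * p z) = 0"
  shows "is_atom M p d a"
  unfolding is_atom_def
proof (intro conjI exI[of _ x] exI[of _ "t - J0"] allI impI)
  show "a \<in> borel_measurable lebesgue" by fact
  then have m: "(\<lambda>y. ereal \<bar>a y\<bar>) \<in> borel_measurable lebesgue" by measurable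
  show "esssup lebesgue (\<lambda>y. ereal \<bar>a y\<bar>) \<le> ereal (measure lebesgue (E x (t - J0)) powr (- 1 / p))"
    by (rule esssup_I[OF m]) (use assms(3) in auto)
  have "closed {z. norm (chart x t z) \<le> 1}"
    by (intro closed_Collect_le continuous_on_norm continuous_chart continuous_on_const)
  then have "closure {y. a y \<noteq> 0} \<subseteq> {z. norm (chart x t z) \<le> 1}"
    using assms(2) by (intro closure_minimal) (auto simp: mem_E intro: less_imp_le)
  moreover have "{z. norm (chart x t z) \<le> 1} \<subseteq> E x (t - J0)"
  proof -
    have "E x t \<inter> E x t \<noteq> {}" using center_mem[of x t] by blast
    then show ?thesis using engulf[of x t x t J0] by auto
  qed
  ultimately show "closure {y. a y \<noteq> 0} \<subseteq> E x (t - J0)" by blast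
  fix \<alpha> :: "'n \<Rightarrow> nat" assume "mi_abs \<alpha> \<le> d"
  from assms(4)[OF polys_monomial[OF this]] show "(LINT y|lebesgue. a y * (\<Prod>i\<in>UNIV. (y $ i) ^ \<alpha> i)) = 0"
    by (simp add: monomial_def)
qed

text \<open>The level sets of the maximal function at dyadic heights are decomposed simultaneously, and
  each difference of consecutive good functions is divided into pieces. All pieces at height
  \<open>2 powr k\<close> are bounded by a multiple of it, so a piece is an atom after division by that
  height times the \<open>p\<close>th root of the volume of its enlarged ellipsoid. The function \<open>m\<close> is a
  measurable majorant of the maximal function, in the application a multiple of the radial
  grand maximal function.\<close>

lemma real_atomic_decomposition:
  assumes p: "0 < p" and q: "1 < q" and pq: "p < q"
  shows "\<exists>C>0. \<forall>f m. f \<in> Lp_space q \<longrightarrow> m \<in> borel_measurable lebesgue \<longrightarrow> (\<forall>z. 0 \<le> m z) \<longrightarrow>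
     integrable lebesgue (\<lambda>z. m z powr p) \<longrightarrow> (AE z in lebesgue. maximal N f z \<le> ennreal (m z)) \<longrightarrow>
     (\<exists>a lam g. (\<forall>k i. is_atom M p d (a k i)) \<and>
        (\<forall>F H. finite F \<longrightarrow> finite H \<longrightarrow> (\<Sum>k\<in>F. \<Sum>i\<in>H. \<bar>lam k i\<bar> powr p) \<le> C * (LINT z|lebesgue. m z powr p)) \<and>
        (\<forall>k::int. Lp_tendsto q (\<lambda>r z. \<Sum>i<r::nat. lam k i * a k i z) (g k) sequentially) \<and>
        Lp_tendsto q (\<lambda>(l, m) z. \<Sum>k=l..m. g k z) f (at_bot \<times>\<^sub>F at_top))"
proof -
  have q0: "0 < q" using q by simp
  obtain Kf where Kf: "0 < Kf" and Kf_AE: "\<And>f c. f \<in> Lp_space q \<Longrightarrow> 0 \<le> c \<Longrightarrow>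
     (AE z in lebesgue. maximal N f z \<le> ennreal c \<longrightarrow> \<bar>f z\<bar> \<le> Kf * c)"
    using AE_le_of_maximal[OF q, of N] by blast
  obtain Kq where Kq: "0 < Kq" and Kq_bound: "\<And>f \<Omega> I x t c. f \<in> Lp_space q \<Longrightarrow> whitney \<Omega> I x t \<Longrightarrow> \<Omega> \<in> lmeasurable \<Longrightarrow> 0 \<le> c \<Longrightarrow>
     (\<forall>v. v \<notin> \<Omega> \<longrightarrow> maximal N f v \<le> ennreal c) \<Longrightarrow>
     (LINT z|lebesgue. \<bar>\<Sum>i. approx d f I x t i z\<bar> powr q) \<le> Kq * (LINT z|lebesgue. indicator \<Omega> z * \<bar>f z\<bar> powr q)"
    using approx_Lq[OF q, of N d] by blast
  define Ka where "Ka = approx_const N d"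
  define Kc where "Kc = correction_const N d"
  have Ka: "0 < Ka" and Kc: "0 < Kc" using approx_const(1) correction_const(1) by (auto simp: Ka_def Kc_def)
  define B0 where "B0 = Kf + overlap * Ka"
  have B0: "0 < B0" using Kf Ka by (simp add: B0_def add_pos_nonneg)
  define C0 where "C0 = 2 * B0 + Ka + overlap * (Kc * 2)"
  have C0: "0 < C0" using B0 Ka Kc by (simp add: C0_def add_pos_nonneg)
  define Cp where "Cp = 1 / (1 - 2 powr (- p))"
  have "2 powr (- p) < 2 powr 0" using p by (intro powr_less_mono) auto
  then have Cp: "0 < Cp" by (simp add: Cp_def)
  define Cv where "Cv = a2 * 2 powr J0 / a1"
  have Cv: "0 < Cv" using pos by (simp add: Cv_def)
  define C where "C = C0 powr p * (Cv * overlap) * Cp + 1"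
  have C: "0 < C" using C0 Cv Cp by (simp add: C_def add_nonneg_pos)
  have key: "\<exists>a lam g. (\<forall>k i. is_atom M p d (a k i)) \<and>
        (\<forall>F H. finite F \<longrightarrow> finite H \<longrightarrow> (\<Sum>k\<in>F. \<Sum>i\<in>H. \<bar>lam k i\<bar> powr p) \<le> C * (LINT z|lebesgue. m z powr p)) \<and>
        (\<forall>k::int. Lp_tendsto q (\<lambda>r z. \<Sum>i<r::nat. lam k i * a k i z) (g k) sequentially) \<and>
        Lp_tendsto q (\<lambda>(l, m) z. \<Sum>k=l..m. g k z) f (at_bot \<times>\<^sub>F at_top)"
    if fq: "f \<in> Lp_space q" and m: "m \<in> borel_measurable lebesgue" "\<forall>z. 0 \<le> m z" "integrable lebesgue (\<lambda>z. m z powr p)"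
      and le: "AE z in lebesgue. maximal N f z \<le> ennreal (m z)" for f :: "real^'n \<Rightarrow> real" and m
  proof -
    have fm[measurable]: "f \<in> borel_measurable lebesgue" using Lp_spaceD(1)[OF fq] .
    have loc: "locally_integrable f" by (rule Lq_locally_integrable[OF fq q])
    have iq: "integrable lebesgue (\<lambda>z. \<bar>f z\<bar> powr q)" using Lp_spaceD(2)[OF fq] by simp
    let ?\<Omega> = "level N f"
    let ?c = "\<lambda>k::int. 2 powr real_of_int k :: real"
    note lm = level_measure[OF p _ m(3,1) le]
    have \<Omega>l: "?\<Omega> k \<in> lmeasurable" for k using lm(1) m(2) by blast
    have \<Omega>sum: "(\<Sum>k\<in>F. 2 powr (real_of_int k * p) * measure lebesgue (?\<Omega> k)) \<le> Cp * (LINT z|lebesgue. m z powr p)"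
      if "finite F" for F unfolding Cp_def using lm(2)[OF _ that] m(2) by blast
    have out: "\<forall>v. v \<notin> ?\<Omega> k \<longrightarrow> maximal N f v \<le> ennreal (?c k)" for k using level_outside by blast
    have c0: "0 \<le> ?c k" for k by simp
    have "\<exists>I x t. whitney (?\<Omega> k) I x t" for k
      using whitney_exists[OF level_open] \<Omega>l[of k] by (auto simp: fmeasurable_def)
    then have "\<exists>w. whitney (?\<Omega> k) (fst w) (fst (snd w)) (snd (snd w))" for k by auto
    then obtain w where w: "\<And>k. whitney (?\<Omega> k) (fst (w k)) (fst (snd (w k))) (snd (snd (w k)))"
      using choice[of "\<lambda>k w. whitney (?\<Omega> k) (fst w) (fst (snd w)) (snd (snd w))"] by blast
    define I where "I = (\<lambda>k. fst (w k))"
    define x where "x = (\<lambda>k. fst (snd (w k)))"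
    define t where "t = (\<lambda>k. snd (snd (w k)))"
    have W: "whitney (?\<Omega> k) (I k) (x k) (t k)" for k using w[of k] by (simp add: I_def x_def t_def)
    have sub: "?\<Omega> (k + 1) \<subseteq> ?\<Omega> k" for k by (rule level_mono) simp
    \<comment> \<open>Good functions, pieces, and sums of projections at height \<open>2 powr k\<close>.\<close>
    define G where "G = (\<lambda>k. good d f (I k) (x k) (t k))"
    define P where "P = (\<lambda>k. piece d f (I k) (x k) (t k) (I (k + 1)) (x (k + 1)) (t (k + 1)))"
    define A where "A = (\<lambda>k z. \<Sum>i. approx d f (I k) (x k) (t k) i z)"
    have Gm[measurable]: "G k \<in> borel_measurable lebesgue" for k unfolding G_def by (rule measurable_good[OF fm])
    have Pm[measurable]: "P k i \<in> borel_measurable lebesgue" for k i unfolding P_def by (rule measurable_piece[OF fm])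
    have Am[measurable]: "A k \<in> borel_measurable lebesgue" for k
      unfolding A_def by (intro borel_measurable_suminf measurable_approx)
    have Ploc: "i \<in> I k \<and> z \<in> E (x k i) (t k i)" if "P k i z \<noteq> 0" for k i z
      using piece_support[OF W W sub] that unfolding P_def by blast
    have G_eq: "G k z = (if z \<in> ?\<Omega> k then A k z else f z)" for k z
      using good_eq(1,2)[OF W[of k], of z d f] by (auto simp: G_def A_def sums_iff)
    have A_bd: "\<bar>A k z\<bar> \<le> (overlap * Ka) * ?c k * indicator (?\<Omega> k) z" for k z
    proof (cases "z \<in> ?\<Omega> k")
      case True
      have "i \<in> I k \<and> z \<in> E (x k i) (t k i)" if "approx d f (I k) (x k) (t k) i z \<noteq> 0" for i
        using approx_support[OF that] support_in_whitney_E[of "x k i" "t k i" z] by simp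
      from overlap_sum(3)[OF W this approx_const(2)[OF W c0 out]] show ?thesis using True by (simp add: A_def Ka_def mult.assoc)
    next
      case False
      then show ?thesis using good_eq(3)[OF W False] by (simp add: A_def)
    qed
    \<comment> \<open>Off the level set, \<open>f\<close> itself is bounded by the height. Only countably many heights occur,
      so one null set serves for all.\<close>
    have f_AE: "AE z in lebesgue. \<forall>k. z \<notin> ?\<Omega> k \<longrightarrow> \<bar>f z\<bar> \<le> Kf * ?c k"
      unfolding AE_all_countable
    proof
      fix k :: int
      show "AE z in lebesgue. z \<notin> ?\<Omega> k \<longrightarrow> \<bar>f z\<bar> \<le> Kf * ?c k"
        using Kf_AE[OF fq c0[of k]] by eventually_elim (use out[of k] in blast)
    qed
    have G_bd: "AE z in lebesgue. \<forall>k. \<bar>G k z\<bar> \<le> B0 * ?c k"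
      using f_AE
    proof eventually_elim
      case (elim z)
      show ?case
      proof
        fix k
        show "\<bar>G k z\<bar> \<le> B0 * ?c k"
        proof (cases "z \<in> ?\<Omega> k")
          case True
          then have "\<bar>G k z\<bar> \<le> (overlap * Ka) * ?c k" using A_bd[of k z] by (simp add: G_eq)
          also have "\<dots> \<le> B0 * ?c k" using Kf by (intro mult_right_mono) (auto simp: B0_def)
          finally show ?thesis .
        next
          case False
          then have "\<bar>G k z\<bar> \<le> Kf * ?c k" using elim by (simp add: G_eq)
          also have "\<dots> \<le> B0 * ?c k" using Ka by (intro mult_right_mono) (auto simp: B0_def)
          finally show ?thesis .
        qed
      qed
    qed
    have c2: "?c (k + 1) = 2 * ?c k" for k by (simp add: powr_add)
    have P_bd: "AE z in lebesgue. \<forall>k i. \<bar>P k i z\<bar> \<le> C0 * ?c k"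
      using G_bd
    proof eventually_elim
      case (elim z)
      show ?case
      proof (intro allI)
        fix k i
        let ?g = "\<lambda>j. correction d f (I k) (x k) (t k) (I (k + 1)) (x (k + 1)) (t (k + 1)) i j z"
        have gloc: "j \<in> I (k + 1) \<and> z \<in> E (x (k + 1) j) (t (k + 1) j)" if "?g j \<noteq> 0" for j
          using correction_location(3,4)[OF W W sub that] by simp
        have 1: "\<bar>\<Sum>j. ?g j\<bar> \<le> overlap * (Kc * ?c (k + 1))"
          unfolding Kc_def by (rule overlap_sum(3)[OF W gloc correction_const(2)[OF loc fm W W sub c0 out]])
        have 2: "\<bar>approx d f (I k) (x k) (t k) i z\<bar> \<le> Ka * ?c k" unfolding Ka_def by (rule approx_const(2)[OF W c0 out])
        have "\<bar>G (k + 1) z\<bar> * pou (I k) (x k) (t k) i z \<le> (B0 * ?c (k + 1)) * 1"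
        proof (rule mult_mono)
          show "\<bar>G (k + 1) z\<bar> \<le> B0 * ?c (k + 1)" using elim by blast
        qed (use pou_range B0 in auto)
        then have 3: "\<bar>G (k + 1) z * pou (I k) (x k) (t k) i z\<bar> \<le> B0 * ?c (k + 1)"
          using pou_range[of "I k" "x k" "t k" i z] by (simp add: abs_mult)
        have "\<bar>P k i z\<bar> \<le> \<bar>G (k + 1) z * pou (I k) (x k) (t k) i z\<bar> + \<bar>approx d f (I k) (x k) (t k) i z\<bar> + \<bar>\<Sum>j. ?g j\<bar>"
          unfolding P_def piece_def G_def by linarith
        also have "\<dots> \<le> B0 * ?c (k + 1) + Ka * ?c k + overlap * (Kc * ?c (k + 1))" using 1 2 3 by linarith
        also have "\<dots> = C0 * ?c k" unfolding c2 C0_def by (simp add: algebra_simps)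
        finally show "\<bar>P k i z\<bar> \<le> C0 * ?c k" .
      qed
    qed
    define V where "V = (\<lambda>k i. measure lebesgue (E (x k i) (t k i - J0)))"
    have V: "0 < V k i" "V k i \<le> Cv * measure lebesgue (E (x k i) (t k i))" for k i
    proof -
      have "0 < a1 * 2 powr (- (t k i - J0))" using pos by simp
      also have "\<dots> \<le> V k i" unfolding V_def by (rule measure_E)
      finally show "0 < V k i" .
      have "V k i \<le> a2 * 2 powr (- (t k i - J0))" unfolding V_def by (rule measure_E)
      also have "\<dots> = Cv * (a1 * 2 powr (- t k i))" using pos by (simp add: Cv_def powr_diff powr_minus field_simps)
      also have "\<dots> \<le> Cv * measure lebesgue (E (x k i) (t k i))" using Cv by (intro mult_left_mono measure_E) auto
      finally show "V k i \<le> Cv * measure lebesgue (E (x k i) (t k i))" .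
    qed
    \<comment> \<open>Indices outside \<open>I k\<close> get the coefficient zero; division by zero then makes the atom
      vanish.\<close>
    define lam where "lam = (\<lambda>k i. if i \<in> I k then C0 * ?c k * V k i powr (1 / p) else 0)"
    define a where "a = (\<lambda>k i z. P k i z / lam k i)"
    have lam_a: "lam k i * a k i z = P k i z" for k i z
    proof (cases "i \<in> I k")
      case True
      then have "lam k i \<noteq> 0" using C0 V(1)[of k i] by (simp add: lam_def)
      then show ?thesis by (simp add: a_def)
    next
      case False
      then show ?thesis using Ploc by (auto simp: lam_def)
    qed
    have atom: "is_atom M p d (a k i)" for k i
    proof (rule is_atomI)
      show "a k i \<in> borel_measurable lebesgue" unfolding a_def by measurable
      show "z \<in> E (x k i) (t k i)" if "a k i z \<noteq> 0" for z using that Ploc by (auto simp: a_def)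
      show "AE z in lebesgue. \<bar>a k i z\<bar> \<le> measure lebesgue (E (x k i) (t k i - J0)) powr (- 1 / p)"
        using P_bd
      proof eventually_elim
        case (elim z)
        show ?case
        proof (cases "i \<in> I k")
          case True
          have "\<bar>a k i z\<bar> = \<bar>P k i z\<bar> / (C0 * ?c k * V k i powr (1 / p))"
            using True C0 by (simp add: a_def lam_def abs_mult)
          also have "\<dots> \<le> (C0 * ?c k) / (C0 * ?c k * V k i powr (1 / p))"
            using elim C0 by (intro divide_right_mono) auto
          also have "\<dots> = V k i powr (- 1 / p)" using C0 by (simp add: powr_minus_divide)
          finally show ?thesis by (simp add: V_def)
        next
          case False
          then have "P k i z = 0" using Ploc by blast
          then show ?thesis by (simp add: a_def)
        qed
      qed
      show "(LINT z|lebesgue. a k i z * r z) = 0" if "r \<in> polys d" for r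
      proof -
        have "(LINT z|lebesgue. P k i z * r z) = 0"
          unfolding P_def by (rule piece_moment[OF W W sub loc fm c0 out that])
        then have "(LINT z|lebesgue. (P k i z * r z) / lam k i) = 0" by simp
        then show ?thesis by (simp add: a_def)
      qed
    qed
    have lam_sum: "(\<Sum>k\<in>F. \<Sum>i\<in>H. \<bar>lam k i\<bar> powr p) \<le> C * (LINT z|lebesgue. m z powr p)" if F: "finite F" and H: "finite H" for F H
    proof -
      have inner: "(\<Sum>i\<in>H. \<bar>lam k i\<bar> powr p) \<le> (C0 powr p * (Cv * overlap)) * (2 powr (real_of_int k * p) * measure lebesgue (?\<Omega> k))" for k
      proof -
        have "(\<Sum>i\<in>H. \<bar>lam k i\<bar> powr p) = (\<Sum>i\<in>H \<inter> I k. \<bar>lam k i\<bar> powr p)"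
          using H by (intro sum.mono_neutral_right) (auto simp: lam_def)
        also have "\<dots> \<le> (\<Sum>i\<in>H \<inter> I k. (C0 powr p * 2 powr (real_of_int k * p)) * (Cv * measure lebesgue (E (x k i) (t k i))))"
        proof (rule sum_mono)
          fix i assume "i \<in> H \<inter> I k"
          then have "\<bar>lam k i\<bar> powr p = (C0 * ?c k * V k i powr (1 / p)) powr p" using C0 by (simp add: lam_def)
          also have "\<dots> = (C0 powr p * 2 powr (real_of_int k * p)) * V k i"
            using C0 p V(1)[of k i] by (simp add: powr_mult powr_powr)
          also have "\<dots> \<le> (C0 powr p * 2 powr (real_of_int k * p)) * (Cv * measure lebesgue (E (x k i) (t k i)))"
            using V(2) by (intro mult_left_mono) auto
          finally show "\<bar>lam k i\<bar> powr p \<le> (C0 powr p * 2 powr (real_of_int k * p)) * (Cv * measure lebesgue (E (x k i) (t k i)))" .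
        qed
        also have "\<dots> = (C0 powr p * 2 powr (real_of_int k * p)) * (Cv * (\<Sum>i\<in>H \<inter> I k. measure lebesgue (E (x k i) (t k i))))"
          by (simp add: sum_distrib_left)
        also have "\<dots> \<le> (C0 powr p * 2 powr (real_of_int k * p)) * (Cv * (overlap * measure lebesgue (?\<Omega> k)))"
          using Cv H by (intro mult_left_mono whitney_measure_sum[OF W \<Omega>l]) auto
        finally show ?thesis by (simp add: mult_ac)
      qed
      have nn: "0 \<le> (LINT z|lebesgue. m z powr p)" by simp
      have "(\<Sum>k\<in>F. \<Sum>i\<in>H. \<bar>lam k i\<bar> powr p) \<le> (\<Sum>k\<in>F. (C0 powr p * (Cv * overlap)) * (2 powr (real_of_int k * p) * measure lebesgue (?\<Omega> k)))"
        by (rule sum_mono[OF inner])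
      also have "\<dots> = (C0 powr p * (Cv * overlap)) * (\<Sum>k\<in>F. 2 powr (real_of_int k * p) * measure lebesgue (?\<Omega> k))"
        by (simp add: sum_distrib_left)
      also have "\<dots> \<le> (C0 powr p * (Cv * overlap)) * (Cp * (LINT z|lebesgue. m z powr p))"
        using Cv by (intro mult_left_mono \<Omega>sum[OF F]) auto
      also have "\<dots> \<le> C * (LINT z|lebesgue. m z powr p)" unfolding C_def using nn by (simp add: algebra_simps)
      finally show ?thesis .
    qed
    have inner_conv: "Lp_tendsto q (\<lambda>r z. \<Sum>i<r. lam k i * a k i z) (\<lambda>z. G (k + 1) z - G k z) sequentially" for k
      unfolding lam_a
    proof (rule Lp_tendsto_dominated[OF q0])
      show "(\<lambda>z. \<Sum>i<r. P k i z) \<in> borel_measurable lebesgue" for r by measurable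
      show "(\<lambda>z. G (k + 1) z - G k z) \<in> borel_measurable lebesgue" by measurable
      show "integrable lebesgue (\<lambda>z. (overlap * (C0 * ?c k) * indicator (?\<Omega> k) z) powr q)"
      proof -
        have "integrable lebesgue (\<lambda>z. (overlap * (C0 * ?c k)) powr q * indicator (?\<Omega> k) z)"
          using \<Omega>l[of k] by (intro integrable_mult_right) (simp add: lmeasurable_iff_integrable)
        moreover have "(overlap * (C0 * ?c k) * indicator (?\<Omega> k) z) powr q = (overlap * (C0 * ?c k)) powr q * indicator (?\<Omega> k) z" for z
          by (simp add: indicator_def)
        ultimately show ?thesis by simp
      qed
      show "(\<lambda>r. \<Sum>i<r. P k i z) \<longlonglongrightarrow> G (k + 1) z - G k z" for z
        using pieces_sum[OF W W sub loc fm] unfolding P_def G_def sums_def .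
      show "AE z in lebesgue. \<forall>r. \<bar>\<Sum>i<r. P k i z\<bar> \<le> overlap * (C0 * ?c k) * indicator (?\<Omega> k) z"
        using P_bd
      proof eventually_elim
        case (elim z)
        have b: "\<bar>P k i z\<bar> \<le> C0 * ?c k" for i using elim by blast
        show ?case
        proof (cases "z \<in> ?\<Omega> k")
          case True
          then show ?thesis using overlap_sum(2)[OF W, of "\<lambda>i. P k i z", OF Ploc b] by simp
        next
          case False
          then have "P k i z = 0" for i using overlap_sum(6)[OF W, of "\<lambda>i. P k i z", OF Ploc b] by blast
          then show ?thesis using False by simp
        qed
      qed
    qed
    have A_Lq: "A k \<in> Lp_space q" and A_int: "(LINT z|lebesgue. \<bar>A k z\<bar> powr q) \<le> ((overlap * Ka) * ?c k) powr q * measure lebesgue (?\<Omega> k)" for k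
    proof -
      have w: "integrable lebesgue (\<lambda>z. ((overlap * Ka) * ?c k) powr q * indicator (?\<Omega> k) z)"
        using \<Omega>l[of k] by (intro integrable_mult_right) (simp add: lmeasurable_iff_integrable)
      have b: "AE z in lebesgue. norm (A k z) powr q \<le> ((overlap * Ka) * ?c k) powr q * indicator (?\<Omega> k) z"
      proof (rule AE_I2)
        fix z
        have "norm (A k z) powr q \<le> ((overlap * Ka) * ?c k * indicator (?\<Omega> k) z) powr q"
          using A_bd[of k z] q0 by (intro powr_mono2) auto
        also have "\<dots> = ((overlap * Ka) * ?c k) powr q * indicator (?\<Omega> k) z" by (simp add: indicator_def)
        finally show "norm (A k z) powr q \<le> ((overlap * Ka) * ?c k) powr q * indicator (?\<Omega> k) z" .
      qed
      show "A k \<in> Lp_space q" by (rule Lp_space_bound(1)[OF Am w b])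
      show "(LINT z|lebesgue. \<bar>A k z\<bar> powr q) \<le> ((overlap * Ka) * ?c k) powr q * measure lebesgue (?\<Omega> k)"
        using Lp_space_bound(2)[OF Am w b] by simp
    qed
    have cut: "(\<lambda>z. indicator S z * f z) \<in> Lp_space q" "(LINT z|lebesgue. norm (indicator S z * f z) powr q) = (LINT z|lebesgue. indicator S z * \<bar>f z\<bar> powr q)"
      if [measurable]: "S \<in> sets lebesgue" for S
    proof -
      have eq: "norm (indicator S z * f z) powr q = indicator S z * \<bar>f z\<bar> powr q" for z by (simp add: indicator_def)
      have "integrable lebesgue (\<lambda>z. indicator S z * \<bar>f z\<bar> powr q)" using integrable_mult_indicator[OF that iq] by simp
      moreover have "(\<lambda>z. indicator S z * f z) \<in> borel_measurable lebesgue" by measurable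
      ultimately show "(\<lambda>z. indicator S z * f z) \<in> Lp_space q" unfolding Lp_space_def mem_Collect_eq eq by blast
      show "(LINT z|lebesgue. norm (indicator S z * f z) powr q) = (LINT z|lebesgue. indicator S z * \<bar>f z\<bar> powr q)"
        unfolding eq ..
    qed
    have compl: "- ?\<Omega> k \<in> sets lebesgue" for k by (simp add: Compl_in_sets_lebesgue)
    have A0: "A k z = 0" if "z \<notin> ?\<Omega> k" for k z using A_bd[of k z] that by simp
    have G_split: "G k z = indicator (- ?\<Omega> k) z * f z + A k z" for k z using A0 by (simp add: G_eq)
    have G_Lq: "G k \<in> Lp_space q" for k
      using Lp_space_add(1)[OF cut(1)[OF compl] A_Lq q0, of k] by (simp add: G_split[abs_def])
    \<comment> \<open>The maximal function is finite almost everywhere, so the level sets shrink to a null set.\<close>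
    have shrink: "(\<lambda>n. LINT z|lebesgue. indicator (?\<Omega> (int n)) z * \<bar>f z\<bar> powr q) \<longlonglongrightarrow> (LINT z|(lebesgue :: (real^'n) measure). 0)"
    proof (rule integral_dominated_convergence[OF _ _ iq])
      show "AE z in lebesgue. (\<lambda>n. indicator (?\<Omega> (int n)) z * \<bar>f z\<bar> powr q) \<longlonglongrightarrow> 0"
        using le
      proof eventually_elim
        case (elim z)
        obtain n0 :: nat where n0: "m z \<le> real n0" using real_arch_simple by blast
        have "z \<notin> ?\<Omega> (int n)" if "n0 \<le> n" for n
        proof -
          have "m z \<le> real n" using n0 that by linarith
          also have "\<dots> \<le> 2 powr real_of_int (int n)" by (simp add: powr_realpow less_imp_le)
          finally have "maximal N f z \<le> ennreal (?c (int n))" using elim by (meson ennreal_leI order_trans)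
          then show ?thesis by (simp add: level_def not_less)
        qed
        then show ?case by (intro tendsto_eventually eventually_sequentiallyI[of n0]) auto
      qed
      show "AE z in lebesgue. norm (indicator (?\<Omega> (int n)) z * \<bar>f z\<bar> powr q) \<le> \<bar>f z\<bar> powr q" for n
        by (intro AE_I2) (simp add: indicator_def)
    qed measurable
    \<comment> \<open>The good function differs from \<open>f\<close> only on the level set, where both are controlled by \<open>f\<close>
      in \<open>L\<^sup>q\<close>.\<close>
    have up: "Lp_tendsto q (\<lambda>n. G (int n)) f sequentially"
      unfolding Lp_tendsto_iff[OF q0]
    proof (intro conjI fq always_eventually allI G_Lq)
      define J where "J = (\<lambda>n. LINT z|lebesgue. indicator (?\<Omega> (int n)) z * \<bar>f z\<bar> powr q)"
      have bound: "(LINT z|lebesgue. norm (G (int n) z - f z) powr q) \<le> 2 powr q * (J n + Kq * J n)" for n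
      proof -
        have "G (int n) z - f z = - (indicator (?\<Omega> (int n)) z * f z) + A (int n) z" for z using A0 by (simp add: G_eq)
        then have "(LINT z|lebesgue. norm (G (int n) z - f z) powr q)
            \<le> 2 powr q * ((LINT z|lebesgue. norm (- (indicator (?\<Omega> (int n)) z * f z)) powr q) + (LINT z|lebesgue. norm (A (int n) z) powr q))"
          using Lp_space_add(2)[OF Lp_space_uminus[OF cut(1)[OF level_sets]] A_Lq q0, of N f "int n"] by simp
        also have "(LINT z|lebesgue. norm (- (indicator (?\<Omega> (int n)) z * f z)) powr q) = J n"
          unfolding norm_minus_cancel cut(2)[OF level_sets] J_def ..
        also have "(LINT z|lebesgue. norm (A (int n) z) powr q) \<le> Kq * J n"
          unfolding A_def J_def real_norm_def by (rule Kq_bound[OF fq W \<Omega>l c0 out])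
        finally show ?thesis by simp
      qed
      have "J \<longlonglongrightarrow> 0" using shrink by (simp add: J_def)
      then have "(\<lambda>n. 2 powr q * (J n + Kq * J n)) \<longlonglongrightarrow> 2 powr q * (0 + Kq * 0)"
        by (intro tendsto_mult tendsto_add tendsto_const)
      then have lim: "(\<lambda>n. 2 powr q * (J n + Kq * J n)) \<longlonglongrightarrow> 0" by simp
      show "(\<lambda>n. LINT z|lebesgue. norm (G (int n) z - f z) powr q) \<longlonglongrightarrow> 0"
        by (rule tendsto_sandwich[OF _ _ tendsto_const lim]) (use bound in auto)
    qed
    have c_lim: "(\<lambda>n. ?c (- int n)) \<longlonglongrightarrow> 0"
    proof -
      have "?c (- int n) = (1 / 2) ^ n" for n
        using powr_minus_divide[of 2 "real n"] powr_realpow[of 2 n] by (simp add: power_one_over)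
      moreover have "(\<lambda>n. (1 / 2 :: real) ^ n) \<longlonglongrightarrow> 0" by (rule LIMSEQ_power_zero) simp
      ultimately show ?thesis by simp
    qed
    \<comment> \<open>The level sets exhaust the set where the maximal function is positive, and \<open>f\<close> vanishes
      almost everywhere off that set.\<close>
    have grow: "(\<lambda>n. LINT z|lebesgue. indicator (- ?\<Omega> (- int n)) z * \<bar>f z\<bar> powr q) \<longlonglongrightarrow> (LINT z|(lebesgue :: (real^'n) measure). 0)"
    proof (rule integral_dominated_convergence[OF _ _ iq])
      show "(\<lambda>z. indicator (- ?\<Omega> (- int n)) z * \<bar>f z\<bar> powr q) \<in> borel_measurable lebesgue" for n
        by (intro borel_measurable_times borel_measurable_indicator compl) measurable
      show "AE z in lebesgue. (\<lambda>n. indicator (- ?\<Omega> (- int n)) z * \<bar>f z\<bar> powr q) \<longlonglongrightarrow> 0"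
        using Kf_AE[OF fq order_refl]
      proof eventually_elim
        case (elim z)
        show ?case
        proof (cases "maximal N f z = 0")
          case True
          then have "f z = 0" using elim by simp
          then show ?thesis by simp
        next
          case False
          have "(\<lambda>n. ennreal (?c (- int n))) \<longlonglongrightarrow> ennreal 0" by (intro tendsto_ennrealI c_lim)
          then have "\<forall>\<^sub>F n in sequentially. ennreal (?c (- int n)) < maximal N f z"
            using False by (intro order_tendstoD(2)) (auto simp: zero_less_iff_neq_zero)
          then have "\<forall>\<^sub>F n in sequentially. indicator (- ?\<Omega> (- int n)) z * \<bar>f z\<bar> powr q = 0"
            by eventually_elim (simp add: level_def)
          then show ?thesis by (rule tendsto_eventually)
        qed
      qed
      show "AE z in lebesgue. norm (indicator (- ?\<Omega> (- int n)) z * \<bar>f z\<bar> powr q) \<le> \<bar>f z\<bar> powr q" for n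
        by (intro AE_I2) (simp add: indicator_def)
    qed simp
    \<comment> \<open>On the level set of height \<open>c = 2 powr k\<close> the good function is bounded by a multiple of
      \<open>c\<close>, and the measure of the set by a multiple of \<open>c powr (- p)\<close>; the product
      \<open>c powr (q - p)\<close> tends to zero as \<open>k\<close> tends to minus infinity because \<open>p < q\<close>.\<close>
    have down: "Lp_tendsto q (\<lambda>n z. - G (- int n) z) (\<lambda>z. 0) sequentially"
      unfolding Lp_tendsto_iff[OF q0]
    proof (intro conjI always_eventually allI Lp_space_uminus G_Lq)
      show "(\<lambda>z. 0 :: real) \<in> Lp_space q" by (simp add: Lp_space_def)
      define J where "J = (\<lambda>n. LINT z|lebesgue. indicator (- ?\<Omega> (- int n)) z * \<bar>f z\<bar> powr q)"
      define Mp where "Mp = (LINT z|lebesgue. m z powr p)"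
      have bound: "(LINT z|lebesgue. norm (- G (- int n) z - 0) powr q)
          \<le> 2 powr q * (J n + (overlap * Ka) powr q * (?c (- int n) powr (q - p) * (Cp * Mp)))" for n
      proof -
        have "(LINT z|lebesgue. norm (- G (- int n) z - 0) powr q)
            \<le> 2 powr q * ((LINT z|lebesgue. norm (indicator (- ?\<Omega> (- int n)) z * f z) powr q) + (LINT z|lebesgue. norm (A (- int n) z) powr q))"
          unfolding diff_0_right norm_minus_cancel G_split by (rule Lp_space_add(2)[OF cut(1)[OF compl] A_Lq q0])
        also have "(LINT z|lebesgue. norm (indicator (- ?\<Omega> (- int n)) z * f z) powr q) = J n"
          unfolding cut(2)[OF compl] J_def ..
        also have "(LINT z|lebesgue. norm (A (- int n) z) powr q) \<le> (overlap * Ka) powr q * (?c (- int n) powr (q - p) * (Cp * Mp))"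
        proof -
          let ?k = "- int n"
          have "2 powr (real_of_int ?k * p) * measure lebesgue (?\<Omega> ?k) \<le> Cp * Mp" using \<Omega>sum[of "{?k}"] by (simp add: Mp_def)
          then have *: "?c ?k powr (q - p) * (2 powr (real_of_int ?k * p) * measure lebesgue (?\<Omega> ?k)) \<le> ?c ?k powr (q - p) * (Cp * Mp)"
            by (rule mult_left_mono) simp
          have "(LINT z|lebesgue. norm (A ?k z) powr q) \<le> ((overlap * Ka) * ?c ?k) powr q * measure lebesgue (?\<Omega> ?k)"
            using A_int[of ?k] by simp
          also have "((overlap * Ka) * ?c ?k) powr q = (overlap * Ka) powr q * (?c ?k powr (q - p) * 2 powr (real_of_int ?k * p))"
          proof -
            have "real_of_int ?k * (q - p) + real_of_int ?k * p = real_of_int ?k * q" by (simp add: right_diff_distrib)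
            then have "?c ?k powr (q - p) * 2 powr (real_of_int ?k * p) = ?c ?k powr q"
              unfolding powr_powr powr_add[symmetric] by (rule arg_cong)
            then show ?thesis unfolding powr_mult by (rule arg_cong[OF sym])
          qed
          also have "\<dots> * measure lebesgue (?\<Omega> ?k) = (overlap * Ka) powr q * (?c ?k powr (q - p) * (2 powr (real_of_int ?k * p) * measure lebesgue (?\<Omega> ?k)))"
            by (simp only: mult.assoc)
          also have "\<dots> \<le> (overlap * Ka) powr q * (?c ?k powr (q - p) * (Cp * Mp))" by (rule mult_left_mono[OF *]) simp
          finally show ?thesis .
        qed
        finally show ?thesis by simp
      qed
      have "J \<longlonglongrightarrow> 0" using grow by (simp add: J_def)
      moreover have "(\<lambda>n. ?c (- int n) powr (q - p)) \<longlonglongrightarrow> 0"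
        by (rule tendsto_zero_powrI[OF c_lim tendsto_const]) (use pq in auto)
      ultimately have "(\<lambda>n. 2 powr q * (J n + (overlap * Ka) powr q * (?c (- int n) powr (q - p) * (Cp * Mp))))
          \<longlonglongrightarrow> 2 powr q * (0 + (overlap * Ka) powr q * (0 * (Cp * Mp)))"
        by (intro tendsto_mult tendsto_add tendsto_const)
      then have lim: "(\<lambda>n. 2 powr q * (J n + (overlap * Ka) powr q * (?c (- int n) powr (q - p) * (Cp * Mp)))) \<longlonglongrightarrow> 0" by simp
      show "(\<lambda>n. LINT z|lebesgue. norm (- G (- int n) z - 0) powr q) \<longlonglongrightarrow> 0"
        by (rule tendsto_sandwich[OF _ _ tendsto_const lim]) (use bound in auto)
    qed
    let ?FF = "at_bot \<times>\<^sub>F at_top :: (int \<times> int) filter"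
    have s1: "filterlim (\<lambda>x. nat (snd x + 1)) sequentially ?FF"
      unfolding filterlim_at_top
    proof
      fix Z :: nat
      have "\<forall>\<^sub>F x in ?FF. fst x \<le> 0 \<and> int Z \<le> snd x"
        by (rule eventually_prodI[OF eventually_le_at_bot eventually_ge_at_top])
      then show "\<forall>\<^sub>F x in ?FF. Z \<le> nat (snd x + 1)" by eventually_elim auto
    qed
    have s2: "filterlim (\<lambda>x. nat (- fst x)) sequentially ?FF"
      unfolding filterlim_at_top
    proof
      fix Z :: nat
      have "\<forall>\<^sub>F x in ?FF. fst x \<le> - int Z \<and> 0 \<le> snd x"
        by (rule eventually_prodI[OF eventually_le_at_bot eventually_ge_at_top])
      then show "\<forall>\<^sub>F x in ?FF. Z \<le> nat (- fst x)" by eventually_elim auto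
    qed
    \<comment> \<open>The series telescopes to \<open>G (m + 1) - G l\<close>, and the two ends tend to their limits
      independently.\<close>
    have both: "Lp_tendsto q (\<lambda>x z. G (int (nat (snd x + 1))) z + - G (- int (nat (- fst x))) z) f ?FF"
      using Lp_tendsto_add[OF Lp_tendsto_compose[OF up s1] Lp_tendsto_compose[OF down s2] q0] by simp
    have ev: "\<forall>\<^sub>F x in ?FF. (\<lambda>z. G (int (nat (snd x + 1))) z + - G (- int (nat (- fst x))) z)
        = (case x of (l, m) \<Rightarrow> \<lambda>z. \<Sum>k=l..m. G (k + 1) z - G k z)"
    proof -
      have "\<forall>\<^sub>F x in ?FF. fst x \<le> 0 \<and> 0 \<le> snd x"
        by (rule eventually_prodI[OF eventually_le_at_bot eventually_ge_at_top])
      then show ?thesis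
      proof eventually_elim
        case (elim x)
        then have "(\<Sum>k=fst x..snd x. G (k + 1) z - G k z) = G (snd x + 1) z - G (fst x) z" for z
          by (intro sum_int_telescope) auto
        then show ?case using elim by (simp add: case_prod_beta)
      qed
    qed
    have outer: "Lp_tendsto q (\<lambda>(l, m) z. \<Sum>k=l..m. G (k + 1) z - G k z) f ?FF"
      by (rule Lp_tendsto_cong[OF both ev])
    show ?thesis
      by (intro exI[of _ a] exI[of _ lam] exI[of _ "\<lambda>k z. G (k + 1) z - G k z"] conjI allI impI atom lam_sum inner_conv outer)
  qed
  show ?thesis
  proof (intro exI[of _ C] conjI allI impI)
    show "0 < C" by (rule C)
  qed (rule key)
qed

end

section \<open>Complex-valued functions\<close>

text \<open>Interleaving two rows of atoms as the even and the odd entries of one row.\<close>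

lemma sum_interleave:
  fixes u v :: "nat \<Rightarrow> complex"
  shows "(\<Sum>i<r. if even i then u (i div 2) else v (i div 2)) = (\<Sum>i<(r + 1) div 2. u i) + (\<Sum>i<r div 2. v i)"
proof (induction r)
  case (Suc r)
  show ?case
  proof (cases "even r")
    case True
    then have "(Suc r + 1) div 2 = Suc (r div 2)" "(r + 1) div 2 = r div 2" "Suc r div 2 = r div 2" by auto
    then show ?thesis using Suc True by simp
  next
    case False
    then have "(Suc r + 1) div 2 = (r + 1) div 2" "Suc r div 2 = Suc (r div 2)" by (auto elim!: oddE)
    then show ?thesis using Suc False by simp
  qed
qed simp

lemma infsum_ennreal_le:
  fixes h :: "int \<Rightarrow> nat \<Rightarrow> real"
  assumes nn: "\<And>k i. 0 \<le> h k i" and B: "\<And>F H. finite F \<Longrightarrow> finite H \<Longrightarrow> (\<Sum>k\<in>F. \<Sum>i\<in>H. h k i) \<le> B"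
  shows "(\<Sum>\<^sub>\<infinity>k. \<Sum>\<^sub>\<infinity>i. ennreal (h k i)) \<le> ennreal B"
proof -
  have fin: "(\<Sum>k\<in>F. \<Sum>\<^sub>\<infinity>i. ennreal (h k i)) \<le> ennreal B" if F: "finite F" for F
  proof -
    have hs: "((\<lambda>i. ennreal (h k i)) has_sum (\<Sum>\<^sub>\<infinity>i. ennreal (h k i))) UNIV" for k
      by (intro has_sum_infsum nonneg_summable_on_complete) simp
    have "((\<lambda>i. \<Sum>k\<in>F. ennreal (h k i)) has_sum (\<Sum>k\<in>F. \<Sum>\<^sub>\<infinity>i. ennreal (h k i))) UNIV"
      using F
    proof (induction F rule: finite_induct)
      case empty then show ?case by simp
    next
      case (insert k F)
      from has_sum_add[OF hs[of k] insert.IH] show ?case using insert by simp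
    qed
    then have "(\<Sum>k\<in>F. \<Sum>\<^sub>\<infinity>i. ennreal (h k i)) = (\<Sum>\<^sub>\<infinity>i. \<Sum>k\<in>F. ennreal (h k i))" by (rule infsumI[symmetric])
    also have "\<dots> = (SUP H\<in>{H. finite H \<and> H \<subseteq> UNIV}. \<Sum>i\<in>H. \<Sum>k\<in>F. ennreal (h k i))"
      by (rule nonneg_infsum_complete) simp
    also have "\<dots> \<le> ennreal B"
    proof (rule SUP_least)
      fix H :: "nat set" assume "H \<in> {H. finite H \<and> H \<subseteq> UNIV}"
      then have "(\<Sum>k\<in>F. \<Sum>i\<in>H. h k i) \<le> B" using B F by blast
      moreover have "(\<Sum>i\<in>H. \<Sum>k\<in>F. ennreal (h k i)) = ennreal (\<Sum>i\<in>H. \<Sum>k\<in>F. h k i)"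
        using nn by (simp add: sum_ennreal sum_nonneg)
      ultimately show "(\<Sum>i\<in>H. \<Sum>k\<in>F. ennreal (h k i)) \<le> ennreal B"
        by (subst (asm) sum.swap) (simp add: ennreal_leI)
    qed
    finally show ?thesis .
  qed
  have "(\<Sum>\<^sub>\<infinity>k. \<Sum>\<^sub>\<infinity>i. ennreal (h k i)) = (SUP F\<in>{F. finite F \<and> F \<subseteq> UNIV}. \<Sum>k\<in>F. \<Sum>\<^sub>\<infinity>i. ennreal (h k i))"
    by (rule nonneg_infsum_complete) simp
  also have "\<dots> \<le> ennreal B" by (rule SUP_least) (use fin in auto)
  finally show ?thesis .
qed

text \<open>Each value of \<open>i div 2\<close> is taken at most twice.\<close>

lemma sum_div2_le:
  fixes h :: "nat \<Rightarrow> real"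
  assumes "finite H" "\<And>i. 0 \<le> h i"
  shows "(\<Sum>i\<in>{i\<in>H. P i}. h (i div 2)) \<le> 2 * (\<Sum>j\<in>(\<lambda>i. i div 2) ` H. h j)"
proof -
  have "(\<Sum>i\<in>{i\<in>H. P i}. h (i div 2)) \<le> (\<Sum>i\<in>H. h (i div 2))" using assms by (intro sum_mono2) auto
  also have "\<dots> = (\<Sum>j\<in>(\<lambda>i. i div 2) ` H. \<Sum>i\<in>{i\<in>H. i div 2 = j}. h (i div 2))"
    by (rule sum.image_gen[OF assms(1)])
  also have "\<dots> \<le> (\<Sum>j\<in>(\<lambda>i. i div 2) ` H. 2 * h j)"
  proof (rule sum_mono)
    fix j assume "j \<in> (\<lambda>i. i div 2) ` H"
    have "{i\<in>H. i div 2 = j} \<subseteq> {2 * j, 2 * j + 1}" by auto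
    then have "card {i\<in>H. i div 2 = j} \<le> card {2 * j, 2 * j + 1}" by (intro card_mono) auto
    then have "card {i\<in>H. i div 2 = j} \<le> 2" by simp
    then have "real (card {i\<in>H. i div 2 = j}) * h j \<le> 2 * h j" using assms(2) by (intro mult_right_mono) auto
    then show "(\<Sum>i\<in>{i\<in>H. i div 2 = j}. h (i div 2)) \<le> 2 * h j" by simp
  qed
  finally show ?thesis by (simp add: sum_distrib_left)
qed

text \<open>Real and imaginary part share the majorant, a multiple of the radial grand maximal function of
  \<open>f\<close>. Their atoms are interleaved into one sequence at each height, the coefficients of the
  imaginary part carrying the factor \<open>\<i>\<close>.\<close>

lemma (in ellipsoid_cover) complex_atomic_decomposition:
  assumes p: "0 < p" and q: "1 < q" and pq: "p < q"
  shows "\<exists>C>0. \<forall>f :: real^'n \<Rightarrow> complex.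
    f \<in> Lp_space q \<longrightarrow> distribution_of f \<in> Hp M a4 a6 p \<longrightarrow>
    (\<exists>(a :: int \<Rightarrow> nat \<Rightarrow> real^'n \<Rightarrow> real) (lam :: int \<Rightarrow> nat \<Rightarrow> complex).
       (\<forall>k i. is_atom M p l (a k i)) \<and>
       (\<Sum>\<^sub>\<infinity>k. \<Sum>\<^sub>\<infinity>i. ennreal (cmod (lam k i) powr p))
         \<le> ennreal (C * Hp_norm M a4 a6 p (distribution_of f) powr p) \<and>
       Lp_double_sums q (\<lambda>k i x. lam k i * complex_of_real (a k i x)) f)"
proof -
  define N where "N = Np CARD('n) a4 a6 p"
  have q0: "0 < q" using q by simp
  obtain Cr where Cr: "0 < Cr" and radial: "\<And>f :: real^'n \<Rightarrow> complex. (\<forall>r. integrable lebesgue (\<lambda>z. indicator (cball 0 r) z *\<^sub>R f z)) \<Longrightarrow>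
     \<forall>x. maximal N (\<lambda>z. Re (f z)) x \<le> ennreal Cr * radial_grand_maximal M a4 a6 p (distribution_of f) x \<and>
          maximal N (\<lambda>z. Im (f z)) x \<le> ennreal Cr * radial_grand_maximal M a4 a6 p (distribution_of f) x"
    using maximal_le_radial[of p] unfolding N_def by blast
  obtain C1 where C1: "0 < C1" and decomposition: "\<forall>f m. f \<in> Lp_space q \<longrightarrow> m \<in> borel_measurable lebesgue \<longrightarrow> (\<forall>z. 0 \<le> m z) \<longrightarrow>
     integrable lebesgue (\<lambda>z. m z powr p) \<longrightarrow> (AE z in lebesgue. maximal N f z \<le> ennreal (m z)) \<longrightarrow>
     (\<exists>a lam g. (\<forall>k i. is_atom M p l (a k i)) \<and>
        (\<forall>F H. finite F \<longrightarrow> finite H \<longrightarrow> (\<Sum>k\<in>F. \<Sum>i\<in>H. \<bar>lam k i\<bar> powr p) \<le> C1 * (LINT z|lebesgue. m z powr p)) \<and>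
        (\<forall>k::int. Lp_tendsto q (\<lambda>r z. \<Sum>i<r::nat. lam k i * a k i z) (g k) sequentially) \<and>
        Lp_tendsto q (\<lambda>(l, m) z. \<Sum>k=l..m. g k z) f (at_bot \<times>\<^sub>F at_top))"
    using real_atomic_decomposition[OF p q pq, of N l] by (elim exE conjE) (rule that)
  define C where "C = 4 * C1 * Cr powr p"
  have C: "0 < C" using C1 Cr by (simp add: C_def)
  have key: "\<exists>(a :: int \<Rightarrow> nat \<Rightarrow> real^'n \<Rightarrow> real) (lam :: int \<Rightarrow> nat \<Rightarrow> complex).
       (\<forall>k i. is_atom M p l (a k i)) \<and>
       (\<Sum>\<^sub>\<infinity>k. \<Sum>\<^sub>\<infinity>i. ennreal (cmod (lam k i) powr p))
         \<le> ennreal (C * Hp_norm M a4 a6 p (distribution_of f) powr p) \<and>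
       Lp_double_sums q (\<lambda>k i x. lam k i * complex_of_real (a k i x)) f"
    if fq: "f \<in> Lp_space q" and fH: "distribution_of f \<in> Hp M a4 a6 p" for f :: "real^'n \<Rightarrow> complex"
  proof -
    let ?R = "radial_grand_maximal M a4 a6 p (distribution_of f)"
    have fm[measurable]: "f \<in> borel_measurable lebesgue" and fi: "integrable lebesgue (\<lambda>z. cmod (f z) powr q)"
      using Lp_spaceD[OF fq] by auto
    have abs: "(\<lambda>z. cmod (f z)) \<in> Lp_space q" using fi by (simp add: Lp_space_def)
    have ReIm: "(\<lambda>z. Re (f z)) \<in> Lp_space q" "(\<lambda>z. Im (f z)) \<in> Lp_space q"
      using q0 abs_Re_le_cmod abs_Im_le_cmod
      by (auto intro!: Lp_space_bound(1)[OF _ fi] AE_I2 powr_mono2)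
    have loc: "integrable lebesgue (\<lambda>z. indicator (cball 0 r) z *\<^sub>R f z)" for r
    proof (rule Bochner_Integration.integrable_bound[OF Lq_integral_bound(1)[OF abs q lmeasurable_cball, of 0 r]])
      have [measurable]: "cball 0 r \<in> sets (lebesgue :: (real^'n) measure)" by (rule fmeasurableD[OF lmeasurable_cball])
      show "(\<lambda>z. indicator (cball 0 r) z *\<^sub>R f z) \<in> borel_measurable lebesgue" by measurable
    qed (auto intro!: AE_I2)
    define m where "m = (\<lambda>z. Cr * enn2real (?R z))"
    have R: "?R \<in> borel_measurable lebesgue" "AE x in lebesgue. ?R x < \<infinity>" "integrable lebesgue (\<lambda>z. enn2real (?R z) powr p)"
      using fH by (auto simp: Hp_def Lp_space_def)
    have m_powr: "m z powr p = Cr powr p * enn2real (?R z) powr p" for z using Cr by (simp add: m_def powr_mult)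
    have m: "m \<in> borel_measurable lebesgue" "\<forall>z. 0 \<le> m z" "integrable lebesgue (\<lambda>z. m z powr p)"
      using R Cr unfolding m_powr by (auto simp: m_def)
    have m_int: "(LINT z|lebesgue. m z powr p) = Cr powr p * Hp_norm M a4 a6 p (distribution_of f) powr p"
    proof -
      have nn: "0 \<le> (LINT z|lebesgue. enn2real (?R z) powr p)" by simp
      have "Hp_norm M a4 a6 p (distribution_of f) powr p = (LINT z|lebesgue. enn2real (?R z) powr p)"
        unfolding Hp_norm_def Lp_norm_def using p nn by (simp add: powr_powr)
      then show ?thesis unfolding m_powr by simp
    qed
    have le: "AE z in lebesgue. maximal N (\<lambda>z. Re (f z)) z \<le> ennreal (m z)" "AE z in lebesgue. maximal N (\<lambda>z. Im (f z)) z \<le> ennreal (m z)"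
    proof -
      have "AE z in lebesgue. maximal N (\<lambda>z. Re (f z)) z \<le> ennreal (m z) \<and> maximal N (\<lambda>z. Im (f z)) z \<le> ennreal (m z)"
        using R(2)
      proof eventually_elim
        case (elim z)
        have "ennreal Cr * ?R z = ennreal (m z)" using elim Cr by (simp add: m_def ennreal_mult)
        then show ?case using radial[of f] loc by (metis (no_types, lifting))
      qed
      then show "AE z in lebesgue. maximal N (\<lambda>z. Re (f z)) z \<le> ennreal (m z)" "AE z in lebesgue. maximal N (\<lambda>z. Im (f z)) z \<le> ennreal (m z)"
        by auto
    qed
    obtain b \<mu> g where b: "\<forall>k i. is_atom M p l (b k i)"
      and \<mu>: "\<forall>F H. finite F \<longrightarrow> finite H \<longrightarrow> (\<Sum>k\<in>F. \<Sum>i\<in>H. \<bar>\<mu> k i\<bar> powr p) \<le> C1 * (LINT z|lebesgue. m z powr p)"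
      and g: "\<forall>k::int. Lp_tendsto q (\<lambda>r z. \<Sum>i<r::nat. \<mu> k i * b k i z) (g k) sequentially"
        "Lp_tendsto q (\<lambda>(l, m) z. \<Sum>k=l..m. g k z) (\<lambda>z. Re (f z)) (at_bot \<times>\<^sub>F at_top)"
      using decomposition[rule_format, OF ReIm(1) m(1) _ m(3) le(1)] m(2) by auto
    obtain b' \<mu>' g' where b': "\<forall>k i. is_atom M p l (b' k i)"
      and \<mu>': "\<forall>F H. finite F \<longrightarrow> finite H \<longrightarrow> (\<Sum>k\<in>F. \<Sum>i\<in>H. \<bar>\<mu>' k i\<bar> powr p) \<le> C1 * (LINT z|lebesgue. m z powr p)"
      and g': "\<forall>k::int. Lp_tendsto q (\<lambda>r z. \<Sum>i<r::nat. \<mu>' k i * b' k i z) (g' k) sequentially"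
        "Lp_tendsto q (\<lambda>(l, m) z. \<Sum>k=l..m. g' k z) (\<lambda>z. Im (f z)) (at_bot \<times>\<^sub>F at_top)"
      using decomposition[rule_format, OF ReIm(2) m(1) _ m(3) le(2)] m(2) by auto
    define a where "a = (\<lambda>k i. if even i then b k (i div 2) else b' k (i div 2))"
    define lam where "lam = (\<lambda>k i. if even i then complex_of_real (\<mu> k (i div 2)) else \<i> * complex_of_real (\<mu>' k (i div 2)))"
    define h where "h = (\<lambda>k z. complex_of_real (g k z) + \<i> * complex_of_real (g' k z))"
    have atoms: "\<forall>k i. is_atom M p l (a k i)" using b b' by (simp add: a_def)
    have sum_bound: "(\<Sum>k\<in>F. \<Sum>i\<in>H. cmod (lam k i) powr p) \<le> C * Hp_norm M a4 a6 p (distribution_of f) powr p"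
      if F: "finite F" and H: "finite H" for F H
    proof -
      let ?H = "(\<lambda>i. i div 2) ` H"
      have "(\<Sum>i\<in>H. cmod (lam k i) powr p) \<le> 2 * (\<Sum>j\<in>?H. \<bar>\<mu> k j\<bar> powr p) + 2 * (\<Sum>j\<in>?H. \<bar>\<mu>' k j\<bar> powr p)" for k
      proof -
        have "(\<Sum>i\<in>H. cmod (lam k i) powr p) = (\<Sum>i\<in>H. if even i then \<bar>\<mu> k (i div 2)\<bar> powr p else \<bar>\<mu>' k (i div 2)\<bar> powr p)"
          by (rule sum.cong) (auto simp: lam_def norm_mult)
        also have "\<dots> = (\<Sum>i\<in>{i\<in>H. even i}. \<bar>\<mu> k (i div 2)\<bar> powr p) + (\<Sum>i\<in>{i\<in>H. odd i}. \<bar>\<mu>' k (i div 2)\<bar> powr p)"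
          using H by (simp add: sum.If_cases Int_def Collect_neg_eq[symmetric])
        also have "\<dots> \<le> 2 * (\<Sum>j\<in>?H. \<bar>\<mu> k j\<bar> powr p) + 2 * (\<Sum>j\<in>?H. \<bar>\<mu>' k j\<bar> powr p)"
          by (intro add_mono sum_div2_le[OF H]) auto
        finally show ?thesis .
      qed
      then have "(\<Sum>k\<in>F. \<Sum>i\<in>H. cmod (lam k i) powr p)
          \<le> (\<Sum>k\<in>F. 2 * (\<Sum>j\<in>?H. \<bar>\<mu> k j\<bar> powr p) + 2 * (\<Sum>j\<in>?H. \<bar>\<mu>' k j\<bar> powr p))" by (rule sum_mono)
      also have "\<dots> = 2 * (\<Sum>k\<in>F. \<Sum>j\<in>?H. \<bar>\<mu> k j\<bar> powr p) + 2 * (\<Sum>k\<in>F. \<Sum>j\<in>?H. \<bar>\<mu>' k j\<bar> powr p)"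
        by (simp add: sum.distrib sum_distrib_left)
      also have "\<dots> \<le> 2 * (C1 * (LINT z|lebesgue. m z powr p)) + 2 * (C1 * (LINT z|lebesgue. m z powr p))"
        using \<mu> \<mu>' F H by (intro add_mono mult_left_mono) auto
      also have "\<dots> = C * Hp_norm M a4 a6 p (distribution_of f) powr p" unfolding m_int C_def by simp
      finally show ?thesis .
    qed
    have double: "Lp_double_sums q (\<lambda>k i x. lam k i * complex_of_real (a k i x)) f"
      unfolding Lp_double_sums_def
    proof (intro exI[of _ h] conjI allI)
      fix k
      have d1: "\<forall>n\<ge>2 * Z. Z \<le> (n + 1) div 2" for Z :: nat by auto
      have d2: "\<forall>n\<ge>2 * Z. Z \<le> n div 2" for Z :: nat by auto
      have s1: "filterlim (\<lambda>r::nat. (r + 1) div 2) sequentially sequentially"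
        unfolding filterlim_at_top eventually_sequentially by (intro allI, rule exI, rule d1)
      have s2: "filterlim (\<lambda>r::nat. r div 2) sequentially sequentially"
        unfolding filterlim_at_top eventually_sequentially by (intro allI, rule exI, rule d2)
      have "Lp_tendsto q (\<lambda>r z. 1 * complex_of_real (\<Sum>i<(r + 1) div 2. \<mu> k i * b k i z) + \<i> * complex_of_real (\<Sum>i<r div 2. \<mu>' k i * b' k i z))
          (\<lambda>z. 1 * complex_of_real (g k z) + \<i> * complex_of_real (g' k z)) sequentially"
      proof (rule Lp_tendsto_add[OF _ _ q0])
        show "Lp_tendsto q (\<lambda>r z. 1 * complex_of_real (\<Sum>i<(r + 1) div 2. \<mu> k i * b k i z)) (\<lambda>z. 1 * complex_of_real (g k z)) sequentially"
          by (rule Lp_tendsto_complex[OF Lp_tendsto_compose[OF g(1)[rule_format] s1] q0]) simp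
        show "Lp_tendsto q (\<lambda>r z. \<i> * complex_of_real (\<Sum>i<r div 2. \<mu>' k i * b' k i z)) (\<lambda>z. \<i> * complex_of_real (g' k z)) sequentially"
          by (rule Lp_tendsto_complex[OF Lp_tendsto_compose[OF g'(1)[rule_format] s2] q0]) simp
      qed
      moreover have "1 * complex_of_real (\<Sum>i<(r + 1) div 2. \<mu> k i * b k i z) + \<i> * complex_of_real (\<Sum>i<r div 2. \<mu>' k i * b' k i z)
          = (\<Sum>i<r. lam k i * complex_of_real (a k i z))" for r z
      proof -
        have "(\<Sum>i<r. lam k i * complex_of_real (a k i z))
            = (\<Sum>i<r. if even i then complex_of_real (\<mu> k (i div 2) * b k (i div 2) z) else \<i> * complex_of_real (\<mu>' k (i div 2) * b' k (i div 2) z))"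
          by (rule sum.cong) (auto simp: lam_def a_def)
        also have "\<dots> = (\<Sum>i<(r + 1) div 2. complex_of_real (\<mu> k i * b k i z)) + (\<Sum>i<r div 2. \<i> * complex_of_real (\<mu>' k i * b' k i z))"
          by (rule sum_interleave[of "\<lambda>j. complex_of_real (\<mu> k j * b k j z)" "\<lambda>j. \<i> * complex_of_real (\<mu>' k j * b' k j z)"])
        finally show ?thesis by (simp add: sum_distrib_left)
      qed
      ultimately show "Lp_tendsto q (\<lambda>m z. \<Sum>i<m. lam k i * complex_of_real (a k i z)) (h k) sequentially"
        by (simp add: h_def)
    next
      have "Lp_tendsto q (\<lambda>x z. 1 * complex_of_real ((case x of (l, m) \<Rightarrow> \<lambda>z. \<Sum>k=l..m. g k z) z)
            + \<i> * complex_of_real ((case x of (l, m) \<Rightarrow> \<lambda>z. \<Sum>k=l..m. g' k z) z))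
          (\<lambda>z. 1 * complex_of_real (Re (f z)) + \<i> * complex_of_real (Im (f z))) (at_bot \<times>\<^sub>F at_top)"
        by (rule Lp_tendsto_add[OF Lp_tendsto_complex[OF g(2) q0] Lp_tendsto_complex[OF g'(2) q0] q0]) simp_all
      moreover have "(\<lambda>x z. 1 * complex_of_real ((case x of (l, m) \<Rightarrow> \<lambda>z. \<Sum>k=l..m. g k z) z)
            + \<i> * complex_of_real ((case x of (l, m) \<Rightarrow> \<lambda>z. \<Sum>k=l..m. g' k z) z)) = (\<lambda>(l, m) x. \<Sum>k=l..m. h k x)"
        by (intro ext) (auto simp: h_def sum.distrib sum_distrib_left split: prod.splits)
      moreover have "(\<lambda>z. 1 * complex_of_real (Re (f z)) + \<i> * complex_of_real (Im (f z))) = f"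
        by (intro ext) (simp add: complex_eq_iff)
      ultimately show "Lp_tendsto q (\<lambda>(l, m) x. \<Sum>k=l..m. h k x) f (at_bot \<times>\<^sub>F at_top)" by simp
    qed
    have "(\<Sum>\<^sub>\<infinity>k. \<Sum>\<^sub>\<infinity>i. ennreal (cmod (lam k i) powr p)) \<le> ennreal (C * Hp_norm M a4 a6 p (distribution_of f) powr p)"
      by (rule infsum_ennreal_le[OF _ sum_bound]) auto
    then show ?thesis using atoms double by blast
  qed
  show ?thesis
  proof (intro exI[of _ C] conjI allI impI)
    show "0 < C" by (rule C)
  qed (rule key)
qed

theorem theorem4p10:
  fixes M :: "real^'n \<Rightarrow> real \<Rightarrow> real^'n^'n"
    and a1 a2 a3 a4 a5 a6 p q :: real and l :: nat
  assumes "continuous_ellipsoid_cover M a1 a2 a3 a4 a5 a6"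
    and "0 < p" and "p \<le> 1" and "1 < q"
    and "Np CARD('n) a4 a6 p \<le> l"
  shows "\<exists>C>0. \<forall>f :: real^'n \<Rightarrow> complex.
    f \<in> Lp_space q \<longrightarrow> distribution_of f \<in> Hp M a4 a6 p \<longrightarrow>
    (\<exists>(a :: int \<Rightarrow> nat \<Rightarrow> real^'n \<Rightarrow> real) (lam :: int \<Rightarrow> nat \<Rightarrow> complex).
       (\<forall>k i. is_atom M p l (a k i)) \<and>
       (\<Sum>\<^sub>\<infinity>k. \<Sum>\<^sub>\<infinity>i. ennreal (cmod (lam k i) powr p))
         \<le> ennreal (C * Hp_norm M a4 a6 p (distribution_of f) powr p) \<and>
       Lp_double_sums q (\<lambda>k i x. lam k i * complex_of_real (a k i x)) f)"
proof -
  interpret ellipsoid_cover M a1 a2 a3 a4 a5 a6 by unfold_locales (rule assms(1))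
  show ?thesis by (rule complex_atomic_decomposition[OF assms(2,4)]) (use assms in simp)
qed

end
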